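(* Let $n\in\mathbb{N}$ and let $G=\mathbb{R}\oplus\mathbb{R}^n\oplus\mathbb{R}^n$ be the Carnot group with the path geometry structure. The cut locus $\mathrm{Cut}_0$ of sub-Riemannian geodesics issuing from the identity is formed by the points $(0,0,y)\in G$ and the points $(0,\ell,y)\in G$ such that $\ell\wedge y\neq 0$ and $$\pi|y|\cos^2\varphi\le|\ell|^2\sin\varphi,\qquad( * )$$ where $\varphi$ is the angle between the vectors $\ell,y\in\mathbb{R}^n$ and $|\cdot|$ denotes the Euclidean norm in $\mathbb{R}^n$. The corresponding cut time is given by $$t_{cut}=\begin{cases}\sqrt{4\pi|y|}&\text{if }\ell\wedge y=0,\\ \sqrt{4\pi|y|\sin\varphi+|\ell|^2}&\text{if }\ell\wedge y\neq0.\end{cases}$$ The points $(0,0,y)$ are also conjugate points, and they are reached by infinitely many optimal geodesics. The points $(0,\ell,y)$ in the cut locus (with $\ell\wedge y\neq0$) are reached by two optimal geodesics, and they are also conjugate points if and only if $( * )$ becomes an equality.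
   Context: The Carnot group with the path geometry structure (path group) is $G=\mathbb{R}\oplus\mathbb{R}^n\oplus\mathbb{R}^n$ with coordinates $(x,\ell,y)$, $x\in\mathbb{R}$, $\ell,y\in\mathbb{R}^n$, and group law $(x,\ell,y)\cdot(\tilde x,\tilde\ell,\tilde y)=(x+\tilde x,\ \ell+\tilde\ell,\ y+\tilde y+\tfrac12(\ell\tilde x-x\tilde\ell))$. Its left-invariant sub-Riemannian structure $(G,\Delta,g)$ has distribution $\Delta$ spanned by the left-invariant fields $X_0=\partial_x+\sum_{i=1}^n\frac{\ell_i}{2}\partial_{y_i}$, $X_i=\partial_{\ell_i}-\frac{x}{2}\partial_{y_i}$ ($i=1,\dots,n$), and the metric $g$ makes $X_0,\dots,X_n$ orthonormal. Geodesics are non-trivial horizontal curves (tangent to $\Delta$) parametrized by constant speed that locally minimize the length between their endpoints; here they are parametrized by arc length and start at the identity $0=(0,0,0)$. They are projections $\gamma(t)=\exp(t\lambda_0)$ of integral curves of the Hamiltonian vector field on $T^*G$ of $H(\lambda)=\frac12\sum_{a=0}^n\langle\lambda,X_a\rangle^2$ starting at $\lambda_0\in T_0^*G$ with $H(\lambda_0)=\frac12$; $\exp:T_0^*G\to G$ is the exponential map. The cut time of a geodesic $\gamma$ is $t_{cut}(\gamma)=\sup\{t>0:\gamma|_{[0,t]}\text{ is a (globally length-)minimizing geodesic}\}$; the point $\gamma(t_{cut}(\gamma))$ is the cut point, and the cut locus $\mathrm{Cut}_0$ is the set of all cut points of geodesics issuing from $0$. The first conjugate time of $\gamma(t)=\exp(t\lambda_0)$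 is $t_{conj}(\gamma)=\inf\{t>0:t\lambda_0\text{ is a critical point of }\exp\}$, and $\gamma(t_{conj}(\gamma))$ is the first conjugate point to $0$ along $\gamma$; conjugate points correspond to critical points of the exponential map. The condition $\ell\wedge y\ne0$ means that $\ell,y$ are linearly independent (then $\varphi\in(0,\pi)$). "Optimal" means globally length-minimizing from $0$ to the given point.
   Formalization: Points (0,0,y) are taken with y ≠ 0, as the identity is not a cut point; the two optimal geodesics to (0,ℓ,y) are distinct exactly when ( * ) is strict and coincide when it is an equality; conjugate means first conjugate along the optimal geodesics. *)

theory Defs
  imports "HOL-Analysis.Analysis"
begin

type_synonym 'n pgroup = "real \<times> (real ^ 'n) \<times> (real ^ 'n)"

fun pg_mult :: "'n::finite pgroup \<Rightarrow> 'n pgroup \<Rightarrow> 'n pgroup" where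
  "pg_mult (x, l, y) (x', l', y') =
     (x + x', l + l', y + y' + (1/2) *\<^sub>R (x' *\<^sub>R l - x *\<^sub>R l'))"

text \<open>The index \<^term>\<open>None\<close> stands for $0$ and \<^term>\<open>Some i\<close> for the $n$ indices $i = 1, \ldots, n$.\<close>

fun frame :: "'n::finite option \<Rightarrow> 'n pgroup \<Rightarrow> 'n pgroup" where
  "frame None (x, l, y) = (1, 0, (1/2) *\<^sub>R l)"
| "frame (Some i) (x, l, y) = (0, axis i 1, - (x/2) *\<^sub>R axis i 1)"

lemma pg_mult_assoc: "pg_mult (pg_mult p q) r = pg_mult p (pg_mult q r)"
  by (cases p; cases q; cases r) (simp add: algebra_simps scaleR_add_left)

lemma pg_mult_0: "pg_mult 0 q = q" "pg_mult q 0 = q"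
  by (cases q; simp add: zero_prod_def)+

lemma pg_mult_minus: "pg_mult (- q) q = 0" "pg_mult q (- q) = 0"
  by (cases q; simp add: zero_prod_def)+

lemma frame_left_invariant:
  assumes "((\<lambda>q. pg_mult p q) has_derivative D) (at q)"
  shows "D (frame a q) = frame a (pg_mult p q)"
proof -
  obtain x l y where p: "p = (x, l, y)" by (cases p)
  have eq: "(\<lambda>q. pg_mult p q) = (\<lambda>q. (x + fst q, l + fst (snd q),
      y + snd (snd q) + (1/2) *\<^sub>R (fst q *\<^sub>R l - x *\<^sub>R fst (snd q))))"
    by (auto simp: p fun_eq_iff)
  have "((\<lambda>q. pg_mult p q) has_derivative (\<lambda>v. (fst v, fst (snd v),
      snd (snd v) + (1/2) *\<^sub>R (fst v *\<^sub>R l - x *\<^sub>R fst (snd v))))) (at q)"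
    unfolding eq by (auto intro!: derivative_eq_intros)
  then have D: "D = (\<lambda>v. (fst v, fst (snd v),
      snd (snd v) + (1/2) *\<^sub>R (fst v *\<^sub>R l - x *\<^sub>R fst (snd v))))"
    using assms has_derivative_unique by blast
  show ?thesis
    by (cases q; cases a) (simp_all add: D p algebra_simps add_divide_distrib)
qed

definition distribution :: "'n::finite pgroup \<Rightarrow> 'n pgroup set" where
  "distribution q = span (range (\<lambda>a. frame a q))"

text \<open>The norm of the metric for which the frame is orthonormal.\<close>

definition sr_norm :: "'n::finite pgroup \<Rightarrow> 'n pgroup \<Rightarrow> real" where
  "sr_norm q v = sqrt (\<Sum>b \<in> range (\<lambda>a. frame a q).
     (representation (range (\<lambda>a. frame a q)) v b)\<^sup>2)"

text \<open>Horizontal curves are Lipschitz curves that are tangent to the distribution almost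
  everywhere. Every absolutely continuous horizontal curve is of
  this kind after reparametrization by arc length, so lengths and minimizers are the usual ones.\<close>

definition horizontal_curve :: "real \<Rightarrow> real \<Rightarrow> (real \<Rightarrow> 'n::finite pgroup) \<Rightarrow> bool" where
  "horizontal_curve a b \<gamma> \<longleftrightarrow>
     (\<exists>L. L-lipschitz_on {a..b} \<gamma>) \<and>
     (\<exists>N. negligible N \<and> (\<forall>t \<in> {a..b} - N. \<exists>v \<in> distribution (\<gamma> t).
        (\<gamma> has_vector_derivative v) (at t within {a..b})))"

definition sr_length :: "real \<Rightarrow> real \<Rightarrow> (real \<Rightarrow> 'n::finite pgroup) \<Rightarrow> real" where
  "sr_length a b \<gamma> =
     integral {a..b} (\<lambda>t. sr_norm (\<gamma> t) (vector_derivative \<gamma> (at t within {a..b})))"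

definition minimizing :: "real \<Rightarrow> real \<Rightarrow> (real \<Rightarrow> 'n::finite pgroup) \<Rightarrow> bool" where
  "minimizing a b \<gamma> \<longleftrightarrow> horizontal_curve a b \<gamma> \<and>
     (\<forall>c d \<eta>. c \<le> d \<and> horizontal_curve c d \<eta> \<and> \<eta> c = \<gamma> a \<and> \<eta> d = \<gamma> b
        \<longrightarrow> sr_length a b \<gamma> \<le> sr_length c d \<eta>)"

text \<open>Geodesics parametrized by arc length on an interval \<^term>\<open>I\<close>.\<close>

definition geodesic_on :: "real set \<Rightarrow> (real \<Rightarrow> 'n::finite pgroup) \<Rightarrow> bool" where
  "geodesic_on I \<gamma> \<longleftrightarrow>
     (\<forall>a \<in> I. \<forall>b \<in> I. a \<le> b \<longrightarrow> horizontal_curve a b \<gamma> \<and> sr_length a b \<gamma> = b - a) \<and>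
     (\<forall>t \<in> I. \<exists>\<epsilon>>0. \<forall>a \<in> I. \<forall>b \<in> I.
        t - \<epsilon> < a \<and> a < b \<and> b < t + \<epsilon> \<longrightarrow> minimizing a b \<gamma>)"

text \<open>Geodesics issuing from the identity are taken on the whole half-line, so that the
  cut time is not an artefact of a short interval of definition.\<close>

definition geodesic :: "(real \<Rightarrow> 'n::finite pgroup) \<Rightarrow> bool" where
  "geodesic \<gamma> \<longleftrightarrow> geodesic_on {0..} \<gamma> \<and> \<gamma> 0 = 0"

definition cut_time :: "(real \<Rightarrow> 'n::finite pgroup) \<Rightarrow> ereal" where
  "cut_time \<gamma> = Sup (ereal ` {t. 0 < t \<and> minimizing 0 t \<gamma>})"

definition cut_locus :: "'n::finite pgroup set" where
  "cut_locus = {\<gamma> t | \<gamma> t. geodesic \<gamma> \<and> cut_time \<gamma> = ereal t}"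

text \<open>Optimal geodesics from the identity to \<^term>\<open>p\<close> are geodesic segments, with undefined
  values outside of \<^term>\<open>{0..T}\<close>, so that they may be counted as functions.\<close>

definition optimal_geodesic ::
    "'n::finite pgroup \<Rightarrow> real \<Rightarrow> (real \<Rightarrow> 'n pgroup) \<Rightarrow> bool" where
  "optimal_geodesic p T \<gamma> \<longleftrightarrow> 0 < T \<and> \<gamma> \<in> extensional {0..T} \<and>
     geodesic_on {0..T} \<gamma> \<and> \<gamma> 0 = 0 \<and> \<gamma> T = p \<and> minimizing 0 T \<gamma>"

definition optimal_geodesics :: "'n::finite pgroup \<Rightarrow> (real \<Rightarrow> 'n pgroup) set" where
  "optimal_geodesics p = {\<gamma>. \<exists>T. optimal_geodesic p T \<gamma>}"

text \<open>The cotangent bundle is trivialized by the coordinates, with covectors paired with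
  vectors through the inner product: a point is a pair \<^term>\<open>(q, \<xi>)\<close>.\<close>

fun hamiltonian :: "'n::finite pgroup \<times> 'n pgroup \<Rightarrow> real" where
  "hamiltonian (q, \<xi>) = (1/2) * (\<Sum>a\<in>UNIV. (\<xi> \<bullet> frame a q)\<^sup>2)"

text \<open>Hamilton's equations $\dot q = \partial H / \partial \xi$,
  $\dot \xi = - \partial H / \partial q$, read off from the differential of $H$.\<close>

definition hamiltonian_curve :: "(real \<Rightarrow> 'n::finite pgroup \<times> 'n pgroup) \<Rightarrow> bool" where
  "hamiltonian_curve c \<longleftrightarrow> (\<forall>t. \<exists>dq d\<xi>.
     (c has_vector_derivative (dq, d\<xi>)) (at t) \<and>
     (hamiltonian has_derivative (\<lambda>(u, \<mu>). dq \<bullet> \<mu> - d\<xi> \<bullet> u)) (at (c t)))"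

definition sr_exp :: "'n::finite pgroup \<Rightarrow> 'n pgroup" where
  "sr_exp \<xi>\<^sub>0 = (THE p. \<exists>c. hamiltonian_curve c \<and> c 0 = (0, \<xi>\<^sub>0) \<and> p = fst (c 1))"

definition critical_point :: "('a::real_normed_vector \<Rightarrow> 'b::real_normed_vector) \<Rightarrow> 'a \<Rightarrow> bool" where
  "critical_point f x \<longleftrightarrow> (\<exists>D. (f has_derivative D) (at x) \<and> \<not> surj D)"

definition conjugate_time :: "'n::finite pgroup \<Rightarrow> ereal" where
  "conjugate_time \<xi>\<^sub>0 = Inf (ereal ` {t. 0 < t \<and> critical_point sr_exp (t *\<^sub>R \<xi>\<^sub>0)})"

text \<open>The end point of the segment \<^term>\<open>\<gamma>\<close> on \<^term>\<open>{0..T}\<close> is the first conjugate point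
  along it.\<close>

definition ends_at_first_conjugate_point :: "real \<Rightarrow> (real \<Rightarrow> 'n::finite pgroup) \<Rightarrow> bool" where
  "ends_at_first_conjugate_point T \<gamma> \<longleftrightarrow>
     (\<exists>\<xi>\<^sub>0. hamiltonian (0, \<xi>\<^sub>0) = 1/2 \<and> (\<forall>t \<in> {0..T}. \<gamma> t = sr_exp (t *\<^sub>R \<xi>\<^sub>0)) \<and>
       conjugate_time \<xi>\<^sub>0 = ereal T)"

text \<open>The condition $\ell \wedge y \neq 0$; the first conjunct is needed because
  \<^term>\<open>{l, y}\<close> is a set.\<close>

definition wedge_nonzero :: "real ^ 'n::finite \<Rightarrow> real ^ 'n \<Rightarrow> bool" where
  "wedge_nonzero l y \<longleftrightarrow> l \<noteq> y \<and> independent {l, y}"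

definition angle :: "real ^ 'n::finite \<Rightarrow> real ^ 'n \<Rightarrow> real" where
  "angle l y = arccos (l \<bullet> y / (norm l * norm y))"

end

theory Submission
  imports Defs
begin

text \<open>
  The normal extremals project to helices that are explicit in the covector. Minimality up to one period
  $2\pi/|p|$ is proved by calibration: for a fixed vertical covector $p$ there is a solution $W$ of the
  Hamilton-Jacobi equation of which the extremals with that $p$ are characteristics, and the derivative of
  $W$ along a horizontal curve is the squared speed minus a square. The equality case of the calibration shows
  that a minimizer sharing its end point with such a helix is a helix with the same $p$. As maximizing a dual
  functional over $|p| \le 2\pi$ shows that every point is reached in this way, all geodesics are helices.

  At the end of a full period the point does not depend on the whole covector: the component $\alpha$ along
  $X_0$ may change its sign (and may even be rotated if the helix has no translational part). Beyond the
  period, a minimizer could therefore be replaced by a minimizer with a corner. The same sum of squares, applied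
  to Jacobi fields, excludes conjugate points before the end of the period, where the kernel of the
  differential is computed explicitly.
\<close>

section \<open>Horizontal curves and their length\<close>

text \<open>W is the value of a relaxed problem: the vertical coordinate of the end point is left
  free and \<open>p\<close> is its Lagrange multiplier, so that the energy minus 2 p.y is minimized
  with only the planar end point prescribed. That problem is quadratic, a charged particle in a
  constant magnetic field. Its Riccati coefficient \<open>kap\<close> comes from +infinity at time 0
  and reaches -infinity at 2 pi / |p|. This pole is why the calibration stops exactly where
  optimality does. It is also the main obstacle: the cut points lie on it. There the planar
  displacement in the plane of rotation vanishes, and one-sided bounds replace continuity.
  Maximizing over the multiplier is Lagrange duality without a gap. It yields an explicit minimizer
  to every point other than the identity, so neither an existence theorem for minimizers nor a
  maximum principle for Lipschitz curves is invoked. Along a competitor W is evaluated at the arc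
  length run through so far, which takes the place of a reparametrization. Helices, conversely,
  share one formula with a removable singularity at p = 0, and straight lines are the only ones
  whose covector is not determined by the curve.\<close>

lemma lipschitz_has_integral_derivative:
  fixes f :: "real \<Rightarrow> 'a::euclidean_space"
  assumes ab: "a \<le> b" and lip: "L-lipschitz_on {a..b} f" and N: "negligible N"
    and D: "\<And>t. t \<in> {a..b} - N \<Longrightarrow> (f has_vector_derivative f' t) (at t within {a..b})"
  shows "(f' has_integral (f b - f a)) {a..b}"
proof (cases "a = b")
  case True
  then show ?thesis using has_integral_refl(2)[of f' b] by simp
next
  case False
  with ab have ab': "a < b" by simp
  \<comment> \<open>The constant extension of \<open>f\<close> keeps the Lipschitz constant and
    makes forward difference quotients available up to the right end.\<close>
  define g where "g t = f (max a (min b t))" for t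
  have gf: "g t = f t" if "t \<in> {a..b}" for t using that by (simp add: g_def)
  have L0: "L \<ge> 0" using lip by (rule lipschitz_on_nonneg)
  have glip: "norm (g s - g t) \<le> L * \<bar>s - t\<bar>" for s t
  proof -
    have "norm (g s - g t) \<le> L * \<bar>max a (min b s) - max a (min b t)\<bar>"
      using lipschitz_onD[OF lip, of "max a (min b s)" "max a (min b t)"] ab
      by (simp add: g_def dist_norm)
    also have "\<dots> \<le> L * \<bar>s - t\<bar>" by (intro mult_left_mono L0) (auto simp: max_def min_def)
    finally show ?thesis .
  qed
  have "L-lipschitz_on UNIV g"
    by (rule lipschitz_onI[OF _ L0]) (use glip in \<open>simp add: dist_norm\<close>)
  then have gc: "continuous_on UNIV g" by (rule lipschitz_on_continuous_on)
  obtain G where G: "\<And>t. t \<in> {a-1..b+1} \<Longrightarrow> (G has_vector_derivative g t) (at t within {a-1..b+1})"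
    by (rule antiderivative_continuous[OF continuous_on_subset[OF gc subset_UNIV], of "a-1" "b+1"], blast)
  have G': "(G has_vector_derivative g t) (at t)" if "a - 1 < t" "t < b + 1" for t
    using G[of t] that at_within_interior[of t "{a-1..b+1}"] by (simp add: interior_atLeastAtMost_real)
  \<comment> \<open>The offset 2 keeps the step strictly below 1, so that t + h n stays inside the
    open interval on which \<open>G\<close> has a two-sided derivative.\<close>
  define h where "h n = 1 / (real n + 2)" for n
  have h: "0 < h n" "h n < 1" for n by (auto simp: h_def field_simps)
  have hlim: "filterlim h (at 0) sequentially"
  proof -
    have "h \<longlonglongrightarrow> 0" unfolding h_def using LIMSEQ_ignore_initial_segment[OF lim_inverse_n, of 2] by (simp add: divide_inverse add.commute)
    then show ?thesis using h(1) by (simp add: filterlim_at order_less_imp_not_eq2 eventually_sequentially)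
  qed
  \<comment> \<open>The difference quotients are bounded by \<open>L\<close> and converge to the
    derivative almost everywhere, while their integrals are difference quotients of the
    antiderivative \<open>G\<close> at the two ends. Dominated convergence then gives the
    fundamental theorem.\<close>
  define E where "E n t = (1 / h n) *\<^sub>R (g (t + h n) - g t)" for n t
  have Ebound: "norm (E n t) \<le> L" for n t
    using glip[of "t + h n" t] h(1)[of n] by (simp add: E_def divide_simps)
  have Eint: "(E n has_integral ((1 / h n) *\<^sub>R (G (b + h n) - G b) - (1 / h n) *\<^sub>R (G (a + h n) - G a))) {a..b}" for n
  proof -
    have "(E n has_integral ((1 / h n) *\<^sub>R (G (b + h n) - G b) - (1 / h n) *\<^sub>R (G (a + h n) - G a))) {a..b}"
    proof (rule fundamental_theorem_of_calculus[OF ab])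
      fix t assume t: "t \<in> {a..b}"
      have 1: "(G has_vector_derivative g t) (at t)" by (rule G') (use t in auto)
      have 2: "((\<lambda>t. G (t + h n)) has_vector_derivative g (t + h n)) (at t)"
      proof -
        have "(G has_vector_derivative g (t + h n)) (at (t + h n))"
          by (rule G') (use t h[of n] in auto)
        moreover have "((\<lambda>t. t + h n) has_vector_derivative 1) (at t)"
          by (auto intro!: derivative_eq_intros)
        ultimately show ?thesis
          using vector_diff_chain_at[of "\<lambda>t. t + h n" 1 t G] by (simp add: o_def)
      qed
      have "((\<lambda>t. (1 / h n) *\<^sub>R (G (t + h n) - G t)) has_vector_derivative E n t) (at t)"
        unfolding E_def by (auto intro!: derivative_eq_intros 1 2)
      then show "((\<lambda>t. (1 / h n) *\<^sub>R (G (t + h n) - G t)) has_vector_derivative E n t) (at t within {a..b})"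
        by (rule has_vector_derivative_at_within)
    qed
    then show ?thesis .
  qed
  have quot: "(\<lambda>n. (1 / h n) *\<^sub>R (F (t + h n) - F t)) \<longlonglongrightarrow> D"
    if "(F has_vector_derivative D) (at t)" for F :: "real \<Rightarrow> 'a" and t D
  proof -
    have "((\<lambda>h. (1 / h) *\<^sub>R (F (t + h) - F t)) \<longlongrightarrow> D) (at 0)"
    proof -
      have "((\<lambda>h. norm (F (t + h) - F t - h *\<^sub>R D) / norm h) \<longlongrightarrow> 0) (at 0)"
        using that by (simp add: has_vector_derivative_def has_derivative_at)
      moreover have "\<forall>\<^sub>F h in at 0. norm (F (t + h) - F t - h *\<^sub>R D) / norm h
          = norm ((1 / h) *\<^sub>R (F (t + h) - F t) - D)"
        unfolding eventually_at_filter
      proof (intro always_eventually allI impI)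
        fix h :: real assume "h \<noteq> 0"
        then have "(1 / h) *\<^sub>R (F (t + h) - F t) - D = (1 / h) *\<^sub>R (F (t + h) - F t - h *\<^sub>R D)"
          by (simp add: scaleR_diff_right)
        then show "norm (F (t + h) - F t - h *\<^sub>R D) / norm h = norm ((1 / h) *\<^sub>R (F (t + h) - F t) - D)"
          by simp
      qed
      ultimately show ?thesis by (simp add: tendsto_cong LIM_zero_iff tendsto_norm_zero_iff)
    qed
    from filterlim_compose[OF this hlim] show ?thesis .
  qed
  \<comment> \<open>The end points join the null set because the extended function may have a corner
    there.\<close>
  define M where "M = N \<union> {a, b}"
  have M: "negligible M" using N by (auto simp: M_def intro!: negligible_Un)
  define E' where "E' n t = (if t \<in> M then 0 else E n t)" for n t
  define f'' where "f'' t = (if t \<in> M then 0 else f' t)" for t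
  have E'int: "(E' n has_integral ((1 / h n) *\<^sub>R (G (b + h n) - G b) - (1 / h n) *\<^sub>R (G (a + h n) - G a))) {a..b}" for n
    by (rule has_integral_spike[OF M _ Eint]) (auto simp: E'_def)
  have dc: "f'' integrable_on {a..b}" "(\<lambda>n. integral {a..b} (E' n)) \<longlonglongrightarrow> integral {a..b} f''"
  proof -
    have 1: "E' n integrable_on {a..b}" for n using E'int by blast
    have 2: "(\<lambda>_. L) integrable_on {a..b}" by (rule integrable_const_ivl)
    have 3: "norm (E' n t) \<le> L" for n t using Ebound[of n t] L0 by (simp add: E'_def)
    have 4: "(\<lambda>n. E' n t) \<longlonglongrightarrow> f'' t" if "t \<in> {a..b}" for t
    proof (cases "t \<in> M")
      case False
      then have t: "a < t" "t < b" "t \<notin> N" using that by (auto simp: M_def)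
      have "(f has_vector_derivative f' t) (at t)"
        using D[of t] t at_within_interior[of t "{a..b}"] by (simp add: interior_atLeastAtMost_real)
      then have "(g has_vector_derivative f' t) (at t)"
        by (rule has_vector_derivative_transform_within_open[of _ _ _ "{a<..<b}"]) (use t gf in auto)
      from quot[OF this] show ?thesis using False by (simp add: E'_def f''_def E_def)
    qed (simp add: E'_def f''_def)
    show "f'' integrable_on {a..b}" by (rule dominated_convergence(1)[OF 1 2 3 4])
    show "(\<lambda>n. integral {a..b} (E' n)) \<longlonglongrightarrow> integral {a..b} f''"
      by (rule dominated_convergence(2)[OF 1 2 3 4])
  qed
  have "(\<lambda>n. integral {a..b} (E' n)) \<longlonglongrightarrow> g b - g a"
    unfolding integral_unique[OF E'int] by (intro tendsto_diff quot G') (use ab in auto)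
  with dc have "integral {a..b} f'' = f b - f a"
    using LIMSEQ_unique gf ab by (metis atLeastAtMost_iff order_refl)
  with dc(1) have "(f'' has_integral (f b - f a)) {a..b}" by (simp add: has_integral_iff)
  then show ?thesis
    by (rule has_integral_spike[OF M, rotated]) (auto simp: f''_def)
qed

section \<open>Controls: the distribution and the metric in planar coordinates\<close>

text \<open>The horizontal vector at \<open>q\<close> with frame coefficients \<open>v\<close>. It
  identifies the distribution at every point with one Euclidean space, in which the controls of a
  curve live.\<close>

definition hlift :: "'n::finite pgroup \<Rightarrow> real \<times> (real ^ 'n) \<Rightarrow> 'n pgroup" where
  "hlift q v = (fst v, snd v, (1/2) *\<^sub>R (fst v *\<^sub>R fst (snd q) - fst q *\<^sub>R snd v))"

definition hproj :: "'n::finite pgroup \<Rightarrow> real \<times> (real ^ 'n)" where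
  "hproj q = (fst q, fst (snd q))"

lemma hproj_hlift [simp]: "hproj (hlift q v) = v"
  by (simp add: hproj_def hlift_def)

lemma linear_hlift: "linear (hlift q)"
  by (rule linearI) (auto simp: hlift_def algebra_simps)

lemma linear_hproj: "linear hproj"
  by (rule linearI) (auto simp: hproj_def)

lemma inj_hlift: "inj (hlift q)"
  by (metis hproj_hlift injI)

lemma Basis_hspace: "(Basis :: (real \<times> (real ^ 'n::finite)) set) = insert (1, 0) (range (\<lambda>i. (0, axis i 1)))"
  by (auto simp: Basis_prod_def Basis_vec_def image_iff)

lemma range_frame: "range (\<lambda>a. frame a q) = hlift q ` Basis"
proof -
  have "frame None q = hlift q (1, 0)"
    by (cases q) (simp add: hlift_def)
  moreover have "frame (Some i) q = hlift q (0, axis i 1)" for i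
    by (cases q) (simp add: hlift_def)
  ultimately show ?thesis
    unfolding Basis_hspace by (auto simp: UNIV_option_conv image_image)
qed

lemma distribution_eq: "distribution q = range (hlift q)"
  by (simp add: distribution_def range_frame linear_span_image[OF linear_hlift])

text \<open>The lift carries the standard basis to the frame, so the frame coordinates of a lifted
  vector are its standard coordinates. The function \<open>f\<close> writes them as a
  \<open>representation\<close>, which has to vanish off the frame.\<close>

lemma sr_norm_hlift: "sr_norm q (hlift q v) = norm v"
proof -
  let ?B = "hlift q ` Basis"
  define f where "f w = (if w \<in> ?B then v \<bullet> hproj w else 0)" for w
  have fin: "finite ?B" by simp
  have inj: "inj_on (hlift q) Basis" using inj_hlift by (rule inj_on_subset) simp
  have ind: "independent ?B"
    by (rule linear_independent_injective_image[OF linear_hlift independent_Basis])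
       (rule inj_on_subset[OF inj_hlift subset_UNIV])
  have sub: "{w. f w \<noteq> 0} \<subseteq> ?B" by (auto simp: f_def split: if_splits)
  have "representation ?B (hlift q v) = f"
  proof (rule real_vector.representation_eqI[OF ind])
    show "hlift q v \<in> span ?B" by (simp add: linear_span_image[OF linear_hlift])
    show "f b \<noteq> 0 \<Longrightarrow> b \<in> ?B" for b using sub by auto
    show "finite {b. f b \<noteq> 0}" using sub fin by (rule finite_subset)
    have "(\<Sum>b | f b \<noteq> 0. f b *\<^sub>R b) = (\<Sum>b\<in>?B. f b *\<^sub>R b)"
      by (rule sum.mono_neutral_left[OF fin sub]) auto
    also have "\<dots> = (\<Sum>b\<in>Basis. (v \<bullet> b) *\<^sub>R hlift q b)"
      by (simp add: sum.reindex[OF inj] f_def)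
    also have "\<dots> = hlift q (\<Sum>b\<in>Basis. (v \<bullet> b) *\<^sub>R b)"
      by (simp add: linear_sum[OF linear_hlift] linear_scale[OF linear_hlift])
    finally show "(\<Sum>b | f b \<noteq> 0. f b *\<^sub>R b) = hlift q v" by (simp add: euclidean_representation)
  qed
  then show ?thesis
    by (simp add: sr_norm_def range_frame sum.reindex[OF inj] f_def norm_eq_sqrt_inner
        euclidean_inner[of v v] power2_eq_square)
qed

text \<open>The control is an explicit argument and is constrained only off a null set. Thus one
  control serves all subintervals and translates of a curve, whereas
  \<open>vector_derivative\<close> would depend on the interval.\<close>

definition hcontrol :: "real \<Rightarrow> real \<Rightarrow> (real \<Rightarrow> 'n::finite pgroup) \<Rightarrow> (real \<Rightarrow> real \<times> (real ^ 'n)) \<Rightarrow> bool" where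
  "hcontrol a b \<gamma> u \<longleftrightarrow> (\<exists>L. L-lipschitz_on {a..b} \<gamma>) \<and>
     (\<exists>N. negligible N \<and> (\<forall>t \<in> {a..b} - N.
        (\<gamma> has_vector_derivative hlift (\<gamma> t) (u t)) (at t within {a..b})))"

lemma horizontal_curve_iff_hcontrol: "horizontal_curve a b \<gamma> \<longleftrightarrow> (\<exists>u. hcontrol a b \<gamma> u)"
proof
  assume "horizontal_curve a b \<gamma>"
  then obtain N where N: "\<exists>L. L-lipschitz_on {a..b} \<gamma>" "negligible N"
    "\<And>t. t \<in> {a..b} - N \<Longrightarrow> \<exists>v \<in> distribution (\<gamma> t). (\<gamma> has_vector_derivative v) (at t within {a..b})"
    unfolding horizontal_curve_def by blast
  have "\<exists>u. t \<in> {a..b} - N \<longrightarrow> (\<gamma> has_vector_derivative hlift (\<gamma> t) u) (at t within {a..b})" for t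
    using N(3)[of t] by (auto simp: distribution_eq)
  then obtain u where "\<And>t. t \<in> {a..b} - N \<Longrightarrow> (\<gamma> has_vector_derivative hlift (\<gamma> t) (u t)) (at t within {a..b})"
    by metis
  with N show "\<exists>u. hcontrol a b \<gamma> u" unfolding hcontrol_def by blast
next
  assume "\<exists>u. hcontrol a b \<gamma> u"
  then show "horizontal_curve a b \<gamma>"
    unfolding hcontrol_def horizontal_curve_def distribution_eq by (metis rangeI)
qed

lemma hcontrol_subset:
  assumes "hcontrol a b \<gamma> u" "a \<le> c" "d \<le> b"
  shows "hcontrol c d \<gamma> u"
proof -
  have sub: "{c..d} \<subseteq> {a..b}" using assms by auto
  from assms(1) obtain L N where L: "L-lipschitz_on {a..b} \<gamma>" and N: "negligible N"
    "\<And>t. t \<in> {a..b} - N \<Longrightarrow> (\<gamma> has_vector_derivative hlift (\<gamma> t) (u t)) (at t within {a..b})"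
    unfolding hcontrol_def by blast
  have "(\<gamma> has_vector_derivative hlift (\<gamma> t) (u t)) (at t within {c..d})" if "t \<in> {c..d} - N" for t
    using N(2)[of t] has_vector_derivative_within_subset[OF _ sub] that sub by auto
  with L N show ?thesis unfolding hcontrol_def using lipschitz_on_subset[OF L sub] by blast
qed

lemma horizontal_curve_subset:
  assumes "horizontal_curve a b \<gamma>" "a \<le> c" "d \<le> b"
  shows "horizontal_curve c d \<gamma>"
  using assms hcontrol_subset unfolding horizontal_curve_iff_hcontrol by blast

lemma lipschitz_vector_derivative_bound:
  fixes f :: "real \<Rightarrow> 'a::real_normed_vector"
  assumes lip: "L-lipschitz_on {a..b} f" and ab: "a < b" and t: "t \<in> {a..b}"
    and D: "(f has_vector_derivative D) (at t within {a..b})"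
  shows "norm D \<le> L"
proof (rule ccontr)
  assume "\<not> norm D \<le> L"
  then have e: "norm D - L > 0" by simp
  have "(f has_derivative (\<lambda>h. h *\<^sub>R D)) (at t within {a..b})" using D by (simp add: has_vector_derivative_def)
  then obtain d where d: "d > 0"
    "\<And>s. s \<in> {a..b} \<Longrightarrow> norm (s - t) < d \<Longrightarrow> norm (f s - f t - (s - t) *\<^sub>R D) \<le> (norm D - L) / 2 * norm (s - t)"
    unfolding has_derivative_within_alt using e by (metis half_gt_zero)
  obtain s where s: "s \<in> {a..b}" "s \<noteq> t" "\<bar>s - t\<bar> < d"
  proof (cases "t < b")
    case True
    with that[of "min b (t + d/2)"] d(1) t show ?thesis by (auto simp: min_def)
  next
    case False
    with that[of "max a (t - d/2)"] d(1) t ab show ?thesis by (auto simp: max_def)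
  qed
  have "norm ((s - t) *\<^sub>R D) \<le> norm (f s - f t) + norm (f s - f t - (s - t) *\<^sub>R D)"
    using norm_triangle_ineq4[of "f s - f t" "f s - f t - (s - t) *\<^sub>R D"] by simp
  also have "\<dots> \<le> L * \<bar>s - t\<bar> + (norm D - L) / 2 * \<bar>s - t\<bar>"
    using d(2)[OF s(1)] s lipschitz_onD[OF lip s(1) t] by (simp add: dist_norm)
  finally have "\<bar>s - t\<bar> * norm D \<le> \<bar>s - t\<bar> * ((norm D + L) / 2)"
    unfolding norm_scaleR by (simp add: field_simps)
  then show False using s e by simp
qed

lemma hcontrol_integral:
  assumes u: "hcontrol a b \<gamma> u" and ab: "a \<le> b"
  shows "(u has_integral (hproj (\<gamma> b) - hproj (\<gamma> a))) {a..b}"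
    and "(\<lambda>t. norm (u t)) integrable_on {a..b}"
    and "sr_length a b \<gamma> = integral {a..b} (\<lambda>t. norm (u t))"
    and "((\<lambda>t. snd (snd (hlift (\<gamma> t) (u t)))) has_integral (snd (snd (\<gamma> b)) - snd (snd (\<gamma> a)))) {a..b}"
proof -
  have "(u has_integral (hproj (\<gamma> b) - hproj (\<gamma> a))) {a..b} \<and> (\<lambda>t. norm (u t)) integrable_on {a..b} \<and>
    sr_length a b \<gamma> = integral {a..b} (\<lambda>t. norm (u t)) \<and>
    ((\<lambda>t. snd (snd (hlift (\<gamma> t) (u t)))) has_integral (snd (snd (\<gamma> b)) - snd (snd (\<gamma> a)))) {a..b}"
  proof (cases "a = b")
    case True
    then show ?thesis
      using has_integral_refl(2)[of u b] has_integral_refl(2)[of "\<lambda>t. snd (snd (hlift (\<gamma> t) (u t)))" b]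
        integrable_on_refl[of "\<lambda>t. norm (u t)" b]
      by (simp add: sr_length_def)
  next
    case False
    with ab have ab': "a < b" by simp
    from u obtain L N where L: "L-lipschitz_on {a..b} \<gamma>" and N: "negligible N"
      and D: "\<And>t. t \<in> {a..b} - N \<Longrightarrow> (\<gamma> has_vector_derivative hlift (\<gamma> t) (u t)) (at t within {a..b})"
      unfolding hcontrol_def by blast
    have L0: "0 \<le> L" using L by (rule lipschitz_on_nonneg)
    define f where "f t = hlift (\<gamma> t) (u t)" for t
    have I: "(f has_integral (\<gamma> b - \<gamma> a)) {a..b}"
      unfolding f_def by (rule lipschitz_has_integral_derivative[OF ab L N D])
    from has_integral_linear[OF I, of hproj]
    have uI: "(u has_integral (hproj (\<gamma> b) - hproj (\<gamma> a))) {a..b}"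
      using linear_hproj by (simp add: linear_diff[OF linear_hproj] f_def o_def linear_conv_bounded_linear)
    have yI: "((\<lambda>t. snd (snd (hlift (\<gamma> t) (u t)))) has_integral (snd (snd (\<gamma> b)) - snd (snd (\<gamma> a)))) {a..b}"
      using has_integral_linear[OF I, of "\<lambda>q. snd (snd q)"]
      by (simp add: f_def o_def bounded_linear_snd_comp bounded_linear_snd bounded_linear_intros)
    \<comment> \<open>On the null set the control is arbitrary and perhaps unbounded. Set to 0
      there, it is bounded by the Lipschitz constant, which makes its norm integrable.\<close>
    define u' where "u' t = (if t \<in> N then 0 else u t)" for t
    have u'I: "(u' has_integral (hproj (\<gamma> b) - hproj (\<gamma> a))) {a..b}"
      by (rule has_integral_spike[OF N _ uI]) (auto simp: u'_def)
    have bound: "norm (u' t) \<le> L" if "t \<in> {a..b}" for t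
    proof (cases "t \<in> N")
      case False
      then have "norm (hlift (\<gamma> t) (u t)) \<le> L"
        using lipschitz_vector_derivative_bound[OF L ab' that D[of t]] that by blast
      moreover have "norm (u t) \<le> norm (hlift (\<gamma> t) (u t))"
      proof -
        obtain v w where v: "u t = (v, w)" by (cases "u t")
        show ?thesis by (simp add: v hlift_def norm_Pair)
      qed
      ultimately show ?thesis using False by (simp add: u'_def)
    qed (simp add: u'_def L0)
    have "u' absolutely_integrable_on {a..b}"
      by (rule absolutely_integrable_integrable_bound[where g = "\<lambda>_. L"])
         (use bound u'I in auto)
    then have n': "(\<lambda>t. norm (u' t)) integrable_on {a..b}" by (simp add: absolutely_integrable_on_def)
    have nI: "(\<lambda>t. norm (u t)) integrable_on {a..b}"
      by (rule integrable_spike[OF n' N]) (auto simp: u'_def)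
    have "sr_length a b \<gamma> = integral {a..b} (\<lambda>t. norm (u t))"
      unfolding sr_length_def
    proof (rule integral_spike[OF N])
      fix t assume t: "t \<in> {a..b} - N"
      then have "vector_derivative \<gamma> (at t within {a..b}) = hlift (\<gamma> t) (u t)"
        using vector_derivative_within_cbox[of a b t \<gamma>] ab' D[OF t] by (simp add: box_real)
      then show "norm (u t) = sr_norm (\<gamma> t) (vector_derivative \<gamma> (at t within {a..b}))"
        by (simp add: sr_norm_hlift)
    qed
    with uI nI yI show ?thesis by blast
  qed
  then show "(u has_integral (hproj (\<gamma> b) - hproj (\<gamma> a))) {a..b}"
    and "(\<lambda>t. norm (u t)) integrable_on {a..b}"
    and "sr_length a b \<gamma> = integral {a..b} (\<lambda>t. norm (u t))"
    and "((\<lambda>t. snd (snd (hlift (\<gamma> t) (u t)))) has_integral (snd (snd (\<gamma> b)) - snd (snd (\<gamma> a)))) {a..b}"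
    by blast+
qed

section \<open>Additivity of the length and displacement bounds\<close>

lemma sr_length_add:
  assumes "horizontal_curve a c \<gamma>" "a \<le> b" "b \<le> c"
  shows "sr_length a c \<gamma> = sr_length a b \<gamma> + sr_length b c \<gamma>"
proof -
  from assms(1) obtain u where u: "hcontrol a c \<gamma> u" by (auto simp: horizontal_curve_iff_hcontrol)
  have "hcontrol a b \<gamma> u" "hcontrol b c \<gamma> u" by (auto intro!: hcontrol_subset[OF u] assms)
  then show ?thesis
    using assms hcontrol_integral(3)[OF u] hcontrol_integral(3)[of a b \<gamma> u] hcontrol_integral(3)[of b c \<gamma> u]
      Henstock_Kurzweil_Integration.integral_combine[OF assms(2,3) hcontrol_integral(2)[OF u]] by auto
qed

lemma sr_length_nonneg:
  assumes "horizontal_curve a b \<gamma>"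
  shows "0 \<le> sr_length a b \<gamma>"
proof (cases "a \<le> b")
  case True
  from assms obtain u where u: "hcontrol a b \<gamma> u" by (auto simp: horizontal_curve_iff_hcontrol)
  show ?thesis using hcontrol_integral(3)[OF u True] hcontrol_integral(2)[OF u True] by (simp add: integral_nonneg)
qed (simp add: sr_length_def)

lemma continuous_on_sr_length:
  assumes "horizontal_curve a b \<gamma>"
  shows "continuous_on {a..b} (\<lambda>t. sr_length a t \<gamma>)"
proof (cases "a \<le> b")
  case True
  from assms obtain u where u: "hcontrol a b \<gamma> u" by (auto simp: horizontal_curve_iff_hcontrol)
  have "sr_length a t \<gamma> = integral {a..t} (\<lambda>t. norm (u t))" if "t \<in> {a..b}" for t
    using hcontrol_integral(3)[OF hcontrol_subset[OF u, of a t]] that by auto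
  then show ?thesis
    using indefinite_integral_continuous_1[OF hcontrol_integral(2)[OF u True]]
    by (subst continuous_on_cong[OF refl]) auto
qed simp

lemma hproj_le_sr_length:
  assumes "horizontal_curve a b \<gamma>" "a \<le> b"
  shows "norm (hproj (\<gamma> b) - hproj (\<gamma> a)) \<le> sr_length a b \<gamma>"
proof -
  from assms(1) obtain u where u: "hcontrol a b \<gamma> u" by (auto simp: horizontal_curve_iff_hcontrol)
  note I = hcontrol_integral[OF u assms(2)]
  have "norm (integral {a..b} u) \<le> integral {a..b} (\<lambda>t. norm (u t))"
    by (rule integral_norm_bound_integral) (use I in auto)
  then show ?thesis using I by (simp add: integral_unique)
qed

lemma norm_wedge_le:
  fixes l v :: "'a::real_inner"
  shows "norm (a *\<^sub>R l - x *\<^sub>R v) \<le> norm (x, l) * norm (a, v)"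
proof -
  have "norm (a *\<^sub>R l - x *\<^sub>R v) \<le> \<bar>a\<bar> * norm l + \<bar>x\<bar> * norm v"
    using norm_triangle_ineq4[of "a *\<^sub>R l" "x *\<^sub>R v"] by simp
  also have "\<dots> \<le> sqrt ((x\<^sup>2 + (norm l)\<^sup>2) * (a\<^sup>2 + (norm v)\<^sup>2))"
  proof (rule real_le_rsqrt)
    have "(x\<^sup>2 + (norm l)\<^sup>2) * (a\<^sup>2 + (norm v)\<^sup>2) - (\<bar>a\<bar> * norm l + \<bar>x\<bar> * norm v)\<^sup>2 = (\<bar>x\<bar> * \<bar>a\<bar> - norm l * norm v)\<^sup>2"
      by (simp add: power2_eq_square algebra_simps abs_mult_self_eq)
    then show "(\<bar>a\<bar> * norm l + \<bar>x\<bar> * norm v)\<^sup>2 \<le> (x\<^sup>2 + (norm l)\<^sup>2) * (a\<^sup>2 + (norm v)\<^sup>2)"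
      by (smt (verit) zero_le_power2)
  qed
  finally show ?thesis by (simp add: norm_Pair real_sqrt_mult)
qed

text \<open>The planar projection stays within distance \<open>?L\<close> of the origin, so the
  vertical speed is at most \<open>?L\<close> / 2 times the speed. The bound is quadratic in the
  length, which makes the vertical error of a short arc negligible when many arcs are
  summed.\<close>

lemma vertical_le_sr_length:
  assumes "horizontal_curve a b \<gamma>" "a \<le> b" "\<gamma> a = 0"
  shows "norm (snd (snd (\<gamma> b))) \<le> (sr_length a b \<gamma>)\<^sup>2 / 2"
proof -
  from assms(1) obtain u where u: "hcontrol a b \<gamma> u" by (auto simp: horizontal_curve_iff_hcontrol)
  note I = hcontrol_integral[OF u assms(2)]
  let ?L = "sr_length a b \<gamma>"
  have "norm (integral {a..b} (\<lambda>t. snd (snd (hlift (\<gamma> t) (u t))))) \<le> integral {a..b} (\<lambda>t. ?L / 2 * norm (u t))"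
  proof (rule integral_norm_bound_integral)
    fix t assume t: "t \<in> {a..b}"
    have h: "horizontal_curve a t \<gamma>" "horizontal_curve t b \<gamma>"
      using horizontal_curve_subset[OF assms(1)] t by auto
    have "norm (hproj (\<gamma> t)) \<le> sr_length a t \<gamma>"
      using hproj_le_sr_length[OF h(1)] t assms(3) linear_0[OF linear_hproj] by (simp add: hproj_def)
    also have "\<dots> \<le> ?L" using sr_length_add[OF assms(1), of t] sr_length_nonneg[OF h(2)] t by simp
    finally have 1: "norm (hproj (\<gamma> t)) \<le> ?L" .
    have "norm (snd (snd (hlift (\<gamma> t) (u t)))) \<le> norm (hproj (\<gamma> t)) * norm (u t) / 2"
      using norm_wedge_le[of "fst (u t)" "fst (snd (\<gamma> t))" "fst (\<gamma> t)" "snd (u t)"] 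
      by (simp add: hlift_def hproj_def)
    also have "\<dots> \<le> ?L / 2 * norm (u t)" using mult_right_mono[OF 1, of "norm (u t)"] by simp
    finally show "norm (snd (snd (hlift (\<gamma> t) (u t)))) \<le> ?L / 2 * norm (u t)" .
  qed (use I(2,4) in \<open>auto simp: integrable_on_mult_right\<close>)
  also have "\<dots> = ?L / 2 * ?L" by (simp only: integral_mult_right I(3)[symmetric])
  finally show ?thesis using I(4) assms(3) by (simp add: integral_unique power2_eq_square)
qed

section \<open>Invariance under translation and time shift, and gluing\<close>

text \<open>A left translation is affine, and its linear part \<open>A\<close> carries the lift of a
  control at one point to the lift of the same control at the translated point.\<close>

lemma hcontrol_translate:
  assumes "hcontrol a b \<gamma> u"
  shows "hcontrol a b (\<lambda>t. pg_mult g (\<gamma> t)) u"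
proof -
  obtain x l y where g: "g = (x, l, y)" by (cases g)
  define A where "A v = (fst v, fst (snd v), snd (snd v) + (1/2) *\<^sub>R (fst v *\<^sub>R l - x *\<^sub>R fst (snd v)))"
    for v :: "'a pgroup"
  have A: "bounded_linear A"
    unfolding linear_conv_bounded_linear[symmetric] by (rule linearI) (auto simp: A_def algebra_simps)
  have eq: "pg_mult g q = g + A q" for q by (cases q) (simp add: g A_def algebra_simps)
  have Ah: "A (hlift q v) = hlift (pg_mult g q) v" for q v
    by (cases q) (simp add: A_def hlift_def g algebra_simps)
  from assms obtain L N where L: "L-lipschitz_on {a..b} \<gamma>" and N: "negligible N"
      and D: "\<And>t. t \<in> {a..b} - N \<Longrightarrow> (\<gamma> has_vector_derivative hlift (\<gamma> t) (u t)) (at t within {a..b})"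
      unfolding hcontrol_def by blast
  obtain M where M: "M > 0" "\<And>v. norm (A v) \<le> norm v * M" using bounded_linear.pos_bounded[OF A] by blast
  have "(M * L)-lipschitz_on {a..b} (\<lambda>t. pg_mult g (\<gamma> t))"
  proof (rule lipschitz_onI)
    fix s t assume st: "s \<in> {a..b}" "t \<in> {a..b}"
    have "dist (pg_mult g (\<gamma> s)) (pg_mult g (\<gamma> t)) = norm (A (\<gamma> s - \<gamma> t))"
      by (simp add: eq dist_norm linear_diff[OF bounded_linear.linear[OF A]])
    also have "\<dots> \<le> dist (\<gamma> s) (\<gamma> t) * M" using M(2) by (simp add: dist_norm)
    also have "\<dots> \<le> (L * dist s t) * M" using lipschitz_onD[OF L st] M(1) by (intro mult_right_mono) auto
    finally show "dist (pg_mult g (\<gamma> s)) (pg_mult g (\<gamma> t)) \<le> M * L * dist s t" by (simp add: algebra_simps)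
  qed (use M lipschitz_on_nonneg[OF L] in auto)
  moreover have "((\<lambda>t. pg_mult g (\<gamma> t)) has_vector_derivative hlift (pg_mult g (\<gamma> t)) (u t)) (at t within {a..b})"
    if "t \<in> {a..b} - N" for t
    unfolding eq[of "\<gamma> _"] Ah[symmetric, unfolded eq]
    using bounded_linear.has_vector_derivative[OF A D[OF that]]
    by (auto intro!: derivative_eq_intros)
  ultimately show ?thesis unfolding hcontrol_def using N by blast
qed

lemma horizontal_curve_translate:
  assumes "horizontal_curve a b \<gamma>"
  shows "horizontal_curve a b (\<lambda>t. pg_mult g (\<gamma> t))"
  using assms hcontrol_translate unfolding horizontal_curve_iff_hcontrol by blast

lemma sr_length_translate:
  assumes "horizontal_curve a b \<gamma>"
  shows "sr_length a b (\<lambda>t. pg_mult g (\<gamma> t)) = sr_length a b \<gamma>"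
proof (cases "a \<le> b")
  case True
  from assms obtain u where u: "hcontrol a b \<gamma> u" by (auto simp: horizontal_curve_iff_hcontrol)
  show ?thesis
    using hcontrol_integral(3)[OF u True] hcontrol_integral(3)[OF hcontrol_translate[OF u] True] by simp
qed (simp add: sr_length_def)

lemma hcontrol_shift:
  assumes "hcontrol (a + c) (b + c) \<gamma> u"
  shows "hcontrol a b (\<lambda>t. \<gamma> (t + c)) (\<lambda>t. u (t + c))"
proof -
  from assms obtain L N where L: "L-lipschitz_on {a+c..b+c} \<gamma>" and N: "negligible N"
      and D: "\<And>t. t \<in> {a+c..b+c} - N \<Longrightarrow> (\<gamma> has_vector_derivative hlift (\<gamma> t) (u t)) (at t within {a+c..b+c})"
      unfolding hcontrol_def by blast
  have "L-lipschitz_on {a..b} (\<lambda>t. \<gamma> (t + c))"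
  proof (rule lipschitz_onI)
    fix s t assume "s \<in> {a..b}" "t \<in> {a..b}"
    then show "dist (\<gamma> (s + c)) (\<gamma> (t + c)) \<le> L * dist s t"
      using lipschitz_onD[OF L, of "s + c" "t + c"] by simp
  qed (rule lipschitz_on_nonneg[OF L])
  moreover have "negligible ((\<lambda>t. - c + t) ` N)" by (rule negligible_translation[OF N])
  moreover have "((\<lambda>t. \<gamma> (t + c)) has_vector_derivative hlift (\<gamma> (t + c)) (u (t + c))) (at t within {a..b})"
    if t: "t \<in> {a..b} - (\<lambda>t. - c + t) ` N" for t
  proof -
    have 1: "t + c \<in> {a+c..b+c} - N"
    proof -
      have "t + c \<notin> N"
      proof
        assume "t + c \<in> N"
        then have "- c + (t + c) \<in> (\<lambda>t. - c + t) ` N" by (rule imageI)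
        then show False using t by simp
      qed
      then show ?thesis using t by auto
    qed
    have 2: "(\<lambda>t. t + c) ` {a..b} = {a+c..b+c}" by simp
    have "((\<lambda>t. t + c) has_vector_derivative 1) (at t within {a..b})"
      by (auto intro!: derivative_eq_intros)
    from vector_diff_chain_within[OF this, of \<gamma>] D[OF 1] 2
    show ?thesis by (auto simp: o_def)
  qed
  ultimately show ?thesis unfolding hcontrol_def by blast
qed

lemma horizontal_curve_shift:
  assumes "horizontal_curve (a + c) (b + c) \<gamma>"
  shows "horizontal_curve a b (\<lambda>t. \<gamma> (t + c))"
  using assms hcontrol_shift unfolding horizontal_curve_iff_hcontrol by blast

lemma sr_length_shift:
  assumes "horizontal_curve (a + c) (b + c) \<gamma>"
  shows "sr_length a b (\<lambda>t. \<gamma> (t + c)) = sr_length (a + c) (b + c) \<gamma>"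
proof (cases "a \<le> b")
  case True
  from assms obtain u where u: "hcontrol (a + c) (b + c) \<gamma> u" by (auto simp: horizontal_curve_iff_hcontrol)
  have "sr_length a b (\<lambda>t. \<gamma> (t + c)) = integral {a..b} (\<lambda>t. norm (u (t + c)))"
    by (rule hcontrol_integral(3)[OF hcontrol_shift[OF u] True])
  also have "\<dots> = integral {a+c..b+c} (\<lambda>t. norm (u t))"
    using integral_shift_real_ivl[of "a + c" c "b + c" "\<lambda>t. norm (u t)"] by simp
  finally show ?thesis using hcontrol_integral(3)[OF u] True by simp
qed (simp add: sr_length_def)

text \<open>The junction is put into the exceptional null set, so the glued curve may have a corner
  there. This admits the competitors that disprove optimality after a full period.\<close>

lemma horizontal_curve_join:
  assumes 1: "horizontal_curve a b \<gamma>" and 2: "horizontal_curve b c \<gamma>" and le: "a \<le> b" "b \<le> c"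
  shows "horizontal_curve a c \<gamma>"
proof -
  from 1 obtain L N where L: "L-lipschitz_on {a..b} \<gamma>" and N: "negligible N"
    "\<And>t. t \<in> {a..b} - N \<Longrightarrow> \<exists>v \<in> distribution (\<gamma> t). (\<gamma> has_vector_derivative v) (at t within {a..b})"
    unfolding horizontal_curve_def by blast
  from 2 obtain L' N' where L': "L'-lipschitz_on {b..c} \<gamma>" and N': "negligible N'"
    "\<And>t. t \<in> {b..c} - N' \<Longrightarrow> \<exists>v \<in> distribution (\<gamma> t). (\<gamma> has_vector_derivative v) (at t within {b..c})"
    unfolding horizontal_curve_def by blast
  have "(max L L')-lipschitz_on {a..c} \<gamma>"
    using lipschitz_on_concat_max[OF L L'] by simp
  moreover have "negligible (N \<union> N' \<union> {b})" using N N' by (intro negligible_Un) auto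
  moreover have "\<exists>v \<in> distribution (\<gamma> t). (\<gamma> has_vector_derivative v) (at t within {a..c})"
    if t: "t \<in> {a..c} - (N \<union> N' \<union> {b})" for t
  proof (cases "t < b")
    case True
    have "at t within {a..c} = at t within {a..b}"
      by (rule at_within_nhd[of t "{..<b}"]) (use True le in auto)
    then show ?thesis using N(2)[of t] t True by auto
  next
    case False
    have "at t within {a..c} = at t within {b..c}"
      by (rule at_within_nhd[of t "{b<..}"]) (use False t le in auto)
    then show ?thesis using N'(2)[of t] t False by auto
  qed
  ultimately show ?thesis unfolding horizontal_curve_def by blast
qed

lemma horizontal_curve_cong:
  assumes "\<And>t. t \<in> {a..b} \<Longrightarrow> \<gamma> t = \<gamma>' t"
  shows "horizontal_curve a b \<gamma> \<longleftrightarrow> horizontal_curve a b \<gamma>'"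
proof -
  have "horizontal_curve a b \<gamma>'" if "horizontal_curve a b \<gamma>" "\<And>t. t \<in> {a..b} \<Longrightarrow> \<gamma> t = \<gamma>' t"
    for \<gamma> \<gamma>' :: "real \<Rightarrow> 'a pgroup"
  proof -
    from that(1) obtain L N where L: "L-lipschitz_on {a..b} \<gamma>" and N: "negligible N"
      "\<And>t. t \<in> {a..b} - N \<Longrightarrow> \<exists>v \<in> distribution (\<gamma> t). (\<gamma> has_vector_derivative v) (at t within {a..b})"
      unfolding horizontal_curve_def by blast
    have "L-lipschitz_on {a..b} \<gamma>'" by (rule lipschitz_on_transform[OF L]) (simp add: that(2))
    moreover have "\<exists>v \<in> distribution (\<gamma>' t). (\<gamma>' has_vector_derivative v) (at t within {a..b})" if t: "t \<in> {a..b} - N" for t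
      using N(2)[OF t] \<open>\<And>t. t \<in> {a..b} \<Longrightarrow> \<gamma> t = \<gamma>' t\<close> t
      by (metis DiffD1 has_vector_derivative_transform)
    ultimately show ?thesis unfolding horizontal_curve_def using N(1) by blast
  qed
  from this[of \<gamma> \<gamma>'] this[of \<gamma>' \<gamma>] assms show ?thesis by auto
qed

lemma sr_length_cong:
  assumes "horizontal_curve a b \<gamma>" "\<And>t. t \<in> {a..b} \<Longrightarrow> \<gamma> t = \<gamma>' t"
  shows "sr_length a b \<gamma> = sr_length a b \<gamma>'"
proof (cases "a \<le> b")
  case True
  from assms obtain u where u: "hcontrol a b \<gamma> u" by (auto simp: horizontal_curve_iff_hcontrol)
  have "hcontrol a b \<gamma>' u"
  proof -
    from u obtain L N where L: "L-lipschitz_on {a..b} \<gamma>" and N: "negligible N"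
      and D: "\<And>t. t \<in> {a..b} - N \<Longrightarrow> (\<gamma> has_vector_derivative hlift (\<gamma> t) (u t)) (at t within {a..b})"
      unfolding hcontrol_def by blast
    have "L-lipschitz_on {a..b} \<gamma>'" by (rule lipschitz_on_transform[OF L]) (simp add: assms(2))
    moreover have "(\<gamma>' has_vector_derivative hlift (\<gamma>' t) (u t)) (at t within {a..b})" if t: "t \<in> {a..b} - N" for t
      using D[OF t] assms(2) t by (metis DiffD1 has_vector_derivative_transform)
    ultimately show ?thesis unfolding hcontrol_def using N(1) by blast
  qed
  then show ?thesis using hcontrol_integral(3)[OF u True] hcontrol_integral(3)[of a b \<gamma>' u] True by simp
qed (simp add: sr_length_def)

lemma smooth_horizontal_curve:
  assumes D: "\<And>t. t \<in> {a..b} \<Longrightarrow> (\<gamma> has_vector_derivative hlift (\<gamma> t) (u t)) (at t within {a..b})"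
    and c: "continuous_on {a..b} u"
  shows "hcontrol a b \<gamma> u"
proof -
  have \<gamma>c: "continuous_on {a..b} \<gamma>"
    by (rule continuous_on_vector_derivative) (rule D)
  have "continuous_on {a..b} (\<lambda>t. hlift (\<gamma> t) (u t))"
    unfolding hlift_def by (intro continuous_intros \<gamma>c c)
  then have "bounded ((\<lambda>t. hlift (\<gamma> t) (u t)) ` {a..b})"
    by (intro compact_imp_bounded compact_continuous_image) auto
  then obtain B where "B > 0" "\<forall>x\<in>(\<lambda>t. hlift (\<gamma> t) (u t)) ` {a..b}. norm x \<le> B"
    unfolding bounded_pos by blast
  then have B: "\<And>t. t \<in> {a..b} \<Longrightarrow> norm (hlift (\<gamma> t) (u t)) \<le> B" "B > 0" by auto
  have "B-lipschitz_on {a..b} \<gamma>"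
  proof (rule bounded_derivative_imp_lipschitz)
    fix t assume t: "t \<in> {a..b}"
    show "(\<gamma> has_derivative (\<lambda>h. h *\<^sub>R hlift (\<gamma> t) (u t))) (at t within {a..b})"
      using D[OF t] by (simp add: has_vector_derivative_def)
    show "onorm (\<lambda>h. h *\<^sub>R hlift (\<gamma> t) (u t)) \<le> B"
      by (rule onorm_bound) (use B mult_left_mono[OF B(1)[OF t], of "\<bar>_\<bar>"] in \<open>auto simp: mult.commute\<close>)
  qed (use B in auto)
  then show ?thesis unfolding hcontrol_def using D negligible_empty by (metis Diff_empty)
qed

section \<open>Calibrations\<close>

text \<open>The coefficient \<^term>\<open>kap w t\<close> is $\frac w2\cot\frac{wt}2$, continued by $\frac1t$ to $w = 0$.\<close>

definition kap :: "real \<Rightarrow> real \<Rightarrow> real" where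
  "kap w t = (if w = 0 then 1 / t else (w / 2) * sin (w * t) / (1 - cos (w * t)))"

lemma one_minus_cos_pos: "0 < x \<Longrightarrow> x < 2 * pi \<Longrightarrow> 0 < 1 - cos (x::real)"
proof -
  assume x: "0 < x" "x < 2 * pi"
  have "sin (x / 2) > 0" using x by (intro sin_gt_zero) auto
  then have "0 < 2 * (sin (x / 2))\<^sup>2" by simp
  also have "\<dots> = 1 - cos x" using cos_double_sin[of "x / 2"] by simp
  finally show ?thesis .
qed

text \<open>This Riccati equation is what makes \<open>hj\<close> solve the Hamilton-Jacobi
  equation; the bound on w t keeps away from the pole of the cotangent.\<close>

lemma kap_has_derivative:
  assumes "0 < t" "0 \<le> w" "w * t < 2 * pi"
  shows "(kap w has_real_derivative - ((kap w t)\<^sup>2 + w\<^sup>2 / 4)) (at t)"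
proof (cases "w = 0")
  case True
  have "((\<lambda>t. 1 / t) has_real_derivative - ((1 / t)\<^sup>2)) (at t)"
    using assms by (auto intro!: derivative_eq_intros simp: power2_eq_square)
  then show ?thesis using True by (simp add: kap_def[abs_def])
next
  case False
  define S C where SC: "S = sin (w * t)" "C = cos (w * t)"
  have c: "1 - C > 0" using one_minus_cos_pos[of "w * t"] assms False by (simp add: SC)
  have sq: "S * S = 1 - C * C" using sin_cos_squared_add3[of "w * t"] unfolding SC by linarith
  have D1: "((\<lambda>t. (w / 2) * sin (w * t)) has_real_derivative (w / 2) * (C * w)) (at t)"
    by (auto intro!: derivative_eq_intros simp: SC)
  have D2: "((\<lambda>t. 1 - cos (w * t)) has_real_derivative S * w) (at t)"
    by (auto intro!: derivative_eq_intros simp: SC)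
  have "((\<lambda>t. (w / 2) * sin (w * t) / (1 - cos (w * t))) has_real_derivative
     ((w / 2) * (C * w) * (1 - C) - (w / 2) * S * (S * w)) / ((1 - C) * (1 - C))) (at t)"
    using DERIV_divide[OF D1 D2] c by (simp add: SC)
  also have "((w / 2) * (C * w) * (1 - C) - (w / 2) * S * (S * w)) / ((1 - C) * (1 - C))
     = - ((kap w t)\<^sup>2 + w\<^sup>2 / 4)"
  proof -
    define E where "E = (1 - C) * (1 - C)"
    have E: "E \<noteq> 0" using c by (simp add: E_def)
    have n: "(w / 2) * (C * w) * (1 - C) - (w / 2) * S * (S * w) = - (w\<^sup>2 / 4 * (S * S + E))"
    proof -
      have "(w / 2) * (C * w) * (1 - C) - (w / 2) * S * (S * w) = w\<^sup>2 / 2 * (C * (1 - C) - S * S)"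
        by (simp add: power2_eq_square field_simps)
      also have "\<dots> = - (w\<^sup>2 / 4 * (S * S + E))"
        unfolding E_def sq by (simp add: field_simps)
      finally show ?thesis .
    qed
    have "(kap w t)\<^sup>2 = ((w / 2) * S)\<^sup>2 / (1 - C)\<^sup>2"
      using False by (simp only: kap_def SC[symmetric] if_False power_divide)
    also have "((w / 2) * S)\<^sup>2 = w\<^sup>2 / 4 * (S * S)" by (simp add: power2_eq_square)
    also have "(1 - C)\<^sup>2 = E" by (simp add: E_def power2_eq_square)
    finally have "(kap w t)\<^sup>2 = w\<^sup>2 / 4 * (S * S) / E" .
    then have "(kap w t)\<^sup>2 + w\<^sup>2 / 4 = w\<^sup>2 / 4 * (S * S + E) / E"
      using E by (simp add: add_divide_distrib distrib_left)
    then show ?thesis unfolding n E_def[symmetric] by simp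
  qed
  finally show ?thesis using False by (simp add: kap_def[abs_def])
qed

lemma kap_antimono:
  assumes "0 < s" "s \<le> t" "0 \<le> w" "w * t < 2 * pi"
  shows "kap w t \<le> kap w s"
proof (rule DERIV_nonpos_imp_nonincreasing[OF assms(2)])
  fix x assume x: "s \<le> x" "x \<le> t"
  have "w * x \<le> w * t" using x assms by (intro mult_left_mono) auto
  then have "(kap w has_real_derivative - ((kap w x)\<^sup>2 + w\<^sup>2 / 4)) (at x)"
    using x assms by (intro kap_has_derivative) auto
  then show "\<exists>y. (kap w has_real_derivative y) (at x) \<and> y \<le> 0"
    by (intro exI conjI) (auto intro!: add_nonneg_nonneg simp del: minus_add_distrib)
qed

text \<open>With f = w t / 2 this is the inequality f cot f \<le> 1, that is, sin f - f cos f \<ge>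
  0; the derivative of the left side is f sin f.\<close>

lemma kap_le:
  assumes "0 < t" "0 \<le> w" "w * t < 2 * pi"
  shows "kap w t \<le> 1 / t"
proof (cases "w = 0")
  case False
  define f where "f = w * t / 2"
  have f: "0 < f" "f < pi" "w * t = 2 * f" using assms False by (auto simp: f_def)
  have "0 \<le> sin f - f * cos f"
  proof -
    have "sin 0 - 0 * cos 0 \<le> sin f - f * cos f"
    proof (rule DERIV_nonneg_imp_nondecreasing[where f = "\<lambda>f. sin f - f * cos f" and a = 0 and b = f])
      fix x assume x: "0 \<le> x" "x \<le> f"
      have "((\<lambda>f. sin f - f * cos f) has_real_derivative x * sin x) (at x)"
        by (auto intro!: derivative_eq_intros)
      moreover have "0 \<le> x * sin x" using x f by (intro mult_nonneg_nonneg sin_ge_zero) auto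
      ultimately show "\<exists>y. ((\<lambda>f. sin f - f * cos f) has_real_derivative y) (at x) \<and> 0 \<le> y" by blast
    qed (use f in auto)
    then show ?thesis by simp
  qed
  then have "0 \<le> 4 * sin f * (sin f - f * cos f)" using sin_gt_zero[OF f(1,2)] by (intro mult_nonneg_nonneg) auto
  also have "\<dots> = 2 * (1 - cos (2 * f)) - 2 * f * sin (2 * f)"
    unfolding cos_double_sin sin_double by (simp add: power2_eq_square algebra_simps)
  finally have "w * t * sin (w * t) \<le> 2 * (1 - cos (w * t))" by (simp add: f)
  moreover have "1 - cos (w * t) > 0" using one_minus_cos_pos[of "w * t"] assms False by simp
  ultimately show ?thesis using False assms by (simp add: kap_def divide_simps algebra_simps)
qed (use assms in \<open>simp add: kap_def\<close>)

text \<open>The cotangent is odd about the midpoint between its poles. The behaviour of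
  \<open>kap\<close> at the end of a period is thereby reduced to its behaviour at time 0, where
  \<open>kap_le\<close> applies.\<close>

lemma kap_reflect:
  assumes "w * T = 2 * pi"
  shows "kap w (T - t) = - kap w t"
proof -
  have "w \<noteq> 0" using assms by auto
  moreover have "w * (T - t) = 2 * pi - w * t" using assms by (simp add: algebra_simps)
  ultimately show ?thesis by (simp add: kap_def)
qed

text \<open>For fixed \<^term>\<open>p\<close> this is a solution of the Hamilton-Jacobi equation
  $\partial_t W + \frac14 |\nabla_\Delta W|^2 = 0$, and \<^term>\<open>half_grad\<close> below is half of its horizontal
  gradient.\<close>

definition hj :: "real ^ 'n::finite \<Rightarrow> real \<Rightarrow> 'n pgroup \<Rightarrow> real" where
  "hj p t q = (case q of (x, l, y) \<Rightarrow> kap (norm p) t * (x\<^sup>2 + (l \<bullet> sgn p)\<^sup>2)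
     + ((norm l)\<^sup>2 - (l \<bullet> sgn p)\<^sup>2) / t + 2 * (p \<bullet> y))"

definition half_grad :: "real ^ 'n::finite \<Rightarrow> real \<Rightarrow> 'n pgroup \<Rightarrow> real \<times> (real ^ 'n)" where
  "half_grad p t q = (case q of (x, l, y) \<Rightarrow> (kap (norm p) t * x + norm p / 2 * (l \<bullet> sgn p),
     (kap (norm p) t * (l \<bullet> sgn p)) *\<^sub>R sgn p + (1 / t) *\<^sub>R (l - (l \<bullet> sgn p) *\<^sub>R sgn p) - (x / 2) *\<^sub>R p))"

lemma norm_scaleR_sgn: "norm p *\<^sub>R sgn p = (p :: 'a::real_normed_vector)"
  by (cases "p = 0") (simp_all add: sgn_div_norm)

section \<open>The Hamilton-Jacobi equation and the ends of the time interval\<close>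

text \<open>With g the half gradient, the equation reads W_t = - |g|^2. Along a curve with control u
  the chain rule gives W_t + 2 g.u = 2 g.u - |g|^2, and the square is completed.\<close>

lemma hj_vector_derivative:
  assumes D: "(\<gamma> has_vector_derivative hlift (\<gamma> t) u) (at t within S)"
    and t: "0 < t" "norm p * t < 2 * pi"
  shows "((\<lambda>t. hj p t (\<gamma> t)) has_real_derivative (norm u)\<^sup>2 - (norm (u - half_grad p t (\<gamma> t)))\<^sup>2) (at t within S)"
proof -
  define w e where we: "w = norm p" "e = sgn p"
  have p: "p = w *\<^sub>R e" by (simp add: we norm_scaleR_sgn)
  obtain x l y where q: "\<gamma> t = (x, l, y)" by (cases "\<gamma> t")
  obtain u0 u1 where u: "u = (u0, u1)" by (cases u)
  have Dx: "((\<lambda>t. fst (\<gamma> t)) has_real_derivative u0) (at t within S)"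
    and Dl: "((\<lambda>t. fst (snd (\<gamma> t))) has_vector_derivative u1) (at t within S)"
    and Dy: "((\<lambda>t. snd (snd (\<gamma> t))) has_vector_derivative (1/2) *\<^sub>R (u0 *\<^sub>R l - x *\<^sub>R u1)) (at t within S)"
    using bounded_linear.has_vector_derivative[OF bounded_linear_fst D]
      bounded_linear.has_vector_derivative[OF bounded_linear_fst_comp[OF bounded_linear_snd] D]
      bounded_linear.has_vector_derivative[OF bounded_linear_snd_comp[OF bounded_linear_snd] D]
    by (simp_all add: hlift_def q u has_real_derivative_iff_has_vector_derivative)
  define X H N P where XHNP: "X t = fst (\<gamma> t)" "H t = fst (snd (\<gamma> t)) \<bullet> e"
    "N t = fst (snd (\<gamma> t)) \<bullet> fst (snd (\<gamma> t))" "P t = p \<bullet> snd (snd (\<gamma> t))" for t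
  have DX: "(X has_real_derivative u0) (at t within S)" using Dx by (simp add: XHNP[abs_def])
  have DH: "(H has_real_derivative u1 \<bullet> e) (at t within S)"
    using bounded_linear.has_vector_derivative[OF bounded_linear_inner_left[of e] Dl]
    by (simp add: XHNP[abs_def] has_real_derivative_iff_has_vector_derivative)
  have DP: "(P has_real_derivative p \<bullet> ((1/2) *\<^sub>R (u0 *\<^sub>R l - x *\<^sub>R u1))) (at t within S)"
    using bounded_linear.has_vector_derivative[OF bounded_linear_inner_right[of p] Dy]
    by (simp add: XHNP[abs_def] has_real_derivative_iff_has_vector_derivative)
  have DN: "(N has_real_derivative 2 * (l \<bullet> u1)) (at t within S)"
    unfolding has_field_derivative_def XHNP[abs_def]
    by (rule has_derivative_eq_rhs[OF has_derivative_inner[OF Dl[unfolded has_vector_derivative_def]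
          Dl[unfolded has_vector_derivative_def]]]) (simp add: fun_eq_iff q inner_commute)
  have DK: "(kap w has_real_derivative - ((kap w t)\<^sup>2 + w\<^sup>2 / 4)) (at t within S)"
    using kap_has_derivative[of t w] t by (auto simp: we intro: has_field_derivative_at_within)
  have eq: "hj p t (\<gamma> t) = kap w t * ((X t)\<^sup>2 + (H t)\<^sup>2) + (N t - (H t)\<^sup>2) / t + 2 * P t" for t
    by (simp add: hj_def we case_prod_beta XHNP power2_norm_eq_inner)
  have v: "X t = x" "H t = l \<bullet> e" "N t = l \<bullet> l" by (simp_all add: XHNP q)
  define h v k where hv: "h = l \<bullet> e" "v = u1 \<bullet> e" "k = kap w t"
  have "((\<lambda>t. hj p t (\<gamma> t)) has_real_derivative
     (- (k\<^sup>2 + w\<^sup>2 / 4) * (x\<^sup>2 + h\<^sup>2) + k * (2 * x * u0 + 2 * h * v)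
     + ((2 * (l \<bullet> u1) - 2 * h * v) * t - (l \<bullet> l - h\<^sup>2)) / (t * t) + w * (u0 * h - x * v))) (at t within S)"
  proof -
    have D1: "((\<lambda>t. (X t)\<^sup>2 + (H t)\<^sup>2) has_real_derivative 2 * x * u0 + 2 * h * v) (at t within S)"
      using DERIV_add[OF DERIV_power[OF DX, of 2] DERIV_power[OF DH, of 2]] by (simp add: v hv mult_ac)
    have D2: "((\<lambda>t. N t - (H t)\<^sup>2) has_real_derivative 2 * (l \<bullet> u1) - 2 * h * v) (at t within S)"
      using DERIV_diff[OF DN DERIV_power[OF DH, of 2]] by (simp add: v hv mult_ac)
    have D3: "((\<lambda>t. (N t - (H t)\<^sup>2) / t) has_real_derivative
        ((2 * (l \<bullet> u1) - 2 * h * v) * t - (l \<bullet> l - h\<^sup>2)) / (t * t)) (at t within S)"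
      using DERIV_divide[OF D2 DERIV_ident] t by (simp add: v hv)
    have D4: "((\<lambda>t. 2 * P t) has_real_derivative w * (u0 * h - x * v)) (at t within S)"
      using DERIV_cmult[OF DP, of 2] by (simp add: p hv inner_simps inner_commute[of e] algebra_simps)
    show ?thesis
      using DERIV_add[OF DERIV_add[OF DERIV_mult[OF DK D1] D3] D4]
      unfolding eq by (simp add: v hv[symmetric] algebra_simps)
  qed
  also have "(- (k\<^sup>2 + w\<^sup>2 / 4) * (x\<^sup>2 + h\<^sup>2) + k * (2 * x * u0 + 2 * h * v)
     + ((2 * (l \<bullet> u1) - 2 * h * v) * t - (l \<bullet> l - h\<^sup>2)) / (t * t) + w * (u0 * h - x * v))
     = (norm u)\<^sup>2 - (norm (u - half_grad p t (\<gamma> t)))\<^sup>2"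
  proof -
    \<comment> \<open>For p = 0 the unit vector degenerates to sgn 0 = 0, but then w = 0 as well,
      and all terms containing \<open>e\<close> drop out consistently.\<close>
    have ee: "e \<bullet> e = 1 \<or> (e = 0 \<and> w = 0)"
      by (cases "p = 0") (auto simp: we sgn_div_norm dot_square_norm power2_eq_square)
    define r where "r = 1 / t"
    define g where "g = (k * h - x * w / 2) *\<^sub>R e + r *\<^sub>R (l - h *\<^sub>R e)"
    have "(x / 2) *\<^sub>R p = (x * w / 2) *\<^sub>R e" by (simp add: p)
    then have g: "half_grad p t (\<gamma> t) = (k * x + w / 2 * h, g)"
      unfolding half_grad_def q prod.case we[symmetric] hv g_def r_def by (simp add: algebra_simps)
    have "(norm u)\<^sup>2 - (norm (u - half_grad p t (\<gamma> t)))\<^sup>2 = 2 * (u \<bullet> half_grad p t (\<gamma> t)) - half_grad p t (\<gamma> t) \<bullet> half_grad p t (\<gamma> t)"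
      by (simp add: power2_norm_eq_inner inner_diff_left inner_diff_right inner_commute)
    also have "\<dots> = 2 * (u0 * (k * x + w / 2 * h) + u1 \<bullet> g) - ((k * x + w / 2 * h)\<^sup>2 + g \<bullet> g)"
      by (simp add: g u power2_eq_square)
    also have "u1 \<bullet> g = (k * h - x * w / 2) * v + r * (l \<bullet> u1 - h * v)"
      by (simp add: g_def inner_simps hv inner_commute[of u1 l])
    also have "g \<bullet> g = (k * h - x * w / 2)\<^sup>2 + r * r * (l \<bullet> l - h\<^sup>2)"
      using ee
    proof
      assume ee: "e \<bullet> e = 1"
      define m where "m = k * h - x * w / 2"
      have "g \<bullet> g = m\<^sup>2 * (e \<bullet> e) + 2 * m * r * (h - h * (e \<bullet> e))
         + r\<^sup>2 * (l \<bullet> l - 2 * h * h + h * h * (e \<bullet> e))"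
        unfolding g_def m_def[symmetric]
        by (simp add: inner_simps inner_commute[of e l] hv(1)[symmetric]) (simp add: power2_eq_square algebra_simps)
      then show ?thesis by (simp add: ee power2_eq_square m_def)
    qed (simp add: g_def hv power2_eq_square)
    finally have E: "(norm u)\<^sup>2 - (norm (u - half_grad p t (\<gamma> t)))\<^sup>2 =
      2 * (u0 * (k * x + w / 2 * h) + ((k * h - x * w / 2) * v + r * (l \<bullet> u1 - h * v)))
      - ((k * x + w / 2 * h)\<^sup>2 + ((k * h - x * w / 2)\<^sup>2 + r * r * (l \<bullet> l - h\<^sup>2)))" .
    have "((2 * (l \<bullet> u1) - 2 * h * v) * t - (l \<bullet> l - h\<^sup>2)) / (t * t)
      = 2 * r * (l \<bullet> u1 - h * v) - r * r * (l \<bullet> l - h\<^sup>2)"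
      using t(1) by (simp add: r_def field_simps)
    then show ?thesis unfolding E by (simp only:) (simp add: power2_eq_square algebra_simps)
  qed
  finally show ?thesis .
qed

lemma inner_sgn_sq_le: "(l \<bullet> sgn p)\<^sup>2 \<le> (norm (l :: 'a::real_inner))\<^sup>2"
proof -
  have "\<bar>l \<bullet> sgn p\<bar> \<le> norm l * norm (sgn p)" by (rule Cauchy_Schwarz_ineq2)
  also have "\<dots> \<le> norm l * 1" by (intro mult_left_mono) (auto simp: norm_sgn)
  finally show ?thesis using abs_le_square_iff[of "l \<bullet> sgn p" "norm l"] by simp
qed

text \<open>As \<open>kap\<close> is at most 1 / t, the planar part of W is at most the energy of a
  straight segment. This bound governs W as the time tends to 0.\<close>

lemma hj_le:
  assumes t: "0 < t" "norm p * t < 2 * pi"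
  shows "hj p t q \<le> (norm (hproj q))\<^sup>2 / t + 2 * norm p * norm (snd (snd q))"
proof -
  obtain x l y where q: "q = (x, l, y)" by (cases q)
  have "kap (norm p) t * (x\<^sup>2 + (l \<bullet> sgn p)\<^sup>2) \<le> 1 / t * (x\<^sup>2 + (l \<bullet> sgn p)\<^sup>2)"
    using kap_le[of t "norm p"] t by (intro mult_right_mono) auto
  moreover have "p \<bullet> y \<le> norm p * norm y" by (rule norm_cauchy_schwarz)
  moreover have "(norm (hproj q))\<^sup>2 = x\<^sup>2 + (norm l)\<^sup>2" by (simp add: q hproj_def norm_Pair)
  ultimately show ?thesis by (simp add: hj_def q add_divide_distrib diff_divide_distrib)
qed

text \<open>Both coefficients decrease in time. In the second alternative t is the pole of
  \<open>kap\<close>, but the factor of \<open>kap\<close> vanishes at such points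
  \<open>q\<close>.\<close>

lemma hj_antimono:
  assumes "0 < s" "s \<le> t" "norm p * t < 2 * pi \<or> (norm p * t = 2 * pi \<and> fst q = 0 \<and> p \<bullet> fst (snd q) = 0)"
  shows "hj p t q \<le> hj p s q"
proof -
  obtain x l y where q: "q = (x, l, y)" by (cases q)
  have 1: "((norm l)\<^sup>2 - (l \<bullet> sgn p)\<^sup>2) / t \<le> ((norm l)\<^sup>2 - (l \<bullet> sgn p)\<^sup>2) / s"
    using assms(1,2) inner_sgn_sq_le[of l p] by (intro divide_left_mono) auto
  have 2: "kap (norm p) t * (x\<^sup>2 + (l \<bullet> sgn p)\<^sup>2) \<le> kap (norm p) s * (x\<^sup>2 + (l \<bullet> sgn p)\<^sup>2)"
    using assms(3)
  proof
    assume "norm p * t < 2 * pi"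
    then show ?thesis using assms by (intro mult_right_mono kap_antimono) auto
  next
    assume "norm p * t = 2 * pi \<and> fst q = 0 \<and> p \<bullet> fst (snd q) = 0"
    then show ?thesis by (simp add: q sgn_div_norm inner_commute)
  qed
  show ?thesis using 1 2 by (simp add: hj_def q)
qed

text \<open>Since the horizontal line from \<^term>\<open>q\<close> is admissible, the sum-of-squares formula for the
  derivative of \<^term>\<open>hj\<close> gives the increment without any Taylor remainder; only the vertical
  displacement relative to that line is left over.\<close>

lemma hj_increment:
  assumes t: "0 < t" "t \<le> t'" "norm p * t' < 2 * pi"
    and d: "norm (hproj q' - hproj q) \<le> t' - t"
  shows "hj p t' q' \<le> hj p t q + (t' - t) + 2 * (p \<bullet> snd (snd (pg_mult (- q) q')))"
proof -
  obtain x l y where q: "q = (x, l, y)" by (cases q)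
  obtain x' l' y' where q': "q' = (x', l', y')" by (cases q')
  define \<rho> where "\<rho> = snd (snd (pg_mult (- q) q'))"
  have \<rho>: "\<rho> = y' - y + (1/2) *\<^sub>R (x *\<^sub>R l' - x' *\<^sub>R l)" by (simp add: \<rho>_def q q' algebra_simps)
  define D where "D = t' - t"
  show ?thesis
  proof (cases "D = 0")
    case True
    then have "x' = x" "l' = l" using d by (simp_all add: D_def q q' hproj_def zero_prod_def)
    then show ?thesis using True unfolding \<rho>_def[symmetric] \<rho> by (simp add: D_def hj_def q q' inner_simps algebra_simps)
  next
    case False
    then have D: "D > 0" using t by (simp add: D_def)
    \<comment> \<open>The constant control that produces the planar displacement in the given time;
      by hypothesis its norm is at most 1.\<close>
    define u where "u = (1 / D) *\<^sub>R (x' - x, l' - l)"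
    have un: "norm u \<le> 1"
    proof -
      have "norm u = norm (x' - x, l' - l) / D" unfolding u_def norm_scaleR using D by simp
      also have "\<dots> \<le> 1" using d D by (simp add: q q' hproj_def D_def[symmetric])
      finally show ?thesis .
    qed
    have uD: "D * fst u = x' - x" "D *\<^sub>R snd u = l' - l" using D by (simp_all add: u_def)
    \<comment> \<open>The horizontal line with this control. It reaches the planar coordinates of
      \<open>q'\<close> at time \<open>t'\<close> and misses \<open>q'\<close> only by the vertical
      vector \<rho>.\<close>
    define c where "c s = (x + (s - t) * fst u, l + (s - t) *\<^sub>R snd u,
       y + ((s - t) / 2) *\<^sub>R (fst u *\<^sub>R l - x *\<^sub>R snd u))" for s
    have Dc: "(c has_vector_derivative hlift (c s) u) (at s)" for s
    proof -
      have "(c has_vector_derivative (fst u, snd u, (1/2) *\<^sub>R (fst u *\<^sub>R l - x *\<^sub>R snd u))) (at s)"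
        unfolding c_def[abs_def]
        by (auto intro!: derivative_eq_intros has_vector_derivative_Pair simp: has_real_derivative_iff_has_vector_derivative[symmetric])
      then show ?thesis by (simp add: hlift_def c_def algebra_simps)
    qed
    have "hj p t' (c t') - t' \<le> hj p t (c t) - t"
    proof (rule DERIV_nonpos_imp_nonincreasing[OF t(2), where f = "\<lambda>s. hj p s (c s) - s"])
      fix s assume s: "t \<le> s" "s \<le> t'"
      have "norm p * s \<le> norm p * t'" using s by (intro mult_left_mono) auto
      then have "((\<lambda>s. hj p s (c s)) has_real_derivative (norm u)\<^sup>2 - (norm (u - half_grad p s (c s)))\<^sup>2) (at s)"
        using hj_vector_derivative[OF Dc] s t by auto
      then have "((\<lambda>s. hj p s (c s) - s) has_real_derivative (norm u)\<^sup>2 - (norm (u - half_grad p s (c s)))\<^sup>2 - 1) (at s)"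
        by (auto intro!: derivative_eq_intros)
      moreover have "(norm u)\<^sup>2 \<le> 1" using un by (simp add: power_le_one)
      ultimately show "\<exists>y. ((\<lambda>s. hj p s (c s) - s) has_real_derivative y) (at s) \<and> y \<le> 0"
        by (smt (verit) zero_le_power2)
    qed
    moreover have "c t = q" by (simp add: c_def q)
    moreover have "hj p t' q' = hj p t' (c t') + 2 * (p \<bullet> \<rho>)"
    proof -
      have "c t' = (x', l', y' - \<rho>)"
      proof -
        have "(D / 2) *\<^sub>R (fst u *\<^sub>R l - x *\<^sub>R snd u) = (1/2) *\<^sub>R ((D * fst u) *\<^sub>R l - x *\<^sub>R (D *\<^sub>R snd u))"
          by (simp add: algebra_simps)
        then show ?thesis by (simp add: c_def D_def[symmetric] uD \<rho>) (simp add: algebra_simps)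
      qed
      then show ?thesis by (simp add: hj_def q' inner_simps)
    qed
    ultimately show ?thesis unfolding \<rho>_def[symmetric] by simp
  qed
qed

section \<open>Monotonicity of the calibration along Lipschitz curves\<close>

text \<open>Cutting the range of \<sigma> into n equal parts gives n increments of size K (D/n)^2,
  whose sum tends to 0. The parts are chosen by values of \<sigma>, since \<sigma> is only
  continuous and monotone in the parameter.\<close>

lemma le_of_quadratic_increments:
  fixes F \<sigma> :: "real \<Rightarrow> real"
  assumes ab: "a \<le> b" and cont: "continuous_on {a..b} \<sigma>"
    and mono: "\<And>s t. a \<le> s \<Longrightarrow> s \<le> t \<Longrightarrow> t \<le> b \<Longrightarrow> \<sigma> s \<le> \<sigma> t"
    and inc: "\<And>s t. a \<le> s \<Longrightarrow> s \<le> t \<Longrightarrow> t \<le> b \<Longrightarrow> F t - F s \<le> K * (\<sigma> t - \<sigma> s)\<^sup>2"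
  shows "F b \<le> F a"
proof -
  define D where "D = \<sigma> b - \<sigma> a"
  have D0: "D \<ge> 0" using mono[of a b] ab by (simp add: D_def)
  have main: "F b - F a \<le> K * D\<^sup>2 / real n" if n: "n > 0" for n :: nat
  proof (cases "D = 0")
    case True
    then show ?thesis using inc[of a b] ab by (simp add: D_def)
  next
    case False
    with D0 have D: "D > 0" by simp
    have "\<exists>s. a \<le> s \<and> s \<le> b \<and> \<sigma> s = \<sigma> a + D * real j / real n" if "j \<le> n" for j
    proof (rule IVT'[OF _ _ ab cont])
      show "\<sigma> a \<le> \<sigma> a + D * real j / real n" using D0 by simp
      have "D * real j / real n \<le> D" using that n D by (simp add: divide_simps)
      then show "\<sigma> a + D * real j / real n \<le> \<sigma> b" by (simp add: D_def)
    qed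
    then obtain s where s: "\<And>j. j \<le> n \<Longrightarrow> a \<le> s j \<and> s j \<le> b \<and> \<sigma> (s j) = \<sigma> a + D * real j / real n"
      by metis
    have step: "F (s j) - F a \<le> real j * (K * (D / real n)\<^sup>2)" if "j \<le> n" for j
      using that
    proof (induction j)
      case 0
      then show ?case using inc[of a "s 0"] s[of 0] by simp
    next
      case (Suc j)
      have eq: "\<sigma> (s (Suc j)) = \<sigma> (s j) + D / real n"
        using s[of j] s[of "Suc j"] Suc.prems by (simp add: add_divide_distrib distrib_left)
      have lt: "\<sigma> (s j) < \<sigma> (s (Suc j))" using eq D n by simp
      have "s j \<le> s (Suc j)"
      proof (rule ccontr)
        assume "\<not> s j \<le> s (Suc j)"
        then have "\<sigma> (s (Suc j)) \<le> \<sigma> (s j)" using s[of j] s[of "Suc j"] Suc.prems by (intro mono) auto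
        with lt show False by simp
      qed
      then have "F (s (Suc j)) - F (s j) \<le> K * (\<sigma> (s (Suc j)) - \<sigma> (s j))\<^sup>2"
        using s[of j] s[of "Suc j"] Suc.prems by (intro inc) auto
      also have "\<sigma> (s (Suc j)) - \<sigma> (s j) = D / real n"
        using eq by simp
      finally show ?case using Suc by (simp add: algebra_simps)
    qed
    \<comment> \<open>The last division point need not be \<open>b\<close>, because \<sigma> may be
      constant near the end; the remaining increment of \<sigma> is 0. The base case of the
      induction treats the left end in the same way.\<close>
    have "F b - F (s n) \<le> K * (\<sigma> b - \<sigma> (s n))\<^sup>2" using s[of n] by (intro inc) auto
    also have "\<sigma> (s n) = \<sigma> b" using s[of n] n by (simp add: D_def)
    finally have "F b - F a \<le> real n * (K * (D / real n)\<^sup>2)" using step[of n] by simp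
    then show ?thesis using n by (simp add: power2_eq_square field_simps)
  qed
  have "(\<lambda>n. K * D\<^sup>2 / real (Suc n)) \<longlonglongrightarrow> 0"
    using tendsto_mult_right_zero[OF LIMSEQ_inverse_real_of_nat, of "K * D\<^sup>2"] by (simp add: divide_inverse)
  then have "F b - F a \<le> 0"
    by (rule tendsto_lowerbound) (auto simp del: of_nat_Suc intro!: always_eventually main)
  then show ?thesis by simp
qed

text \<open>The time argument of W advances by the length of the curve, so no reparametrization by
  arc length is made. Over a short arc, \<open>hj_increment\<close> leaves only the vertical
  displacement from the chord, which is quadratic in the length.\<close>

lemma hj_nonincreasing:
  assumes \<gamma>: "horizontal_curve a b \<gamma>" and ab: "a \<le> b"
    and t: "0 < t" "norm p * (t + sr_length a b \<gamma>) < 2 * pi"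
  shows "hj p (t + sr_length a b \<gamma>) (\<gamma> b) - (t + sr_length a b \<gamma>) \<le> hj p t (\<gamma> a) - t"
proof -
  define \<sigma> where "\<sigma> s = t + sr_length a s \<gamma>" for s
  have sub: "horizontal_curve c d \<gamma>" if "a \<le> c" "d \<le> b" for c d
    by (rule horizontal_curve_subset[OF \<gamma> that])
  have diff: "\<sigma> d - \<sigma> c = sr_length c d \<gamma>" if "a \<le> c" "c \<le> d" "d \<le> b" for c d
    using sr_length_add[OF sub[of a d], of c] that by (simp add: \<sigma>_def)
  have mono: "\<sigma> c \<le> \<sigma> d" if "a \<le> c" "c \<le> d" "d \<le> b" for c d
    using diff[OF that] sr_length_nonneg[OF sub[of c d]] that by simp
  have "hj p (\<sigma> b) (\<gamma> b) - \<sigma> b \<le> hj p (\<sigma> a) (\<gamma> a) - \<sigma> a"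
  proof (rule le_of_quadratic_increments[OF ab _ mono, where K = "norm p"])
    show "continuous_on {a..b} \<sigma>"
      unfolding \<sigma>_def[abs_def] by (intro continuous_intros continuous_on_sr_length \<gamma>)
    fix c d assume cd: "a \<le> c" "c \<le> d" "d \<le> b"
    have pos: "0 < \<sigma> c" using t(1) sr_length_nonneg[OF sub[of a c]] cd by (simp add: \<sigma>_def)
    have "norm p * \<sigma> d \<le> norm p * \<sigma> b" using mono[of d b] cd by (intro mult_left_mono) auto
    then have small: "norm p * \<sigma> d < 2 * pi" using t(2) by (simp add: \<sigma>_def)
    have chord: "norm (hproj (\<gamma> d) - hproj (\<gamma> c)) \<le> \<sigma> d - \<sigma> c"
      using hproj_le_sr_length[OF sub[of c d]] cd diff[OF cd] by simp
    have tr: "horizontal_curve c d (\<lambda>t. pg_mult (- \<gamma> c) (\<gamma> t))"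
      by (rule horizontal_curve_translate[OF sub]) (use cd in auto)
    have "norm (snd (snd (pg_mult (- \<gamma> c) (\<gamma> d)))) \<le> (\<sigma> d - \<sigma> c)\<^sup>2 / 2"
      using vertical_le_sr_length[OF tr] cd diff[OF cd] sr_length_translate[OF sub[of c d]]
      by (simp add: pg_mult_minus)
    then have "norm p * norm (snd (snd (pg_mult (- \<gamma> c) (\<gamma> d)))) \<le> norm p * ((\<sigma> d - \<sigma> c)\<^sup>2 / 2)"
      by (intro mult_left_mono) auto
    then have "p \<bullet> snd (snd (pg_mult (- \<gamma> c) (\<gamma> d))) \<le> norm p * ((\<sigma> d - \<sigma> c)\<^sup>2 / 2)"
      using norm_cauchy_schwarz[of p "snd (snd (pg_mult (- \<gamma> c) (\<gamma> d)))"] by simp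
    then show "hj p (\<sigma> d) (\<gamma> d) - \<sigma> d - (hj p (\<sigma> c) (\<gamma> c) - \<sigma> c) \<le> norm p * (\<sigma> d - \<sigma> c)\<^sup>2"
      using hj_increment[OF pos mono[OF cd] small chord] by simp
  qed
  moreover have "\<sigma> a = t" using sr_length_add[OF sub[of a a], of a] ab by (simp add: \<sigma>_def)
  ultimately show ?thesis by (simp add: \<sigma>_def)
qed

text \<open>W is singular at time 0, so the comparison starts after a short arc of length e. There W
  - e is at most |p| e, by \<open>hj_le\<close> and the quadratic vertical bound; then e tends to
  0.\<close>

lemma hj_le_sr_length:
  assumes \<gamma>: "horizontal_curve a b \<gamma>" and ab: "a \<le> b" and 0: "\<gamma> a = 0"
    and L: "0 < sr_length a b \<gamma>" "norm p * sr_length a b \<gamma> < 2 * pi"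
  shows "hj p (sr_length a b \<gamma>) (\<gamma> b) \<le> sr_length a b \<gamma>"
proof -
  let ?L = "sr_length a b \<gamma>"
  have "hj p ?L (\<gamma> b) - ?L \<le> norm p * e" if e: "0 < e" "e < min 1 ?L" for e
  proof -
    obtain s where s: "a \<le> s" "s \<le> b" "sr_length a s \<gamma> = e"
      using IVT'[of "\<lambda>s. sr_length a s \<gamma>" a e b] continuous_on_sr_length[OF \<gamma>] ab e
        sr_length_add[OF horizontal_curve_subset[OF \<gamma>, of a a], of a] by auto
    have h: "horizontal_curve a s \<gamma>" "horizontal_curve s b \<gamma>"
      using horizontal_curve_subset[OF \<gamma>] s by auto
    have sum: "e + sr_length s b \<gamma> = ?L" using sr_length_add[OF \<gamma> s(1,2)] s(3) by simp
    have small: "norm p * e < 2 * pi"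
      using L(2) e by (smt (verit) mult_left_mono norm_ge_zero)
    have 1: "hj p ?L (\<gamma> b) - ?L \<le> hj p e (\<gamma> s) - e"
      using hj_nonincreasing[OF h(2) s(2) e(1), of p] L(2) by (simp add: sum)
    have "hj p e (\<gamma> s) \<le> (norm (hproj (\<gamma> s)))\<^sup>2 / e + 2 * norm p * norm (snd (snd (\<gamma> s)))"
      by (rule hj_le[OF e(1) small])
    also have "(norm (hproj (\<gamma> s)))\<^sup>2 / e \<le> e\<^sup>2 / e"
      using hproj_le_sr_length[OF h(1) s(1)] e s(3) 0
      by (intro divide_right_mono power_mono) (auto simp: hproj_def zero_prod_def)
    also have "2 * norm p * norm (snd (snd (\<gamma> s))) \<le> 2 * norm p * (e\<^sup>2 / 2)"
      using vertical_le_sr_length[OF h(1) s(1) 0] s(3) by (intro mult_left_mono) auto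
    finally have "hj p e (\<gamma> s) - e \<le> norm p * e\<^sup>2" using e by (simp add: power2_eq_square)
    also have "\<dots> \<le> norm p * e" using e by (intro mult_left_mono) (auto simp: power2_eq_square)
    finally show ?thesis using 1 by simp
  qed
  then have ev: "\<forall>\<^sub>F e in at_right 0. hj p ?L (\<gamma> b) - ?L \<le> norm p * e"
    using L(1) by (auto simp: eventually_at_right[of 0 1] intro!: exI[of _ "min 1 ?L"])
  have "((\<lambda>e. norm p * e) \<longlongrightarrow> norm p * 0) (at_right 0)" by (intro tendsto_intros)
  from tendsto_lowerbound[OF this ev] show ?thesis by simp
qed

section \<open>Helices\<close>

text \<open>The solution of x'' = b - w^2 x with x(0) = 0 and x'(0) = a; the branch w = 0 is the
  continuous limit of the other one. \<open>hel_u\<close> below is its velocity.\<close>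

definition hel_x :: "real \<Rightarrow> real \<Rightarrow> real \<Rightarrow> real \<Rightarrow> real" where
  "hel_x a b w t = (if w = 0 then a * t + b * t\<^sup>2 / 2 else a * sin (w * t) / w + b * (1 - cos (w * t)) / w\<^sup>2)"

definition hel_u :: "real \<Rightarrow> real \<Rightarrow> real \<Rightarrow> real \<Rightarrow> real" where
  "hel_u a b w t = (if w = 0 then a + b * t else a * cos (w * t) + b * sin (w * t) / w)"

text \<open>The integrals over \<^term>\<open>{0..t}\<close> of \<^const>\<open>hel_x\<close> and of its square.\<close>

definition hel_i1 :: "real \<Rightarrow> real \<Rightarrow> real \<Rightarrow> real \<Rightarrow> real" where
  "hel_i1 a b w t = (if w = 0 then a * t\<^sup>2 / 2 + b * t ^ 3 / 6
     else a * (1 - cos (w * t)) / w\<^sup>2 + b * (t - sin (w * t) / w) / w\<^sup>2)"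

definition hel_i2 :: "real \<Rightarrow> real \<Rightarrow> real \<Rightarrow> real \<Rightarrow> real" where
  "hel_i2 a b w t = (if w = 0 then a\<^sup>2 * t ^ 3 / 3 + a * b * t ^ 4 / 4 + b\<^sup>2 * t ^ 5 / 20
     else (a\<^sup>2 * t + 3 * b * hel_i1 a b w t - hel_x a b w t * hel_u a b w t) / (2 * w\<^sup>2))"

lemma hel_0 [simp]: "hel_x a b w 0 = 0" "hel_i1 a b w 0 = 0" "hel_i2 a b w 0 = 0" "hel_u a b w 0 = a"
  by (simp_all add: hel_x_def hel_i1_def hel_i2_def hel_u_def)

lemma hel_u_eq: "hel_u a b w t = a + b * t - w\<^sup>2 * hel_i1 a b w t"
  by (simp add: hel_u_def hel_i1_def field_simps power2_eq_square)

text \<open>Conservation of energy for the oscillator x'' = b - w^2 x; it makes helices have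
  constant speed.\<close>

lemma hel_energy: "(hel_u a b w t)\<^sup>2 + w\<^sup>2 * (hel_x a b w t)\<^sup>2 - 2 * b * hel_x a b w t = a\<^sup>2"
proof (cases "w = 0")
  case False
  define S C where SC: "S = sin (w * t)" "C = cos (w * t)"
  have sq: "S\<^sup>2 = 1 - C\<^sup>2" unfolding SC by (rule sin_squared_eq)
  define r where "r = b / w"

  have u: "hel_u a b w t = a * C + r * S" using False by (simp add: hel_u_def SC r_def)
  have x: "w * hel_x a b w t = a * S + r * (1 - C)" using False
    by (simp add: hel_x_def SC r_def field_simps power2_eq_square)
  have "(hel_u a b w t)\<^sup>2 + w\<^sup>2 * (hel_x a b w t)\<^sup>2 - 2 * b * hel_x a b w t
      = (a * C + r * S)\<^sup>2 + (w * hel_x a b w t)\<^sup>2 - 2 * r * (w * hel_x a b w t)"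
    by (simp add: u False r_def power_mult_distrib)
  also have "\<dots> = (a\<^sup>2 + r\<^sup>2) * (S\<^sup>2 + C\<^sup>2) - r\<^sup>2" unfolding x by algebra
  also have "\<dots> = a\<^sup>2" by (simp add: sq)
  finally show ?thesis .
qed (simp add: hel_u_def hel_x_def power2_eq_square algebra_simps)

lemma hel_x_deriv: "(hel_x a b w has_real_derivative hel_u a b w t) (at t within S)"
proof (cases "w = 0")
  case True
  then show ?thesis
    unfolding hel_x_def[abs_def] hel_u_def by (auto intro!: derivative_eq_intros)
next
  case False
  have "((\<lambda>t. a * sin (w * t) / w + b * (1 - cos (w * t)) / w\<^sup>2) has_real_derivative
    a * (cos (w * t) * w) / w + b * (sin (w * t) * w) / w\<^sup>2) (at t within S)"
    by (auto intro!: derivative_eq_intros simp: False eval_nat_numeral)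
  then show ?thesis using False by (simp add: hel_x_def[abs_def] hel_u_def power2_eq_square)
qed

lemma hel_u_deriv: "(hel_u a b w has_real_derivative b - w\<^sup>2 * hel_x a b w t) (at t within S)"
proof (cases "w = 0")
  case True
  then show ?thesis
    unfolding hel_x_def hel_u_def[abs_def] by (auto intro!: derivative_eq_intros)
next
  case False
  have "((\<lambda>t. a * cos (w * t) + b * sin (w * t) / w) has_real_derivative
    - (a * (sin (w * t) * w)) + b * (cos (w * t) * w) / w) (at t within S)"
    by (auto intro!: derivative_eq_intros simp: False)
  also have "- (a * (sin (w * t) * w)) + b * (cos (w * t) * w) / w = b - w\<^sup>2 * hel_x a b w t"
    using False by (simp add: hel_x_def power2_eq_square field_simps)
  finally show ?thesis using False by (simp add: hel_u_def[abs_def])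
qed

lemma hel_i1_deriv: "(hel_i1 a b w has_real_derivative hel_x a b w t) (at t within S)"
proof (cases "w = 0")
  case True
  then show ?thesis
    unfolding hel_x_def hel_i1_def[abs_def] by (auto intro!: derivative_eq_intros)
next
  case False
  have "((\<lambda>t. a * (1 - cos (w * t)) / w\<^sup>2 + b * (t - sin (w * t) / w) / w\<^sup>2) has_real_derivative
    a * (sin (w * t) * w) / w\<^sup>2 + b * (1 - cos (w * t) * w / w) / w\<^sup>2) (at t within S)"
    by (auto intro!: derivative_eq_intros simp: False eval_nat_numeral mult_ac)
  then show ?thesis using False by (simp add: hel_x_def hel_i1_def[abs_def] power2_eq_square)
qed

text \<open>By conservation of energy the derivative of x x' is a^2 + 3 b x - 2 w^2 x^2. Solving for
  x^2 and integrating gives the formula for \<open>hel_i2\<close>.\<close>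

lemma hel_i2_deriv: "(hel_i2 a b w has_real_derivative (hel_x a b w t)\<^sup>2) (at t within S)"
proof (cases "w = 0")
  case True
  have "((\<lambda>t. a\<^sup>2 * t ^ 3 / 3 + a * b * t ^ 4 / 4 + b\<^sup>2 * t ^ 5 / 20) has_real_derivative
    a\<^sup>2 * (3 * t ^ 2) / 3 + a * b * (4 * t ^ 3) / 4 + b\<^sup>2 * (5 * t ^ 4) / 20) (at t within S)"
    by (auto intro!: derivative_eq_intros)
  also have "a\<^sup>2 * (3 * t ^ 2) / 3 + a * b * (4 * t ^ 3) / 4 + b\<^sup>2 * (5 * t ^ 4) / 20 = (a * t + b * t\<^sup>2 / 2)\<^sup>2"
    by (simp add: power2_eq_square power3_eq_cube power4_eq_xxxx field_simps)
  finally show ?thesis using True by (simp add: hel_i2_def[abs_def] hel_x_def)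
next
  case False
  define x u where xu: "x = hel_x a b w t" "u = hel_u a b w t"
  have "((\<lambda>t. (a\<^sup>2 * t + 3 * b * hel_i1 a b w t - hel_x a b w t * hel_u a b w t) / (2 * w\<^sup>2)) has_real_derivative
    (a\<^sup>2 + 3 * b * x - (u * u + x * (b - w\<^sup>2 * x))) / (2 * w\<^sup>2)) (at t within S)"
    unfolding xu using False
    by (auto intro!: derivative_eq_intros hel_i1_deriv hel_x_deriv hel_u_deriv simp: field_simps)
  also have "a\<^sup>2 + 3 * b * x - (u * u + x * (b - w\<^sup>2 * x)) = 2 * w\<^sup>2 * x\<^sup>2"
    using hel_energy[of a b w t] unfolding xu[symmetric] by (simp add: power2_eq_square algebra_simps)
  also have "2 * w\<^sup>2 * x\<^sup>2 / (2 * w\<^sup>2) = x\<^sup>2" using False by simp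
  finally show ?thesis using False by (simp add: hel_i2_def[abs_def] xu)
qed

text \<open>The X_0 coordinate is the oscillator x, and the other horizontal velocities are a - x p.
  Integrating y' = (x' l - x l') / 2 by parts gives y = x l / 2 minus the integral of x l', which is
  the last component.\<close>

definition helix :: "'n::finite pgroup \<Rightarrow> real \<Rightarrow> 'n pgroup" where
  "helix \<xi> t = (case \<xi> of (a0, a, p) \<Rightarrow>
     let b = a \<bullet> p; w = norm p; x = hel_x a0 b w t; i = hel_i1 a0 b w t; l = t *\<^sub>R a - i *\<^sub>R p
     in (x, l, (x / 2) *\<^sub>R l - i *\<^sub>R a + hel_i2 a0 b w t *\<^sub>R p))"

definition helix_control :: "'n::finite pgroup \<Rightarrow> real \<Rightarrow> real \<times> (real ^ 'n)" where
  "helix_control \<xi> t = (case \<xi> of (a0, a, p) \<Rightarrow>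
     (hel_u a0 (a \<bullet> p) (norm p) t, a - hel_x a0 (a \<bullet> p) (norm p) t *\<^sub>R p))"

lemma helix_0 [simp]: "helix \<xi> 0 = 0"
  by (cases \<xi>) (simp add: helix_def Let_def zero_prod_def)

lemma helix_has_vector_derivative:
  "(helix \<xi> has_vector_derivative hlift (helix \<xi> t) (helix_control \<xi> t)) (at t within S)"
proof -
  obtain a0 a p where \<xi>: "\<xi> = (a0, a, p)" by (cases \<xi>)
  define X U I J where XUIJ: "X = hel_x a0 (a \<bullet> p) (norm p)" "U = hel_u a0 (a \<bullet> p) (norm p)"
    "I = hel_i1 a0 (a \<bullet> p) (norm p)" "J = hel_i2 a0 (a \<bullet> p) (norm p)"
  have D: "(X has_real_derivative U t) (at t within S)" "(I has_real_derivative X t) (at t within S)"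
    "(J has_real_derivative (X t)\<^sup>2) (at t within S)"
    unfolding XUIJ by (rule hel_x_deriv hel_i1_deriv hel_i2_deriv)+
  have L: "((\<lambda>t. t *\<^sub>R a - I t *\<^sub>R p) has_vector_derivative a - X t *\<^sub>R p) (at t within S)"
    by (auto intro!: derivative_eq_intros D)
  have "((\<lambda>t. (X t / 2) *\<^sub>R (t *\<^sub>R a - I t *\<^sub>R p) - I t *\<^sub>R a + J t *\<^sub>R p) has_vector_derivative
     ((X t / 2) *\<^sub>R (a - X t *\<^sub>R p) + (U t / 2) *\<^sub>R (t *\<^sub>R a - I t *\<^sub>R p)) - X t *\<^sub>R a + (X t)\<^sup>2 *\<^sub>R p) (at t within S)"
    by (auto intro!: derivative_eq_intros D L)
  then have "((\<lambda>t. (X t, t *\<^sub>R a - I t *\<^sub>R p, (X t / 2) *\<^sub>R (t *\<^sub>R a - I t *\<^sub>R p) - I t *\<^sub>R a + J t *\<^sub>R p)) has_vector_derivative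
     (U t, a - X t *\<^sub>R p, ((X t / 2) *\<^sub>R (a - X t *\<^sub>R p) + (U t / 2) *\<^sub>R (t *\<^sub>R a - I t *\<^sub>R p)) - X t *\<^sub>R a + (X t)\<^sup>2 *\<^sub>R p)) (at t within S)"
    using D(1) L by (intro has_vector_derivative_Pair) (simp_all add: has_real_derivative_iff_has_vector_derivative)
  moreover have "helix \<xi> = (\<lambda>t. (X t, t *\<^sub>R a - I t *\<^sub>R p, (X t / 2) *\<^sub>R (t *\<^sub>R a - I t *\<^sub>R p) - I t *\<^sub>R a + J t *\<^sub>R p))"
    by (simp add: fun_eq_iff helix_def \<xi> Let_def XUIJ)
  moreover have "hlift (helix \<xi> t) (helix_control \<xi> t) = 
     (U t, a - X t *\<^sub>R p, ((X t / 2) *\<^sub>R (a - X t *\<^sub>R p) + (U t / 2) *\<^sub>R (t *\<^sub>R a - I t *\<^sub>R p)) - X t *\<^sub>R a + (X t)\<^sup>2 *\<^sub>R p)"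
  proof -
    have "hlift (helix \<xi> t) (helix_control \<xi> t) = (U t, a - X t *\<^sub>R p,
       (1/2) *\<^sub>R (U t *\<^sub>R (t *\<^sub>R a - I t *\<^sub>R p) - X t *\<^sub>R (a - X t *\<^sub>R p)))"
      by (simp add: hlift_def helix_def helix_control_def \<xi> Let_def XUIJ)
    moreover have "(X t / 2) *\<^sub>R (a - X t *\<^sub>R p) - X t *\<^sub>R a + (X t)\<^sup>2 *\<^sub>R p = (1/2) *\<^sub>R (- (X t *\<^sub>R (a - X t *\<^sub>R p)))"
      by (simp add: algebra_simps power2_eq_square scaleR_2[symmetric]) 
    ultimately show ?thesis by (simp add: algebra_simps)
  qed
  ultimately show ?thesis by simp
qed

lemma helix_control_norm: "(norm (helix_control (a0, a, p) t))\<^sup>2 = a0\<^sup>2 + (norm a)\<^sup>2"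
proof -
  define x u where xu: "x = hel_x a0 (a \<bullet> p) (norm p) t" "u = hel_u a0 (a \<bullet> p) (norm p) t"
  have "(norm (helix_control (a0, a, p) t))\<^sup>2 = u\<^sup>2 + (norm (a - x *\<^sub>R p))\<^sup>2"
    by (simp add: helix_control_def norm_Pair xu)
  also have "(norm (a - x *\<^sub>R p))\<^sup>2 = (norm a)\<^sup>2 - 2 * (a \<bullet> p) * x + (norm p)\<^sup>2 * x\<^sup>2"
    by (simp add: power2_norm_eq_inner inner_simps inner_commute[of p a]) (simp add: power2_eq_square algebra_simps)
  finally show ?thesis using hel_energy[of a0 "a \<bullet> p" "norm p" t] unfolding xu[symmetric] by simp
qed

text \<open>On its own characteristic W is the energy spent. In the plane of rotation the chord
  satisfies w^2 (x^2 + h^2) = 2 (1 - cos w t) (\<alpha>^2 + \<beta>^2) with \<alpha> =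
  \<open>a0\<close>, which cancels the denominator of \<open>kap\<close>; the component of
  \<open>l\<close> orthogonal to \<open>p\<close> moves uniformly.\<close>

lemma hj_helix:
  assumes t: "0 < t" "norm p * t \<le> 2 * pi"
  shows "hj p t (helix (a0, a, p) t) = (a0\<^sup>2 + (norm a)\<^sup>2) * t"
proof (cases "p = 0")
  case True
  then show ?thesis using t
    by (simp add: hj_def helix_def Let_def hel_x_def kap_def power2_eq_square field_simps)
next
  case False
  define w \<beta> where w\<beta>: "w = norm p" "\<beta> = a \<bullet> sgn p"
  have w: "w > 0" using False by (simp add: w\<beta>)
  have b: "a \<bullet> p = w * \<beta>"
    using norm_scaleR_sgn[of p] by (metis inner_scaleR_right w\<beta>)
  have ps: "p \<bullet> sgn p = w" using w by (simp add: w\<beta> sgn_div_norm dot_square_norm power2_eq_square)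
  have pp: "p \<bullet> p = w\<^sup>2" by (simp add: w\<beta> power2_norm_eq_inner)
  define x u i j where xuij: "x = hel_x a0 (w * \<beta>) w t" "u = hel_u a0 (w * \<beta>) w t"
    "i = hel_i1 a0 (w * \<beta>) w t" "j = hel_i2 a0 (w * \<beta>) w t"
  define S C where SC: "S = sin (w * t)" "C = cos (w * t)"
  have sq: "S\<^sup>2 = 1 - C\<^sup>2" unfolding SC by (rule sin_squared_eq)
  define l where "l = t *\<^sub>R a - i *\<^sub>R p"
  define h where "h = l \<bullet> sgn p"
  have h: "h = t * \<beta> - i * w" by (simp add: h_def l_def inner_simps ps w\<beta>)
  have wx: "w * x = a0 * S + \<beta> * (1 - C)"
    using w by (simp add: xuij hel_x_def SC power2_eq_square field_simps)
  have wi: "w * (w * i) = a0 * (1 - C) + \<beta> * (w * t - S)"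
    using w by (simp add: xuij hel_i1_def SC power2_eq_square field_simps)
  have wh: "w * h = \<beta> * S - a0 * (1 - C)" using wi by (simp add: h algebra_simps)
  have ln: "(norm l)\<^sup>2 - h\<^sup>2 = t\<^sup>2 * ((norm a)\<^sup>2 - \<beta>\<^sup>2)"
    unfolding h power2_norm_eq_inner
    by (simp add: l_def inner_simps b pp inner_commute[of p a]) (simp add: power2_eq_square algebra_simps)
  have u: "u = a0 + w * \<beta> * t - w\<^sup>2 * i" unfolding xuij by (rule hel_u_eq)
  have j: "2 * w\<^sup>2 * j = a0\<^sup>2 * t + 3 * (w * \<beta>) * i - x * u"
    using w by (simp add: xuij hel_i2_def)
  have py: "2 * (p \<bullet> ((x / 2) *\<^sub>R l - i *\<^sub>R a + j *\<^sub>R p)) = a0\<^sup>2 * t + w * \<beta> * i - a0 * x"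
  proof -
    have pl: "p \<bullet> l = u - a0" by (simp add: l_def inner_simps pp inner_commute[of p a] b u)
    have "2 * (p \<bullet> ((x / 2) *\<^sub>R l - i *\<^sub>R a + j *\<^sub>R p)) = x * (u - a0) - 2 * i * (w * \<beta>) + 2 * w\<^sup>2 * j"
      by (simp add: inner_simps pp inner_commute[of p a] b pl field_simps)
    then show ?thesis unfolding j by (simp add: algebra_simps)
  qed
  have k: "kap w t * (x\<^sup>2 + h\<^sup>2) = (a0\<^sup>2 + \<beta>\<^sup>2) * S / w"
  proof -
    have "w\<^sup>2 * (x\<^sup>2 + h\<^sup>2) = (a0\<^sup>2 + \<beta>\<^sup>2) * (S\<^sup>2 + (1 - C)\<^sup>2)"
      using wx wh by algebra
    also have "S\<^sup>2 + (1 - C)\<^sup>2 = 2 * (1 - C)" using sq by algebra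
    finally have eq: "x\<^sup>2 + h\<^sup>2 = (a0\<^sup>2 + \<beta>\<^sup>2) * (2 * (1 - C)) / w\<^sup>2" using w by (simp add: field_simps)
    show ?thesis
    proof (cases "w * t < 2 * pi")
      case True
      then have "1 - C > 0" using one_minus_cos_pos[of "w * t"] w t(1) by (simp add: SC)
      then show ?thesis using w unfolding eq kap_def SC[symmetric] by (simp add: power2_eq_square field_simps)
    next
      case False
      \<comment> \<open>At the pole the division in \<open>kap\<close> has the default value 0; as
        the chord in the plane of rotation closes up, both sides vanish.\<close>
      then have "w * t = 2 * pi" using t w\<beta> by simp
      then have "S = 0" "C = 1" by (simp_all add: SC)
      then show ?thesis by (simp add: eq)
    qed
  qed
  have "hj p t (helix (a0, a, p) t) = kap w t * (x\<^sup>2 + h\<^sup>2) + ((norm l)\<^sup>2 - h\<^sup>2) / t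
      + 2 * (p \<bullet> ((x / 2) *\<^sub>R l - i *\<^sub>R a + j *\<^sub>R p))"
    by (simp add: hj_def helix_def Let_def w\<beta>(1)[symmetric] xuij b l_def h_def)
  also have "\<dots> = (a0\<^sup>2 + \<beta>\<^sup>2) * S / w + t * ((norm a)\<^sup>2 - \<beta>\<^sup>2) + (a0\<^sup>2 * t + w * \<beta> * i - a0 * x)"
    unfolding k ln py using t by (simp add: power2_eq_square)
  also have "a0\<^sup>2 * t + w * \<beta> * i - a0 * x = a0\<^sup>2 * t + (\<beta>\<^sup>2 * t - (a0\<^sup>2 + \<beta>\<^sup>2) * S / w)"
  proof -
    have "w * (w * \<beta> * i - a0 * x) = \<beta> * (w * (w * i)) - a0 * (w * x)" by (simp add: algebra_simps)
    also have "\<dots> = w * (\<beta>\<^sup>2 * t) - (a0\<^sup>2 + \<beta>\<^sup>2) * S" unfolding wi wx by (simp add: power2_eq_square algebra_simps)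
    finally have "w * \<beta> * i - a0 * x = \<beta>\<^sup>2 * t - (a0\<^sup>2 + \<beta>\<^sup>2) * S / w" using w by (simp add: field_simps)
    then show ?thesis by simp
  qed
  finally show ?thesis by (simp add: algebra_simps)
qed

text \<open>In the plane of X_0 and \<open>p\<close> the projection runs once around a circle in a
  full period; only the drift orthogonal to that plane remains.\<close>

lemma helix_planar_zero:
  assumes "norm p * t = 2 * pi"
  shows "fst (helix (a0, a, p) t) = 0 \<and> p \<bullet> fst (snd (helix (a0, a, p) t)) = 0"
proof -
  have p: "norm p \<noteq> 0" using assms by auto
  have "hel_x a0 (a \<bullet> p) (norm p) t = 0" using p by (simp add: hel_x_def assms)
  moreover have "p \<bullet> (t *\<^sub>R a - hel_i1 a0 (a \<bullet> p) (norm p) t *\<^sub>R p) = hel_u a0 (a \<bullet> p) (norm p) t - a0"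
    by (simp add: inner_simps hel_u_eq power2_norm_eq_inner inner_commute[of p a])
  moreover have "hel_u a0 (a \<bullet> p) (norm p) t = a0" using p by (simp add: hel_u_def assms)
  ultimately show ?thesis by (simp add: helix_def Let_def)
qed

lemma continuous_on_helix_control: "continuous_on S (helix_control \<xi>)"
proof -
  obtain a0 a p where \<xi>: "\<xi> = (a0, a, p)" by (cases \<xi>)
  have 1: "continuous_on S (hel_x c b w)" for c b w using hel_x_deriv by (blast intro: DERIV_continuous_on)
  have 2: "continuous_on S (hel_u c b w)" for c b w by (rule DERIV_continuous_on) (rule hel_u_deriv)
  show ?thesis unfolding helix_control_def[abs_def] \<xi> prod.case
    by (intro continuous_intros 1 2)
qed

lemma hcontrol_helix: "hcontrol s t (helix \<xi>) (helix_control \<xi>)"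
  by (rule smooth_horizontal_curve[OF helix_has_vector_derivative continuous_on_helix_control])

lemma horizontal_curve_helix: "horizontal_curve s t (helix \<xi>)"
  using hcontrol_helix horizontal_curve_iff_hcontrol by blast

section \<open>Length and minimality of helices\<close>

definition unit_covector :: "'n::finite pgroup \<Rightarrow> bool" where
  "unit_covector \<xi> \<longleftrightarrow> (fst \<xi>)\<^sup>2 + (norm (fst (snd \<xi>)))\<^sup>2 = 1"

lemma sr_length_helix:
  assumes "unit_covector \<xi>" "s \<le> t"
  shows "sr_length s t (helix \<xi>) = t - s"
proof -
  have "norm (helix_control \<xi> r) = 1" for r
    using helix_control_norm[of "fst \<xi>" "fst (snd \<xi>)" "snd (snd \<xi>)" r] assms(1)
    by (simp add: unit_covector_def) (smt (verit) norm_ge_zero power2_eq_1_iff)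
  then show ?thesis using hcontrol_integral(3)[OF hcontrol_helix assms(2), of \<xi>] assms(2) by simp
qed

text \<open>A competitor of length L < T would give T = W(T) \<le> W(L) \<le> L at the common end
  point, by the monotonicity of W in time and the calibration inequality.\<close>

lemma minimizing_of_hj:
  assumes h: "horizontal_curve a b \<gamma>" and 0: "\<gamma> a = 0" and T: "sr_length a b \<gamma> = T" "0 < T"
    and p: "norm p * T < 2 * pi \<or> (norm p * T = 2 * pi \<and> fst (\<gamma> b) = 0 \<and> p \<bullet> fst (snd (\<gamma> b)) = 0)"
    and hj: "hj p T (\<gamma> b) = T"
  shows "minimizing a b \<gamma>"
  unfolding minimizing_def
proof (intro conjI allI impI h)
  fix c d \<eta> assume "c \<le> d \<and> horizontal_curve c d \<eta> \<and> \<eta> c = \<gamma> a \<and> \<eta> d = \<gamma> b"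
  then have \<eta>: "c \<le> d" "horizontal_curve c d \<eta>" "\<eta> c = 0" "\<eta> d = \<gamma> b" using 0 by auto
  define L where "L = sr_length c d \<eta>"
  have "T \<le> L"
  proof (rule ccontr)
    assume "\<not> T \<le> L"
    then have LT: "L < T" by simp
    have L0: "L \<ge> 0" using sr_length_nonneg[OF \<eta>(2)] by (simp add: L_def)
    have small: "norm p * s < 2 * pi" if "s < T" "0 \<le> s" for s
    proof (cases "p = 0")
      case False
      then have "norm p * s < norm p * T" using that by simp
      then show ?thesis using p by auto
    qed simp
    show False
    proof (cases "L = 0")
      \<comment> \<open>The calibration inequality requires a positive time. A competitor of length
        0 forces the end point to be 0, where W(T) = 0.\<close>
      case True
      then have "hproj (\<gamma> b) = 0" "snd (snd (\<gamma> b)) = 0"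
        using hproj_le_sr_length[OF \<eta>(2,1)] vertical_le_sr_length[OF \<eta>(2,1,3)] \<eta>
        by (simp_all add: L_def[symmetric] hproj_def zero_prod_def)
      then have "hj p T (\<gamma> b) = 0" by (cases "\<gamma> b") (simp add: hj_def hproj_def zero_prod_def)
      then show False using hj T by simp
    next
      case False
      then have L: "L > 0" using L0 by simp
      have "hj p L (\<gamma> b) \<le> L"
        using hj_le_sr_length[OF \<eta>(2,1,3)] small[OF LT L0] L \<eta>(4) by (simp add: L_def)
      moreover have "T \<le> hj p L (\<gamma> b)"
        using hj_antimono[of L T p "\<gamma> b"] L LT p hj by auto
      ultimately show False using LT by simp
    qed
  qed
  then show "sr_length a b \<gamma> \<le> sr_length c d \<eta>" by (simp add: T L_def)
qed

lemma minimizing_helix: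
  assumes "unit_covector \<xi>" "0 < T" "norm (snd (snd \<xi>)) * T \<le> 2 * pi"
  shows "minimizing 0 T (helix \<xi>)"
proof -
  obtain a0 a p where \<xi>: "\<xi> = (a0, a, p)" by (cases \<xi>)
  show ?thesis
  proof (rule minimizing_of_hj[where T = T and p = p])
    show "sr_length 0 T (helix \<xi>) = T" using sr_length_helix[OF assms(1), of 0 T] assms(2) by simp
    show "hj p T (helix \<xi> T) = T" using hj_helix[of T p a0 a] assms by (simp add: \<xi> unit_covector_def)
    show "norm p * T < 2 * pi \<or> (norm p * T = 2 * pi \<and> fst (helix \<xi> T) = 0 \<and> p \<bullet> fst (snd (helix \<xi> T)) = 0)"
      using helix_planar_zero[of p T a0 a] assms(3) by (auto simp: \<xi>)
  qed (use assms horizontal_curve_helix[of 0 T \<xi>] in simp_all)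
qed

section \<open>Minimizers are helices\<close>

text \<open>The vertical velocity depends only on the planar position and velocity, so equal
  projections and equal initial points determine the whole curve.\<close>

lemma horizontal_curve_eqI:
  assumes h: "horizontal_curve a b \<gamma>" "horizontal_curve a b \<eta>" and eq: "\<gamma> a = \<eta> a"
    and hp: "\<And>t. t \<in> {a..b} \<Longrightarrow> hproj (\<gamma> t) = hproj (\<eta> t)" and t: "t \<in> {a..b}"
  shows "\<gamma> t = \<eta> t"
proof (cases "a < b")
  case False
  then have "t = a" using t by simp
  then show ?thesis using eq by simp
next
  case True
  obtain u v where u: "hcontrol a b \<gamma> u" and v: "hcontrol a b \<eta> v" using h horizontal_curve_iff_hcontrol by blast
  from u obtain L M where L: "L-lipschitz_on {a..b} \<gamma>" and M: "negligible M"
    and D: "\<And>t. t \<in> {a..b} - M \<Longrightarrow> (\<gamma> has_vector_derivative hlift (\<gamma> t) (u t)) (at t within {a..b})"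
    unfolding hcontrol_def by blast
  from v obtain K N where K: "K-lipschitz_on {a..b} \<eta>" and N: "negligible N"
    and E: "\<And>t. t \<in> {a..b} - N \<Longrightarrow> (\<eta> has_vector_derivative hlift (\<eta> t) (v t)) (at t within {a..b})"
    unfolding hcontrol_def by blast
  have bl: "bounded_linear hproj" using linear_hproj linear_conv_bounded_linear by blast
  have uv: "hlift (\<gamma> s) (u s) = hlift (\<eta> s) (v s)" if s: "s \<in> {a..b} - (M \<union> N)" for s
  proof -
    have 1: "((\<lambda>s. hproj (\<gamma> s)) has_vector_derivative u s) (at s within {a..b})"
      using bounded_linear.has_vector_derivative[OF bl D[of s]] s by simp
    have "((\<lambda>s. hproj (\<eta> s)) has_vector_derivative v s) (at s within {a..b})"
      using bounded_linear.has_vector_derivative[OF bl E[of s]] s by simp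
    then have 2: "((\<lambda>s. hproj (\<gamma> s)) has_vector_derivative v s) (at s within {a..b})"
      by (rule has_vector_derivative_transform[rotated 2]) (use s hp in auto)
    have "u s = v s"
      using vector_derivative_unique_within[OF _ 1 2] True s by (auto simp: trivial_limit_within islimpt_Icc)
    moreover have "hproj (\<gamma> s) = hproj (\<eta> s)" using hp s by auto
    ultimately show ?thesis by (simp add: hlift_def hproj_def)
  qed
  have sub: "{a..t} \<subseteq> {a..b}" using t by auto
  have "((\<lambda>_. 0) has_integral ((\<gamma> t - \<eta> t) - (\<gamma> a - \<eta> a))) {a..t}"
  proof (rule lipschitz_has_integral_derivative)
    show "(L + K)-lipschitz_on {a..t} (\<lambda>t. \<gamma> t - \<eta> t)"
      by (intro lipschitz_on_diff lipschitz_on_subset[OF L sub] lipschitz_on_subset[OF K sub])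
    show "negligible (M \<union> N)" using M N by (rule negligible_Un)
    fix s assume s: "s \<in> {a..t} - (M \<union> N)"
    have "((\<lambda>t. \<gamma> t - \<eta> t) has_vector_derivative hlift (\<gamma> s) (u s) - hlift (\<eta> s) (v s)) (at s within {a..b})"
      using D[of s] E[of s] s sub by (auto intro!: derivative_eq_intros)
    then have "((\<lambda>t. \<gamma> t - \<eta> t) has_vector_derivative hlift (\<gamma> s) (u s) - hlift (\<eta> s) (v s)) (at s within {a..t})"
      by (rule has_vector_derivative_within_subset[OF _ sub])
    moreover have "hlift (\<gamma> s) (u s) - hlift (\<eta> s) (v s) = 0" using uv[of s] s t by simp
    ultimately show "((\<lambda>t. \<gamma> t - \<eta> t) has_vector_derivative 0) (at s within {a..t})" by simp
  qed (use t in auto)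
  then have "(\<gamma> t - \<eta> t) - (\<gamma> a - \<eta> a) = 0" by (rule has_integral_unique) (rule has_integral_0)
  then show ?thesis using eq by simp
qed

lemma norm_mult_less_of_le:
  assumes "norm p * T \<le> c" "s < T" "0 \<le> s" "0 < (c::real)"
  shows "norm p * s < c"
proof (cases "norm p = 0")
  case False
  then have "norm p * s < norm p * T" using assms by simp
  then show ?thesis using assms(1) by simp
qed (use assms in auto)

text \<open>The characteristic system is linear, and it is integrated by exhibiting as many first
  integrals as there are planar coordinates. Their values are the components of the initial
  covector.\<close>

lemma half_grad_flow:
  assumes T: "0 < T" "norm p * T \<le> 2 * pi"
    and D: "\<And>t. 0 < t \<Longrightarrow> t < T \<Longrightarrow> ((\<lambda>t. hproj (\<gamma> t)) has_vector_derivative half_grad p t (\<gamma> t)) (at t)"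
  shows "\<exists>a0 a. \<forall>t. 0 < t \<and> t < T \<longrightarrow> hproj (\<gamma> t) = hproj (helix (a0, a, p) t)"
proof -
  define w e where we: "w = norm p" "e = sgn p"
  have p: "p = w *\<^sub>R e" by (simp add: we norm_scaleR_sgn)
  have ee: "e \<bullet> e = 1 \<or> (e = 0 \<and> w = 0)"
    by (cases "p = 0") (auto simp: we sgn_div_norm dot_square_norm power2_eq_square)
  define x l where xl: "x t = fst (\<gamma> t)" "l t = fst (snd (\<gamma> t))" for t
  define h where "h t = l t \<bullet> e" for t
  define k where "k = kap w"
  have small: "w * t < 2 * pi" if "0 < t" "t < T" for t
    using norm_mult_less_of_le[OF T(2), of t] that by (simp add: we)
  have Dk: "(k has_real_derivative - ((k t)\<^sup>2 + w\<^sup>2 / 4)) (at t)" if "0 < t" "t < T" for t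
    unfolding k_def using kap_has_derivative[of t w] small[OF that] that by (simp add: we)
  have g: "half_grad p t (\<gamma> t) = (k t * x t + w / 2 * h t, (k t * h t - w / 2 * x t) *\<^sub>R e + (1 / t) *\<^sub>R (l t - h t *\<^sub>R e))" for t
  proof -
    have "(x t / 2) *\<^sub>R p = (w / 2 * x t) *\<^sub>R e" by (simp add: p)
    then show ?thesis
      unfolding half_grad_def case_prod_beta we[symmetric] xl[symmetric] h_def[symmetric] k_def[symmetric]
      by (simp add: algebra_simps)
  qed
  have Dx: "(x has_real_derivative k t * x t + w / 2 * h t) (at t)"
    and Dl: "(l has_vector_derivative (k t * h t - w / 2 * x t) *\<^sub>R e + (1 / t) *\<^sub>R (l t - h t *\<^sub>R e)) (at t)"
    if "0 < t" "t < T" for t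
    using bounded_linear.has_vector_derivative[OF bounded_linear_fst D[OF that]]
      bounded_linear.has_vector_derivative[OF bounded_linear_snd D[OF that]]
    by (simp_all add: hproj_def xl[abs_def] g[unfolded xl[abs_def]] has_real_derivative_iff_has_vector_derivative)
  have Dh: "(h has_real_derivative k t * h t - w / 2 * x t) (at t)" if "0 < t" "t < T" for t
  proof -
    have "(h has_real_derivative ((k t * h t - w / 2 * x t) *\<^sub>R e + (1 / t) *\<^sub>R (l t - h t *\<^sub>R e)) \<bullet> e) (at t)"
      using bounded_linear.has_vector_derivative[OF bounded_linear_inner_left[of e] Dl[OF that]]
      by (simp add: h_def[abs_def] has_real_derivative_iff_has_vector_derivative)
    moreover have "((k t * h t - w / 2 * x t) *\<^sub>R e + (1 / t) *\<^sub>R (l t - h t *\<^sub>R e)) \<bullet> e = k t * h t - w / 2 * x t"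
      using ee by (auto simp: inner_simps h_def)
    ultimately show ?thesis by simp
  qed
  \<comment> \<open>The momenta transported back to the identity: along X_0, along \<open>e\<close>,
    and orthogonal to \<open>e\<close>. The Riccati equation makes the first two constant.\<close>
  define m1 m2 v where mv: "m1 t = k t * x t - w / 2 * h t" "m2 t = k t * h t + w / 2 * x t"
    "v t = (1 / t) *\<^sub>R (l t - h t *\<^sub>R e)" for t
  have D1: "(m1 has_vector_derivative 0) (at t)" if t: "0 < t" "t < T" for t
  proof -
    have "(m1 has_real_derivative (- ((k t)\<^sup>2 + w\<^sup>2 / 4)) * x t + (k t * x t + w / 2 * h t) * k t - w / 2 * (k t * h t - w / 2 * x t)) (at t)"
      unfolding mv[abs_def] by (intro DERIV_diff DERIV_mult DERIV_cmult Dk Dx Dh t)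
    moreover have "(- ((k t)\<^sup>2 + w\<^sup>2 / 4)) * x t + (k t * x t + w / 2 * h t) * k t - w / 2 * (k t * h t - w / 2 * x t) = 0"
      by (simp add: power2_eq_square field_simps)
    ultimately show ?thesis by (simp only: has_real_derivative_iff_has_vector_derivative)
  qed
  have D2: "(m2 has_vector_derivative 0) (at t)" if t: "0 < t" "t < T" for t
  proof -
    have "(m2 has_real_derivative (- ((k t)\<^sup>2 + w\<^sup>2 / 4)) * h t + (k t * h t - w / 2 * x t) * k t + w / 2 * (k t * x t + w / 2 * h t)) (at t)"
      unfolding mv[abs_def] by (intro DERIV_add DERIV_mult DERIV_cmult Dk Dx Dh t)
    moreover have "(- ((k t)\<^sup>2 + w\<^sup>2 / 4)) * h t + (k t * h t - w / 2 * x t) * k t + w / 2 * (k t * x t + w / 2 * h t) = 0"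
      by (simp add: power2_eq_square field_simps)
    ultimately show ?thesis by (simp only: has_real_derivative_iff_has_vector_derivative)
  qed
  have Dv: "(v has_vector_derivative 0) (at t)" if t: "0 < t" "t < T" for t
  proof -
    define z where "z t = l t - h t *\<^sub>R e" for t
    have "(z has_vector_derivative (1 / t) *\<^sub>R z t) (at t)"
      unfolding z_def[abs_def] using t by (auto intro!: derivative_eq_intros Dl Dh)
    moreover have "((\<lambda>t. 1 / t) has_real_derivative - (1 / (t * t))) (at t)"
      using t by (auto intro!: derivative_eq_intros simp: power2_eq_square)
    ultimately have "((\<lambda>t. (1 / t) *\<^sub>R z t) has_vector_derivative (1 / t) *\<^sub>R (1 / t) *\<^sub>R z t + (- (1 / (t * t))) *\<^sub>R z t) (at t)"
      by (rule has_vector_derivative_scaleR[rotated])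
    then show ?thesis by (simp add: mv[abs_def] z_def[symmetric])
  qed
  define M where "M t = (m1 t, m2 t, v t)" for t
  have DM: "(M has_vector_derivative 0) (at t)" if "0 < t" "t < T" for t
    using has_vector_derivative_Pair[OF D1[OF that] has_vector_derivative_Pair[OF D2[OF that] Dv[OF that]]]
    by (simp add: M_def[abs_def] zero_prod_def)
  have "\<exists>c. \<forall>t\<in>{0<..<T}. M t = c"
    by (rule has_derivative_zero_constant)
      (use DM in \<open>auto simp: has_vector_derivative_def intro: has_derivative_at_withinI\<close>)
  then obtain a0 \<beta> c where c: "\<And>t. 0 < t \<Longrightarrow> t < T \<Longrightarrow> m1 t = a0 \<and> m2 t = \<beta> \<and> v t = c"
    by (auto simp: M_def)
  define a where "a = \<beta> *\<^sub>R e + c"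
  have "hproj (\<gamma> t) = hproj (helix (a0, a, p) t)" if t: "0 < t" "t < T" for t
  proof -
    have m: "k t * x t - w / 2 * h t = a0" "k t * h t + w / 2 * x t = \<beta>" using c[OF t] by (simp_all add: mv)
    have l: "l t = h t *\<^sub>R e + t *\<^sub>R c" using c[OF t] t by (auto simp: mv)
    have ce: "c \<bullet> e = 0"
    proof -
      have "c \<bullet> e = (1 / t) * (h t - h t * (e \<bullet> e))" using c[OF t] by (auto simp: mv inner_simps h_def)
      then show ?thesis using ee by (auto simp: h_def)
    qed
    have b: "a \<bullet> p = w * \<beta>" using ee ce by (auto simp: a_def p inner_simps)
    show ?thesis
    proof (cases "w = 0")
      case True
      then have p0: "p = 0" "e = 0" by (simp_all add: we)
      then have "x t = a0 * t" using m(1) t True by (simp add: k_def kap_def field_simps)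
      then show ?thesis using l by (simp add: hproj_def helix_def Let_def p0 hel_x_def xl[symmetric] a_def h_def)
    next
      case False
      define S C where SC: "S = sin (w * t)" "C = cos (w * t)"
      have sq: "S\<^sup>2 = 1 - C\<^sup>2" unfolding SC by (rule sin_squared_eq)
      have w0: "w > 0" using False by (simp add: we)
      have pos: "1 - C > 0" using one_minus_cos_pos[of "w * t"] small[OF t] w0 t by (simp add: SC)
      have "k t = (w / 2 * S) / (1 - C)" using False by (simp add: k_def kap_def SC)
      then have k1: "k t * (1 - C) = w / 2 * S"
        using pos nonzero_eq_divide_eq[of "1 - C" "k t" "w / 2 * S"] by simp
      have k2: "k t * S + w / 2 * (1 - C) = w"
      proof -
        have "(k t * S + w / 2 * (1 - C)) * (1 - C) = w * (1 - C)"
          using k1 sq by algebra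
        then show ?thesis using pos by simp
      qed
      have "a0 * S + \<beta> * (1 - C) = x t * (k t * S + w / 2 * (1 - C)) + h t * (k t * (1 - C) - w / 2 * S)"
        unfolding m[symmetric] by (simp add: algebra_simps)
      then have wx: "a0 * S + \<beta> * (1 - C) = w * x t" unfolding k1 k2 by simp
      have "\<beta> * S - a0 * (1 - C) = h t * (k t * S + w / 2 * (1 - C)) + x t * (w / 2 * S - k t * (1 - C))"
        unfolding m[symmetric] by (simp add: algebra_simps)
      then have wh: "\<beta> * S - a0 * (1 - C) = w * h t" unfolding k1 k2 by simp
      have X: "hel_x a0 (w * \<beta>) w t = x t"
      proof -
        have "hel_x a0 (w * \<beta>) w t = (a0 * S + \<beta> * (1 - C)) / w"
          using False by (simp add: hel_x_def SC power2_eq_square field_simps)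
        then show ?thesis using False unfolding wx by simp
      qed
      have I: "t * \<beta> - hel_i1 a0 (w * \<beta>) w t * w = h t"
      proof -
        have "t * \<beta> - hel_i1 a0 (w * \<beta>) w t * w = (\<beta> * S - a0 * (1 - C)) / w"
          using False by (simp add: hel_i1_def SC power2_eq_square field_simps)
        then show ?thesis using False unfolding wh by simp
      qed
      have "t *\<^sub>R a - hel_i1 a0 (w * \<beta>) w t *\<^sub>R p = (t * \<beta> - hel_i1 a0 (w * \<beta>) w t * w) *\<^sub>R e + t *\<^sub>R c"
        by (simp add: a_def p algebra_simps)
      also have "\<dots> = l t" unfolding I l ..
      finally show ?thesis
        by (simp add: hproj_def helix_def Let_def b we(1)[symmetric] X xl[symmetric])
    qed
  qed
  then show ?thesis by blast
qed

text \<open>F = W - t is nonincreasing, at most 0 because of its initial behaviour, and at least 0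
  because of its final value. Hence F = 0, and the square in its derivative vanishes: the control is
  the half gradient almost everywhere. The vertical covector of the resulting helix is the given
  \<open>p\<close>, which is what makes minimizers countable later.\<close>

lemma helix_of_hj_eq:
  assumes \<gamma>: "horizontal_curve 0 T \<gamma>" and T: "0 < T" and 0: "\<gamma> 0 = 0"
    and unit: "\<And>s t. 0 \<le> s \<Longrightarrow> s \<le> t \<Longrightarrow> t \<le> T \<Longrightarrow> sr_length s t \<gamma> = t - s"
    and p: "norm p * T < 2 * pi \<or> (norm p * T = 2 * pi \<and> fst (\<gamma> T) = 0 \<and> p \<bullet> fst (snd (\<gamma> T)) = 0)"
    and hj: "hj p T (\<gamma> T) = T"
  shows "\<exists>a0 a. unit_covector (a0, a, p) \<and> (\<forall>t\<in>{0..T}. \<gamma> t = helix (a0, a, p) t)"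
proof -
  define w where "w = norm p"
  have wT: "w * T \<le> 2 * pi" using p by (auto simp: w_def)
  have small: "w * t < 2 * pi" if "0 \<le> t" "t < T" for t
    using norm_mult_less_of_le[of p T "2 * pi" t] wT that by (simp add: w_def)
  have sub: "horizontal_curve s t \<gamma>" if "0 \<le> s" "t \<le> T" for s t
    by (rule horizontal_curve_subset[OF \<gamma> that])
  have contg: "continuous_on {0..T} \<gamma>" using \<gamma> lipschitz_on_continuous_on unfolding horizontal_curve_def by blast
  define F where "F t = hj p t (\<gamma> t) - t" for t
  have mono: "F t \<le> F s" if "0 < s" "s \<le> t" "t \<le> T" "w * t < 2 * pi" for s t
    using hj_nonincreasing[OF sub[of s t] that(2,1), of p] unit[of s t] that by (simp add: F_def w_def)
  have le: "F t \<le> 0" if "0 < t" "t < T" for t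
    using hj_le_sr_length[OF sub[of 0 t] _ 0, of p] unit[of 0 t] that small[of t] by (simp add: F_def w_def)
  have ge: "0 \<le> F t" if t: "0 < t" "t < T" for t
    using p
  proof
    assume "norm p * T < 2 * pi"
    then show ?thesis using mono[of t T] hj t by (simp add: w_def F_def)
  next
    assume a: "norm p * T = 2 * pi \<and> fst (\<gamma> T) = 0 \<and> p \<bullet> fst (snd (\<gamma> T)) = 0"
    then have hT: "fst (snd (\<gamma> T)) \<bullet> sgn p = 0" by (simp add: sgn_div_norm inner_commute)
    \<comment> \<open>At the pole F has no evident limit. In \<open>G\<close> the singular product
      of \<open>kap\<close> is replaced by its lower bound - (T - s); \<open>G\<close> is continuous
      up to T, where it is 0. The bound holds because the distance to the end point is at most T - s
      and \<open>kap\<close> is reflected.\<close>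
    define G where "G s = - (T - s) + ((norm (fst (snd (\<gamma> s))))\<^sup>2 - (fst (snd (\<gamma> s)) \<bullet> sgn p)\<^sup>2) / s
      + 2 * (p \<bullet> snd (snd (\<gamma> s))) - s" for s
    have GF: "G s \<le> F t" if s: "t < s" "s < T" for s
    proof -
      obtain x l y where q: "\<gamma> s = (x, l, y)" by (cases "\<gamma> s")
      obtain x' l' y' where q': "\<gamma> T = (x', l', y')" by (cases "\<gamma> T")
      have "norm (hproj (\<gamma> T) - hproj (\<gamma> s)) \<le> T - s"
        using hproj_le_sr_length[OF sub[of s T]] unit[of s T] s t by simp
      then have "(norm (hproj (\<gamma> T) - hproj (\<gamma> s)))\<^sup>2 \<le> (T - s)\<^sup>2" by (rule power_mono) simp
      then have 1: "x\<^sup>2 + (norm (l' - l))\<^sup>2 \<le> (T - s)\<^sup>2" using a by (simp add: q q' hproj_def norm_Pair)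
      have "(l \<bullet> sgn p)\<^sup>2 = ((l' - l) \<bullet> sgn p)\<^sup>2" using hT by (simp add: q' inner_simps)
      also have "\<dots> \<le> (norm (l' - l))\<^sup>2" by (rule inner_sgn_sq_le)
      finally have 2: "x\<^sup>2 + (l \<bullet> sgn p)\<^sup>2 \<le> (T - s)\<^sup>2" using 1 by simp
      have "w * (T - s) < 2 * pi" using small[of "T - s"] s t by simp
      then have "- kap w s \<le> 1 / (T - s)"
        using kap_le[of "T - s" w] kap_reflect[of w T s] a s by (simp add: w_def)
      then have "- kap w s * (x\<^sup>2 + (l \<bullet> sgn p)\<^sup>2) \<le> 1 / (T - s) * (x\<^sup>2 + (l \<bullet> sgn p)\<^sup>2)"
        by (intro mult_right_mono) auto
      also have "\<dots> \<le> 1 / (T - s) * (T - s)\<^sup>2" using 2 s by (intro mult_left_mono) auto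
      also have "\<dots> = T - s" using s by (simp add: power2_eq_square)
      finally have "G s \<le> F s" by (simp add: G_def F_def hj_def q w_def)
      also have "F s \<le> F t" using mono[of t s] small[of s] s t by simp
      finally show ?thesis .
    qed
    have "continuous_on {t..T} G"
      unfolding G_def using t by (intro continuous_intros continuous_on_subset[OF contg]) auto
    then have "(G \<longlongrightarrow> G T) (at T within {t..T})" using t by (simp add: continuous_on)
    then have "(G \<longlongrightarrow> G T) (at_left T)" using t by (simp add: at_within_Icc_at_left)
    moreover have "G T = 0" using hj a hT by (simp add: G_def hj_def case_prod_beta)
    moreover have "\<forall>\<^sub>F s in at_left T. G s \<le> F t"
      unfolding eventually_at_left[OF t(2)] using GF t by blast
    ultimately show ?thesis using tendsto_upperbound[of G 0 "at_left T" "F t"] by simp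
  qed
  have F0: "F t = 0" if "0 < t" "t < T" for t using le[OF that] ge[OF that] by simp
  obtain u where u: "hcontrol 0 T \<gamma> u" using \<gamma> horizontal_curve_iff_hcontrol by blast
  then obtain L N where N: "negligible N"
    and D: "\<And>t. t \<in> {0..T} - N \<Longrightarrow> (\<gamma> has_vector_derivative hlift (\<gamma> t) (u t)) (at t within {0..T})"
    unfolding hcontrol_def by blast
  have bl: "bounded_linear hproj" using linear_hproj linear_conv_bounded_linear by blast
  have lip: "1-lipschitz_on {0..T} (\<lambda>t. hproj (\<gamma> t))"
  proof (rule lipschitz_onI)
    have *: "norm (hproj (\<gamma> t) - hproj (\<gamma> s)) \<le> t - s" if "0 \<le> s" "s \<le> t" "t \<le> T" for s t
      using hproj_le_sr_length[OF sub[of s t]] unit[of s t] that by simp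
    fix s t assume "s \<in> {0..T}" "t \<in> {0..T}"
    then show "dist (hproj (\<gamma> s)) (hproj (\<gamma> t)) \<le> 1 * dist s t"
      using *[of s t] *[of t s] by (cases "s \<le> t") (auto simp: dist_norm norm_minus_commute)
  qed simp
  have ug: "u t = half_grad p t (\<gamma> t)" if t: "0 < t" "t < T" "t \<notin> N" for t
  proof -
    have Dt: "(\<gamma> has_vector_derivative hlift (\<gamma> t) (u t)) (at t within {0..T})" using D t by auto
    then have Dt': "(\<gamma> has_vector_derivative hlift (\<gamma> t) (u t)) (at t)"
      using at_within_interior[of t "{0..T}"] t by (simp add: interior_atLeastAtMost_real)
    have "((\<lambda>t. hproj (\<gamma> t)) has_vector_derivative u t) (at t within {0..T})"
      using bounded_linear.has_vector_derivative[OF bl Dt] by simp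
    then have nu: "norm (u t) \<le> 1" using lipschitz_vector_derivative_bound[OF lip T, of t "u t"] t by simp
    have "((\<lambda>t. hj p t (\<gamma> t) - t) has_real_derivative (norm (u t))\<^sup>2 - (norm (u t - half_grad p t (\<gamma> t)))\<^sup>2 - 1) (at t)"
      using hj_vector_derivative[OF Dt' t(1)] small[of t] t by (auto intro!: derivative_eq_intros simp: w_def)
    then have "(F has_real_derivative (norm (u t))\<^sup>2 - (norm (u t - half_grad p t (\<gamma> t)))\<^sup>2 - 1) (at t)"
      by (simp add: F_def[abs_def])
    moreover have "(F has_real_derivative 0) (at t)"
      by (rule has_field_derivative_transform_within_open[of "\<lambda>_. 0" _ _ "{0<..<T}"]) (use t F0 in auto)
    ultimately have "(norm (u t))\<^sup>2 - (norm (u t - half_grad p t (\<gamma> t)))\<^sup>2 - 1 = 0" by (rule DERIV_unique)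
    moreover have "(norm (u t))\<^sup>2 \<le> 1" using nu by (simp add: power_le_one)
    ultimately have "(norm (u t - half_grad p t (\<gamma> t)))\<^sup>2 \<le> 0" by linarith
    then show ?thesis by simp
  qed
  have contG: "continuous_on {0<..<T} (\<lambda>t. half_grad p t (\<gamma> t))"
  proof -
    have "continuous_on {0<..<T} (kap (norm p))"
      by (rule DERIV_continuous_on, rule has_field_derivative_at_within, rule kap_has_derivative)
         (use small in \<open>auto simp: w_def\<close>)
    then show ?thesis
      unfolding half_grad_def case_prod_beta
      by (intro continuous_intros continuous_on_subset[OF contg]) auto
  qed
  \<comment> \<open>The control equals the half gradient only off a null set. Away from both
    singular ends the latter is continuous, so integrating it yields differentiability at every
    time.\<close>
  have DG: "((\<lambda>t. hproj (\<gamma> t)) has_vector_derivative half_grad p t (\<gamma> t)) (at t)" if t: "0 < t" "t < T" for t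
  proof -
    define a b where ab: "a = t / 2" "b = (t + T) / 2"
    have ab': "0 < a" "a < t" "t < b" "b < T" using t by (auto simp: ab)
    have I: "integral {a..s} (\<lambda>t. half_grad p t (\<gamma> t)) = hproj (\<gamma> s) - hproj (\<gamma> a)" if s: "s \<in> {a..b}" for s
    proof -
      have "(u has_integral hproj (\<gamma> s) - hproj (\<gamma> a)) {a..s}"
        using hcontrol_integral(1)[OF hcontrol_subset[OF u, of a s]] s ab' by auto
      then have "((\<lambda>t. half_grad p t (\<gamma> t)) has_integral hproj (\<gamma> s) - hproj (\<gamma> a)) {a..s}"
        by (rule has_integral_spike[OF N, rotated]) (use ug s ab' in auto)
      then show ?thesis by (rule integral_unique)
    qed
    have "((\<lambda>s. integral {a..s} (\<lambda>t. half_grad p t (\<gamma> t))) has_vector_derivative half_grad p t (\<gamma> t)) (at t within {a..b})"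
      by (rule integral_has_vector_derivative) (use ab' in \<open>auto intro!: continuous_on_subset[OF contG]\<close>)
    then have "((\<lambda>s. hproj (\<gamma> s) - hproj (\<gamma> a)) has_vector_derivative half_grad p t (\<gamma> t)) (at t within {a..b})"
      by (rule has_vector_derivative_transform[rotated 2]) (use I ab' in auto)
    then have "((\<lambda>s. hproj (\<gamma> s) - hproj (\<gamma> a)) has_vector_derivative half_grad p t (\<gamma> t)) (at t)"
      using at_within_interior[of t "{a..b}"] ab' by (simp add: interior_atLeastAtMost_real)
    from has_vector_derivative_add[OF this has_vector_derivative_const[of "hproj (\<gamma> a)"]]
    show ?thesis by simp
  qed
  obtain a0 a where eq: "\<And>t. 0 < t \<Longrightarrow> t < T \<Longrightarrow> hproj (\<gamma> t) = hproj (helix (a0, a, p) t)"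
    using half_grad_flow[OF T _ DG] wT by (auto simp: w_def)
  have eqT: "hproj (\<gamma> t) = hproj (helix (a0, a, p) t)" if t: "t \<in> {0..T}" for t
  proof -
    have c: "continuous_on {0..T} (\<lambda>t. hproj (\<gamma> t) - hproj (helix (a0, a, p) t))"
      by (intro continuous_on_diff continuous_on_compose2[OF linear_continuous_on[OF bl, of UNIV]] contg
          continuous_on_vector_derivative[OF helix_has_vector_derivative]) auto
    have cl: "closure {0<..<T} = {0..T}" using T by simp
    have "hproj (\<gamma> t) - hproj (helix (a0, a, p) t) = 0"
      by (rule continuous_constant_on_closure[OF c[folded cl], where a = 0]) (use eq t cl in simp_all)
    then show ?thesis by simp
  qed
  have all: "\<gamma> t = helix (a0, a, p) t" if "t \<in> {0..T}" for t
    by (rule horizontal_curve_eqI[OF \<gamma> horizontal_curve_helix _ eqT that]) (simp_all add: 0)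
  have "(a0\<^sup>2 + (norm a)\<^sup>2) * T = T"
    using hj_helix[OF T, of p a0 a] wT hj all[of T] T by (simp add: w_def)
  then have "unit_covector (a0, a, p)" using T by (simp add: unit_covector_def)
  then show ?thesis using all by blast
qed

section \<open>Continuity of the end point in the covector, and scaling\<close>

definition sinc0 :: "real \<Rightarrow> real" where
  "sinc0 x = (if x = 0 then 1 else sin x / x)"

lemma continuous_on_sinc0: "continuous_on UNIV sinc0"
proof -
  have "isCont sinc0 x" for x
  proof (cases "x = 0")
    case True
    have "(\<lambda>h. (sin (0 + h) - sin 0) / h) \<midarrow>0\<rightarrow> cos (0::real)"
      using DERIV_sin[of "0::real"] unfolding DERIV_def .
    then have "(\<lambda>h. sin h / h) \<midarrow>0\<rightarrow> (1::real)" by simp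
    then have "sinc0 \<midarrow>0\<rightarrow> 1"
      by (rule Lim_transform_eventually) (auto simp: sinc0_def eventually_at_filter)
    then show ?thesis by (simp add: isCont_def True sinc0_def)
  next
    case False
    have "isCont (\<lambda>x. sin x / x) x" using False by (intro continuous_intros) auto
    moreover have "\<forall>\<^sub>F y in nhds x. sinc0 y = sin y / y"
      using eventually_nhds_in_open[of "- {0}" x] False by (auto elim!: eventually_mono simp: sinc0_def)
    ultimately show ?thesis by (simp add: isCont_cong)
  qed
  then show ?thesis by (simp add: continuous_on_eq_continuous_at)
qed

text \<open>Removes the case distinction at w = 0, so that \<open>hel_x\<close> is jointly
  continuous in all its arguments.\<close>

lemma hel_x_sinc: "hel_x a b w t = a * t * sinc0 (w * t) + b * (t\<^sup>2 / 2) * (sinc0 (w * t / 2))\<^sup>2"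
proof (cases "w = 0 \<or> t = 0")
  case True
  then show ?thesis by (auto simp: hel_x_def sinc0_def power2_eq_square)
next
  case False
  have "1 - cos (w * t) = 2 * (sin (w * t / 2))\<^sup>2" using cos_double_sin[of "w * t / 2"] by simp
  then show ?thesis using False by (simp add: hel_x_def sinc0_def power_divide power_mult_distrib)
qed

lemma continuous_on_hel_x [continuous_intros]:
  assumes "continuous_on U f" "continuous_on U g" "continuous_on U h" "continuous_on U k"
  shows "continuous_on U (\<lambda>x. hel_x (f x) (g x) (h x) (k x))"
  unfolding hel_x_sinc
  by (intro continuous_intros assms continuous_on_compose2[OF continuous_on_sinc0]) auto

lemma hel_i1_integral: "hel_i1 a b w 1 = integral {0..1} (hel_x a b w)"
proof -
  have "(hel_x a b w has_integral (hel_i1 a b w 1 - hel_i1 a b w 0)) {0..1}"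
    by (rule fundamental_theorem_of_calculus)
      (simp_all add: hel_i1_deriv flip: has_real_derivative_iff_has_vector_derivative)
  then show ?thesis by (simp add: integral_unique)
qed

lemma hel_i2_integral: "hel_i2 a b w 1 = integral {0..1} (\<lambda>t. (hel_x a b w t)\<^sup>2)"
proof -
  have "((\<lambda>t. (hel_x a b w t)\<^sup>2) has_integral (hel_i2 a b w 1 - hel_i2 a b w 0)) {0..1}"
    by (rule fundamental_theorem_of_calculus)
      (simp_all add: hel_i2_deriv flip: has_real_derivative_iff_has_vector_derivative)
  then show ?thesis by (simp add: integral_unique)
qed

text \<open>As integrals of \<open>hel_x\<close> and its square with parameters, these functions
  inherit continuity at w = 0 without expansions of their own.\<close>

lemma continuous_on_hel_i:
  assumes "continuous_on U f" "continuous_on U g" "continuous_on U h"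
  shows "continuous_on U (\<lambda>x. hel_i1 (f x) (g x) (h x) 1)"
    and "continuous_on U (\<lambda>x. hel_i2 (f x) (g x) (h x) 1)"
proof -
  have c: "continuous_on (U \<times> cbox 0 1) (\<lambda>(x, t). hel_x (f x) (g x) (h x) t)"
    unfolding case_prod_beta
    by (intro continuous_intros continuous_on_compose2[OF assms(1) continuous_on_fst]
        continuous_on_compose2[OF assms(2) continuous_on_fst] continuous_on_compose2[OF assms(3) continuous_on_fst]) auto
  show "continuous_on U (\<lambda>x. hel_i1 (f x) (g x) (h x) 1)"
    unfolding hel_i1_integral using integral_continuous_on_param[OF c] by simp
  have c2: "continuous_on (U \<times> cbox 0 1) (\<lambda>(x, t). (hel_x (f x) (g x) (h x) t)\<^sup>2)"
    using continuous_on_power[OF c, of 2] by (simp add: case_prod_beta)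
  show "continuous_on U (\<lambda>x. hel_i2 (f x) (g x) (h x) 1)"
    unfolding hel_i2_integral using integral_continuous_on_param[OF c2] by simp
qed

lemma continuous_on_helix_1:
  assumes "continuous_on U f" "continuous_on U g" "continuous_on U h"
  shows "continuous_on U (\<lambda>x. helix (f x, g x, h x) 1)"
proof -
  have b: "continuous_on U (\<lambda>x. g x \<bullet> h x)" "continuous_on U (\<lambda>x. norm (h x))"
    by (intro continuous_intros assms)+
  note I = continuous_on_hel_i[OF assms(1) b]
  show ?thesis unfolding helix_def prod.case Let_def
    by (intro continuous_intros assms b I) auto
qed

lemma hel_scale:
  assumes "c \<noteq> 0"
  shows "hel_x (c * a) (c\<^sup>2 * b) (c * w) t = hel_x a b w (c * t)"
    and "hel_u (c * a) (c\<^sup>2 * b) (c * w) t = c * hel_u a b w (c * t)"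
    and "c * hel_i1 (c * a) (c\<^sup>2 * b) (c * w) t = hel_i1 a b w (c * t)"
    and "c * hel_i2 (c * a) (c\<^sup>2 * b) (c * w) t = hel_i2 a b w (c * t)"
proof -
  show x: "hel_x (c * a) (c\<^sup>2 * b) (c * w) t = hel_x a b w (c * t)"
    using assms by (simp add: hel_x_def power_mult_distrib mult_ac)
  show u: "hel_u (c * a) (c\<^sup>2 * b) (c * w) t = c * hel_u a b w (c * t)"
    using assms by (simp add: hel_u_def power2_eq_square field_simps)
  show i: "c * hel_i1 (c * a) (c\<^sup>2 * b) (c * w) t = hel_i1 a b w (c * t)"
  proof (cases "w = 0")
    case True
    then show ?thesis by (simp add: hel_i1_def eval_nat_numeral field_simps)
  next
    case False
    have "c * (c * a * (1 - cos (c * w * t)) / (c * w)\<^sup>2 + c\<^sup>2 * b * (t - sin (c * w * t) / (c * w)) / (c * w)\<^sup>2)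
      = a * (1 - cos (w * (c * t))) / w\<^sup>2 + b * (c * t - sin (w * (c * t)) / w) / w\<^sup>2"
      using assms False by (simp add: power2_eq_square field_simps)
    then show ?thesis using assms False by (simp add: hel_i1_def)
  qed
  show "c * hel_i2 (c * a) (c\<^sup>2 * b) (c * w) t = hel_i2 a b w (c * t)"
  proof (cases "w = 0")
    case True
    then show ?thesis by (simp add: hel_i2_def eval_nat_numeral field_simps)
  next
    case False
    have "c * (((c * a)\<^sup>2 * t + 3 * (c\<^sup>2 * b) * I - X * (c * U)) / (2 * (c * w)\<^sup>2))
       = (a\<^sup>2 * (c * t) + 3 * b * (c * I) - X * U) / (2 * w\<^sup>2)" for I X U :: real
      using assms False by (simp add: power2_eq_square field_simps)
    then show ?thesis using assms False by (simp add: hel_i2_def x u i)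
  qed
qed

lemma helix_scale:
  assumes "0 < c"
  shows "helix (c *\<^sub>R \<xi>) t = helix \<xi> (c * t)"
proof -
  obtain a0 a p where \<xi>: "\<xi> = (a0, a, p)" by (cases \<xi>)
  have c: "c \<noteq> 0" using assms by simp
  have b: "(c *\<^sub>R a) \<bullet> (c *\<^sub>R p) = c\<^sup>2 * (a \<bullet> p)" by (simp add: power2_eq_square)
  have n: "norm (c *\<^sub>R p) = c * norm p" using assms by simp
  have 1: "hel_i1 (c * a0) (c\<^sup>2 * (a \<bullet> p)) (c * norm p) t * c = hel_i1 a0 (a \<bullet> p) (norm p) (c * t)"
    by (rule trans[OF mult.commute hel_scale(3)[OF c]])
  have 2: "hel_i2 (c * a0) (c\<^sup>2 * (a \<bullet> p)) (c * norm p) t * c = hel_i2 a0 (a \<bullet> p) (norm p) (c * t)"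
    by (rule trans[OF mult.commute hel_scale(4)[OF c]])
  show ?thesis
    unfolding \<xi> helix_def Let_def scaleR_Pair prod.case b n hel_scale(1)[OF c] real_scaleR_def
    by (simp add: 1 2 mult.commute[of t c])
qed

lemma hj_scale:
  assumes "0 < c"
  shows "hj (c *\<^sub>R p) t q = c * hj p (c * t) q"
proof -
  have k: "kap (c * w) t = c * kap w (c * t)" for w
    using assms by (simp add: kap_def mult_ac)
  have s: "sgn (c *\<^sub>R p) = sgn p" using assms by (simp add: sgn_scaleR)
  obtain x l y where q: "q = (x, l, y)" by (cases q)
  have d: "c * (A / (c * t)) = A / t" for A using assms by simp
  show ?thesis using assms
    by (simp add: hj_def q k s distrib_left d mult.assoc)
qed

lemma helix_trivial: "helix (0, 0, p) t = 0"
proof -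
  have "hel_x 0 0 w t = 0" "hel_i1 0 0 w t = 0" "hel_i2 0 0 w t = 0" for w
    by (simp_all add: hel_x_def hel_i1_def hel_i2_def)
  then show ?thesis by (simp add: helix_def Let_def zero_prod_def)
qed

section \<open>Duality: every point is reached with |p| at most 2 pi\<close>

text \<open>Weak duality: the value of W for any multiplier \<open>p\<close> is a lower bound for
  the energy of a helix with another multiplier \<open>p'\<close>. Scaling by the speed reduces this
  to the calibration inequality.\<close>

lemma hj_helix_le:
  assumes "norm p < 2 * pi"
  shows "hj p 1 (helix (a0, a, p') 1) \<le> a0\<^sup>2 + (norm a)\<^sup>2"
proof -
  define E L where EL: "E = a0\<^sup>2 + (norm a)\<^sup>2" "L = sqrt E"
  show ?thesis
  proof (cases "E = 0")
    case True
    then have "a0 = 0" "a = 0" by (auto simp: EL add_nonneg_eq_0_iff)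
    then show ?thesis by (simp add: helix_trivial hj_def zero_prod_def)
  next
    case False
    then have L: "L > 0" "L\<^sup>2 = E" by (simp_all add: EL add_nonneg_pos less_le)
    have "norm (helix_control (a0, a, p') t) = L" for t
      using helix_control_norm[of a0 a p' t] by (simp add: EL real_sqrt_unique)
    then have len: "sr_length 0 1 (helix (a0, a, p')) = L"
      using hcontrol_integral(3)[OF hcontrol_helix, of 0 1 "(a0, a, p')"] by simp
    have "hj ((1 / L) *\<^sub>R p) L (helix (a0, a, p') 1) \<le> L"
      using hj_le_sr_length[OF horizontal_curve_helix, of 0 1 "(a0, a, p')" "(1 / L) *\<^sub>R p"] L assms
      by (simp add: len)
    then have "L * hj ((1 / L) *\<^sub>R p) L (helix (a0, a, p') 1) \<le> L * L" using L by (intro mult_left_mono) auto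
    also have "L * hj ((1 / L) *\<^sub>R p) L (helix (a0, a, p') 1) = hj p 1 (helix (a0, a, p') 1)"
      using hj_scale[of L "(1 / L) *\<^sub>R p" 1] L by simp
    finally show ?thesis using L by (simp add: EL power2_eq_square)
  qed
qed

text \<open>The covector of the geodesic with vertical part \<^term>\<open>p\<close> whose end point at time $1$
  projects to \<^term>\<open>(x, l)\<close>.\<close>

definition shoot :: "real \<Rightarrow> real ^ 'n::finite \<Rightarrow> real ^ 'n \<Rightarrow> 'n pgroup" where
  "shoot x l p = (let w = norm p; a0 = kap w 1 * x - (p \<bullet> l) / 2; b = w\<^sup>2 * x / 2 + kap w 1 * (p \<bullet> l)
     in (a0, l + hel_i1 a0 b w 1 *\<^sub>R p, p))"

text \<open>The components \<open>a0\<close> and \<open>b\<close> of \<open>shoot\<close> are the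
  first integrals of \<open>half_grad_flow\<close> at time 1, the second one multiplied by w. Hence
  they are the initial data of the characteristic that ends over (x, l).\<close>

lemma shoot_end:
  assumes "norm p < 2 * pi"
  shows "hproj (helix (shoot x l p) 1) = (x, l)"
proof -
  define w s k where wsk: "w = norm p" "s = p \<bullet> l" "k = kap w 1"
  define a0 b where ab: "a0 = k * x - s / 2" "b = w\<^sup>2 * x / 2 + k * s"
  define i where "i = hel_i1 a0 b w 1"
  have sh: "shoot x l p = (a0, l + i *\<^sub>R p, p)"
    by (simp add: shoot_def Let_def ab i_def wsk)
  have key: "hel_x a0 b w 1 = x \<and> s + i * w\<^sup>2 = b"
  proof (cases "w = 0")
    case True
    then have "p = 0" by (simp add: wsk)
    then have "s = 0" by (simp add: wsk)
    then show ?thesis using True by (simp add: hel_x_def ab wsk(3) kap_def)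
  next
    case False
    define S C where SC: "S = sin w" "C = cos w"
    have sq: "S\<^sup>2 = 1 - C\<^sup>2" unfolding SC by (rule sin_squared_eq)
    have w0: "w > 0" using False by (simp add: wsk)
    have pos: "1 - C > 0" using one_minus_cos_pos[of w] assms w0 by (simp add: SC wsk)
    have "k = (w / 2 * S) / (1 - C)" using False by (simp add: wsk(3) kap_def SC)
    then have k1: "k * (1 - C) = w / 2 * S"
      using pos nonzero_eq_divide_eq[of "1 - C" k "w / 2 * S"] by simp
    have k2: "k * S + w / 2 * (1 - C) = w"
    proof -
      have "(k * S + w / 2 * (1 - C)) * (1 - C) = w * (1 - C)" using k1 sq by algebra
      then show ?thesis using pos by simp
    qed
    have "w\<^sup>2 * hel_x a0 b w 1 = a0 * S * w + b * (1 - C)"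
      using False by (simp add: hel_x_def SC power2_eq_square field_simps)
    also have "\<dots> = w * x * (k * S + w / 2 * (1 - C)) + s * (k * (1 - C) - w / 2 * S)"
      by (simp add: ab power2_eq_square field_simps)
    also have "\<dots> = w\<^sup>2 * x" unfolding k1 k2 by (simp add: power2_eq_square)
    finally have 1: "hel_x a0 b w 1 = x" using False by simp
    have "w * (i * w\<^sup>2) = a0 * (1 - C) * w + b * (w - S)"
      using False by (simp add: i_def hel_i1_def SC power2_eq_square field_simps)
    also have "\<dots> = w * b + w * x * (k * (1 - C) - w / 2 * S) - s * (k * S + w / 2 * (1 - C))"
      by (simp add: ab power2_eq_square field_simps)
    also have "\<dots> = w * (b - s)" unfolding k1 k2 by (simp add: algebra_simps)
    finally have "i * w\<^sup>2 = b - s" using False by simp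
    with 1 show ?thesis by simp
  qed
  have "(l + i *\<^sub>R p) \<bullet> p = b"
    using key by (simp add: inner_simps wsk inner_commute[of l] power2_norm_eq_inner)
  then have "helix (shoot x l p) 1 = (x, (l + i *\<^sub>R p) - i *\<^sub>R p, (x / 2) *\<^sub>R ((l + i *\<^sub>R p) - i *\<^sub>R p) - i *\<^sub>R (l + i *\<^sub>R p) + hel_i2 a0 b w 1 *\<^sub>R p)"
    using key by (simp add: sh helix_def Let_def wsk(1)[symmetric] i_def)
  then show ?thesis by (simp add: hproj_def)
qed

lemma continuous_on_kap_norm: "continuous_on (ball 0 (2 * pi)) (\<lambda>p :: 'a::real_normed_vector. kap (norm p) 1)"
proof -
  \<comment> \<open>Both \<open>hel_x\<close> are continuous at w = 0, so the quotient extends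
    \<open>kap\<close> through p = 0.\<close>
  have eq: "kap (norm p) 1 = hel_x 1 0 (norm p) 1 / (2 * hel_x 0 1 (norm p) 1)" if "p \<in> ball 0 (2 * pi)" for p :: 'a
    by (simp add: kap_def hel_x_def power2_eq_square)
  have pos: "hel_x 0 1 (norm p) 1 \<noteq> 0" if "p \<in> ball 0 (2 * pi)" for p :: 'a
  proof (cases "p = 0")
    case False
    then have "1 - cos (norm p) > 0" using that by (intro one_minus_cos_pos) auto
    then show ?thesis using False by (simp add: hel_x_def)
  qed (simp add: hel_x_def)
  have "continuous_on (ball 0 (2 * pi)) (\<lambda>p :: 'a. hel_x 1 0 (norm p) 1 / (2 * hel_x 0 1 (norm p) 1))"
    by (intro continuous_intros) (use pos in auto)
  then show ?thesis using eq by (simp cong: continuous_on_cong_simp)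
qed

lemma continuous_on_shoot:
  "continuous_on (ball 0 (2 * pi)) (\<lambda>p. shoot x l p)"
  unfolding shoot_def Let_def
  by (intro continuous_intros continuous_on_kap_norm continuous_on_hel_i) auto

text \<open>A quantitative form of the pole: sin d \<le> d for d = 2 pi - w, and from 3 pi / 2 on
  cos d is nonnegative and w / 2 at least 1. It drives the dual functional down near the sphere |p|
  = 2 pi.\<close>

lemma kap_le_near_2pi:
  assumes "3 * pi / 2 \<le> w" "w < 2 * pi"
  shows "kap w 1 \<le> - (1 / (2 * pi - w))"
proof -
  define d where "d = 2 * pi - w"
  have d: "0 < d" "d \<le> pi / 2" "w = 2 * pi - d" using assms by (auto simp: d_def)
  have w: "2 \<le> w" using assms(1) pi_gt3 by simp
  have sd: "sin d > 0" "cos d \<ge> 0" "sin d \<le> d" using d by (auto intro!: sin_gt_zero cos_ge_zero sin_x_le_x)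
  have c1: "1 - cos d > 0" using one_minus_cos_pos[of d] d by simp
  have "(1 - cos d) * (1 + cos d) = sin d * sin d" using sin_squared_eq[of d] by (simp add: power2_eq_square algebra_simps)
  then have q: "sin d / (1 - cos d) = (1 + cos d) / sin d" using sd c1 by (simp add: field_simps)
  have "1 / d \<le> 1 / sin d" using sd d by (intro divide_left_mono) auto
  also have "\<dots> \<le> (1 + cos d) / sin d" using sd by (intro divide_right_mono) auto
  finally have "1 / d \<le> sin d / (1 - cos d)" using q by simp
  also have "\<dots> \<le> w / 2 * (sin d / (1 - cos d))"
    using mult_right_mono[of 1 "w / 2" "sin d / (1 - cos d)"] w sd c1 by simp
  also have "\<dots> = - kap w 1" using d w by (simp add: kap_def)
  finally show ?thesis by (simp add: d_def)
qed

text \<open>The dual functional D p = W_p(1, (x, l, y)) has an interior maximum, since for x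
  \<noteq> 0 its singular term pushes it down near the boundary of the ball. At the maximum the
  first-order condition says that the vertical end point \<open>Y p\<close> is
  \<open>y\<close>.\<close>

lemma helix_surj_aux:
  fixes x :: real and l y :: "real ^ 'n::finite"
  assumes x: "x \<noteq> 0"
  shows "\<exists>a0 a p. norm p < 2 * pi \<and> helix (a0, a, p) 1 = (x, l, y)"
proof -
  let ?B = "ball 0 (2 * pi) :: (real ^ 'n) set"
  define Y where "Y p = snd (snd (helix (shoot x l p) 1))" for p
  have H: "helix (shoot x l p) 1 = (x, l, Y p)" if "p \<in> ?B" for p
    using shoot_end[of p x l] that by (cases "helix (shoot x l p) 1") (simp add: Y_def hproj_def)
  have shp: "snd (snd (shoot x l p)) = p" for p by (simp add: shoot_def Let_def)
  have contS: "continuous_on ?B (\<lambda>p. shoot x l p)" by (rule continuous_on_shoot)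
  have contY: "continuous_on ?B Y"
  proof -
    have "continuous_on ?B (\<lambda>p. helix (fst (shoot x l p), fst (snd (shoot x l p)), p) 1)"
      by (intro continuous_on_helix_1 continuous_intros contS)
    then have "continuous_on ?B (\<lambda>p. helix (shoot x l p) 1)" using shp by (metis (no_types, lifting) continuous_on_cong prod.collapse)
    then show ?thesis unfolding Y_def by (intro continuous_intros)
  qed
  define D where "D p = hj p 1 (x, l, y)" for p
  have diff: "hj p 1 (x, l, y1) = hj p 1 (x, l, y2) + 2 * (p \<bullet> (y1 - y2))" for p y1 y2
    by (simp add: hj_def inner_simps)
  \<comment> \<open>By weak duality, p maximizes the functional belonging to the end point that
    \<open>shoot\<close> reaches with p. This supergradient inequality replaces a derivative of D in
    p.\<close>
  have concave: "hj p' 1 (x, l, Y p) \<le> hj p 1 (x, l, Y p)" if "p \<in> ?B" "p' \<in> ?B" for p p'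
  proof -
    obtain a0 a where s: "shoot x l p = (a0, a, p)" using shp[of p] by (metis prod.collapse)
    have "hj p' 1 (helix (a0, a, p) 1) \<le> a0\<^sup>2 + (norm a)\<^sup>2" using that by (intro hj_helix_le) auto
    also have "\<dots> = hj p 1 (helix (a0, a, p) 1)" using hj_helix[of 1 p a0 a] that by simp
    finally show ?thesis using H[OF that(1)] by (simp add: s)
  qed
  have contD: "continuous_on ?B D"
  proof -
    have eq: "D p = (fst (shoot x l p))\<^sup>2 + (norm (fst (snd (shoot x l p))))\<^sup>2 + 2 * (p \<bullet> (y - Y p))" if "p \<in> ?B" for p
    proof -
      obtain a0 a where s: "shoot x l p = (a0, a, p)" using shp[of p] by (metis prod.collapse)
      show ?thesis using hj_helix[of 1 p a0 a] that H[OF that] diff[of p y "Y p"] by (simp add: D_def s)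
    qed
    have "continuous_on ?B (\<lambda>p. (fst (shoot x l p))\<^sup>2 + (norm (fst (snd (shoot x l p))))\<^sup>2 + 2 * (p \<bullet> (y - Y p)))"
      by (intro continuous_intros contS contY)
    then show ?thesis by (rule continuous_on_eq) (simp add: eq)
  qed
  \<comment> \<open>K exceeds all other terms of D, and d is chosen such that x^2 / e \<ge> K as
    soon as e = 2 pi - |p| is at most d. Then D p is negative there, whereas D 0 is
    nonnegative.\<close>
  define K where "K = (norm l)\<^sup>2 + 4 * pi * norm y + 1"
  have K: "K > 0" by (simp add: K_def add_nonneg_pos)
  define d where "d = min (pi / 2) (x\<^sup>2 / K)"
  have d: "0 < d" "d \<le> pi / 2" "d * K \<le> x\<^sup>2" using x K pi_gt_zero
    by (auto simp: d_def min_def field_simps)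
  define R where "R = 2 * pi - d"
  have R: "0 \<le> R" "R < 2 * pi" using d pi_gt_zero by (auto simp: R_def)
  have far: "D p \<le> D 0" if p: "p \<in> ?B" "R < norm p" for p
  proof -
    define e where "e = 2 * pi - norm p"
    have e: "0 < e" "e \<le> d" using p by (auto simp: e_def R_def)
    have k: "kap (norm p) 1 \<le> - (1 / e)"
      using kap_le_near_2pi[of "norm p"] p d by (simp add: e_def R_def)
    have "e * K \<le> d * K" using e K by (intro mult_right_mono) auto
    then have "K \<le> x\<^sup>2 / e" using e d by (simp add: pos_le_divide_eq mult.commute)
    then have "K \<le> (1 / e) * x\<^sup>2" by simp
    also have "\<dots> \<le> - kap (norm p) 1 * (x\<^sup>2 + (l \<bullet> sgn p)\<^sup>2)"
    proof (rule mult_mono)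
      have "0 < 1 / e" using e by simp
      then show "0 \<le> - kap (norm p) 1" using k by linarith
    qed (use k in auto)
    finally have "kap (norm p) 1 * (x\<^sup>2 + (l \<bullet> sgn p)\<^sup>2) \<le> - K" by simp
    moreover have "p \<bullet> y \<le> 2 * pi * norm y"
      using norm_cauchy_schwarz[of p y] mult_right_mono[of "norm p" "2 * pi" "norm y"] p by simp
    moreover have "D p = kap (norm p) 1 * (x\<^sup>2 + (l \<bullet> sgn p)\<^sup>2) + (norm l)\<^sup>2 - (l \<bullet> sgn p)\<^sup>2 + 2 * (p \<bullet> y)"
      by (simp add: D_def hj_def)
    moreover have "0 \<le> (l \<bullet> sgn p)\<^sup>2" by simp
    ultimately have "D p \<le> - K + (norm l)\<^sup>2 + 4 * pi * norm y" by linarith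
    also have "\<dots> \<le> 0" by (simp add: K_def)
    also have "0 \<le> D 0" by (simp add: D_def hj_def kap_def)
    finally show ?thesis .
  qed
  have sub: "cball 0 R \<subseteq> ?B" using R by auto
  have "compact (cball (0 :: real ^ 'n) R)" "cball (0 :: real ^ 'n) R \<noteq> {}" using R by auto
  from continuous_attains_sup[OF this continuous_on_subset[OF contD sub]]
  obtain p where p: "p \<in> cball 0 R" "\<And>p'. p' \<in> cball 0 R \<Longrightarrow> D p' \<le> D p" by blast
  have pB: "p \<in> ?B" using p(1) sub by blast
  have max: "D p' \<le> D p" if "p' \<in> ?B" for p'
  proof (cases "R < norm p'")
    case True
    then show ?thesis using far[OF that True] p(2)[of 0] R by simp
  qed (use p(2) in auto)
  \<comment> \<open>Comparing the maximality of p with the supergradient inequality at p + s h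
    leaves 2 s times an inner product. Dividing by s and letting s tend to 0 uses only the
    continuity of \<open>Y\<close>.\<close>
  have "0 \<le> h \<bullet> (Y p - y)" for h
  proof -
    have pos: "0 \<le> h \<bullet> (Y (p + s *\<^sub>R h) - y)" if s: "0 < s" "p + s *\<^sub>R h \<in> ?B" for s
    proof -
      let ?p = "p + s *\<^sub>R h"
      have "D p + 2 * (p \<bullet> (Y ?p - y)) \<le> D ?p + 2 * (?p \<bullet> (Y ?p - y))"
        using concave[OF s(2) pB] unfolding D_def diff[of _ "Y ?p" y] .
      also have "D ?p \<le> D p" by (rule max[OF s(2)])
      finally have "0 \<le> 2 * s * (h \<bullet> (Y ?p - y))" by (simp add: inner_simps algebra_simps)
      then show ?thesis using s(1) by (simp add: zero_le_mult_iff)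
    qed
    have lim: "((\<lambda>s. p + s *\<^sub>R h) \<longlongrightarrow> p) (at_right 0)" by (auto intro!: tendsto_eq_intros)
    have ev: "\<forall>\<^sub>F s in at_right 0. p + s *\<^sub>R h \<in> ?B" using topological_tendstoD[OF lim open_ball pB] .
    have "((\<lambda>s. Y (p + s *\<^sub>R h)) \<longlongrightarrow> Y p) (at_right 0)"
    proof -
      have "isCont Y p" using contY pB by (simp add: continuous_on_eq_continuous_at[OF open_ball])
      from isCont_tendsto_compose[OF this lim] show ?thesis .
    qed
    then have "((\<lambda>s. h \<bullet> (Y (p + s *\<^sub>R h) - y)) \<longlongrightarrow> h \<bullet> (Y p - y)) (at_right 0)"
      by (intro tendsto_intros)
    moreover have "\<forall>\<^sub>F s in at_right 0. 0 \<le> h \<bullet> (Y (p + s *\<^sub>R h) - y)"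
      using ev eventually_at_right_less[of 0] by eventually_elim (use pos in auto)
    ultimately show ?thesis by (intro tendsto_lowerbound) auto
  qed
  from this[of "y - Y p"] have "(y - Y p) \<bullet> (y - Y p) \<le> 0" by (simp add: inner_simps algebra_simps)
  then have "(y - Y p) \<bullet> (y - Y p) = 0" using inner_ge_zero[of "y - Y p"] by linarith
  then have "y - Y p = 0" by (simp only: inner_eq_zero_iff)
  then have "Y p = y" by (simp only: right_minus_eq)
  then have "helix (shoot x l p) 1 = (x, l, y)" using H[OF pB] by simp
  moreover obtain a0 a where "shoot x l p = (a0, a, p)" using shp[of p] by (metis prod.collapse)
  ultimately show ?thesis using pB by auto
qed

text \<open>For x = 0 the maximum may escape to the sphere |p| = 2 pi, which is where the cut points
  come from. Such points are limits of points with x = 1 / (n+1), whose covectors stay in a compact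
  set because their energy equals W, bounded by \<open>hj_le\<close>.\<close>

lemma helix_surj:
  fixes q :: "'n::finite pgroup"
  shows "\<exists>a0 a p. norm p \<le> 2 * pi \<and> helix (a0, a, p) 1 = q"
proof -
  obtain x l y where q: "q = (x, l, y :: real ^ 'n)" by (cases q)
  show ?thesis
  proof (cases "x = 0")
    case False
    then obtain a0 a p where "norm p < 2 * pi" "helix (a0, a, p) 1 = q"
      using helix_surj_aux[of x l y] q by blast
    then show ?thesis by (intro exI[of _ a0] exI[of _ a] exI[of _ p]) simp
  next
    case True
    have "\<exists>\<xi>. norm (snd (snd \<xi>)) < 2 * pi \<and> helix \<xi> 1 = (1 / real (Suc n), l, y)" for n
      using helix_surj_aux[of "1 / real (Suc n)" l y] by fastforce
    then obtain \<xi> where \<xi>: "\<And>n. norm (snd (snd (\<xi> n))) < 2 * pi" "\<And>n. helix (\<xi> n) 1 = (1 / real (Suc n), l, y)"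
      by metis
    define K where "K = 1 + (norm l)\<^sup>2 + 4 * pi * norm y"
    define A where "A = {\<xi> :: 'n pgroup. (fst \<xi>)\<^sup>2 + (norm (fst (snd \<xi>)))\<^sup>2 \<le> K \<and> norm (snd (snd \<xi>)) \<le> 2 * pi}"
    have "\<xi> n \<in> A" for n
    proof -
      obtain a0 a p where s: "\<xi> n = (a0, a, p)" by (cases "\<xi> n")
      have "a0\<^sup>2 + (norm a)\<^sup>2 = hj p 1 (1 / real (Suc n), l, y)"
        using hj_helix[of 1 p a0 a] \<xi>[of n] by (simp add: s)
      also have "\<dots> \<le> (1 / real (Suc n))\<^sup>2 + (norm l)\<^sup>2 + 2 * norm p * norm y"
        using hj_le[of 1 p "(1 / real (Suc n), l, y)"] \<xi>(1)[of n] by (simp add: s hproj_def norm_Pair)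
      also have "(1 / real (Suc n))\<^sup>2 \<le> 1" by (rule power_le_one) auto
      also have "2 * norm p * norm y \<le> 2 * (2 * pi) * norm y"
        using \<xi>(1)[of n] by (intro mult_right_mono) (auto simp: s)
      finally show ?thesis using \<xi>(1)[of n] by (simp add: A_def s K_def)
    qed
    moreover have "compact A"
    proof -
      have "closed A" unfolding A_def by (intro closed_Collect_conj closed_Collect_le continuous_intros)
      moreover have "bounded A"
      proof (rule boundedI)
        fix \<xi> assume a: "\<xi> \<in> A"
        obtain a0 a p where s: "\<xi> = (a0, a, p)" by (cases \<xi>)
        have "(norm \<xi>)\<^sup>2 = a0\<^sup>2 + (norm a)\<^sup>2 + (norm p)\<^sup>2" by (simp add: s norm_Pair)
        also have "\<dots> \<le> K + (2 * pi)\<^sup>2" using a by (intro add_mono power_mono) (auto simp: A_def s)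
        finally show "norm \<xi> \<le> sqrt (K + (2 * pi)\<^sup>2)" by (rule real_le_rsqrt)
      qed
      ultimately show ?thesis by (simp add: compact_eq_bounded_closed)
    qed
    ultimately obtain \<zeta> r where r: "\<zeta> \<in> A" "strict_mono r" "(\<xi> \<circ> r) \<longlonglongrightarrow> \<zeta>"
      unfolding compact_def by blast
    have "continuous_on UNIV (\<lambda>\<xi> :: 'n pgroup. helix (fst \<xi>, fst (snd \<xi>), snd (snd \<xi>)) 1)"
      by (intro continuous_on_helix_1 continuous_intros)
    then have "continuous_on UNIV (\<lambda>\<xi> :: 'n pgroup. helix \<xi> 1)" by simp
    then have "isCont (\<lambda>\<xi> :: 'n pgroup. helix \<xi> 1) \<zeta>"
      using continuous_on_eq_continuous_at[OF open_UNIV] by blast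
    from isCont_tendsto_compose[OF this r(3)]
    have 1: "(\<lambda>n. helix (\<xi> (r n)) 1) \<longlonglongrightarrow> helix \<zeta> 1" by (simp add: o_def)
    have "(\<lambda>n. 1 / real (Suc n)) \<longlonglongrightarrow> 0" using LIMSEQ_inverse_real_of_nat by (simp add: divide_inverse)
    then have "(\<lambda>n. (1 / real (Suc n), l, y)) \<longlonglongrightarrow> (0, l, y)" by (intro tendsto_Pair tendsto_const)
    from LIMSEQ_subseq_LIMSEQ[OF this r(2)] have "(\<lambda>n. helix (\<xi> (r n)) 1) \<longlonglongrightarrow> (0, l, y)"
      unfolding \<xi>(2) by (simp add: o_def)
    with 1 have "helix \<zeta> 1 = q" using LIMSEQ_unique q True by blast
    then show ?thesis using r(1) by (cases \<zeta>) (auto simp: A_def)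
  qed
qed

section \<open>Classification of minimizers\<close>

lemma minimizing_horizontal: "minimizing a b \<gamma> \<Longrightarrow> horizontal_curve a b \<gamma>"
  unfolding minimizing_def by (rule conjunct1)

lemma minimizing_le:
  assumes "minimizing a b \<gamma>" "c \<le> d" "horizontal_curve c d \<eta>" "\<eta> c = \<gamma> a" "\<eta> d = \<gamma> b"
  shows "sr_length a b \<gamma> \<le> sr_length c d \<eta>"
  using assms unfolding minimizing_def by blast

text \<open>Some helix with |p| \<le> 2 pi at time 1 ends at the same point. It is minimizing, so
  after normalization its length is T, and the calibration belonging to it is saturated by \<gamma>
  as well.\<close>

lemma minimizer_is_helix:
  fixes \<gamma> :: "real \<Rightarrow> 'n::finite pgroup"
  assumes \<gamma>: "minimizing 0 T \<gamma>" and T: "0 < T" and 0: "\<gamma> 0 = 0"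
    and unit: "\<And>s t. 0 \<le> s \<Longrightarrow> s \<le> t \<Longrightarrow> t \<le> T \<Longrightarrow> sr_length s t \<gamma> = t - s"
  shows "\<exists>\<xi>. unit_covector \<xi> \<and> norm (snd (snd \<xi>)) * T \<le> 2 * pi \<and> (\<forall>t\<in>{0..T}. \<gamma> t = helix \<xi> t)"
proof -
  have h: "horizontal_curve 0 T \<gamma>" by (rule minimizing_horizontal[OF \<gamma>])
  have min: "T \<le> sr_length c d \<eta>"
    if "c \<le> d" "horizontal_curve c d \<eta>" "\<eta> c = \<gamma> 0" "\<eta> d = \<gamma> T" for c d \<eta>
    using minimizing_le[OF \<gamma> that] unit[of 0 T] T by simp
  obtain a0 a p where p: "norm p \<le> 2 * pi" "helix (a0, a, p) 1 = \<gamma> T" using helix_surj by blast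
  define E L where EL: "E = a0\<^sup>2 + (norm a)\<^sup>2" "L = sqrt E"
  have "E \<noteq> 0"
  proof
    assume "E = 0"
    then have "a0 = 0" "a = 0" by (auto simp: EL add_nonneg_eq_0_iff)
    then have "\<gamma> T = 0" using p(2) by (simp add: helix_trivial)
    moreover have "horizontal_curve 0 0 (\<lambda>_. 0 :: 'n pgroup)"
      using horizontal_curve_helix[of 0 0 "0 :: 'n pgroup"]
        horizontal_curve_cong[of 0 0 "helix (0 :: 'n pgroup)" "\<lambda>_. 0"] by simp
    ultimately have "T \<le> sr_length 0 0 (\<lambda>_. 0 :: 'n pgroup)" using min[of 0 0 "\<lambda>_. 0"] 0 by simp
    then show False using T by (simp add: sr_length_def)
  qed
  then have L: "L > 0" "L\<^sup>2 = E" by (simp_all add: EL add_nonneg_pos less_le)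
  define \<xi> where "\<xi> = (1 / L) *\<^sub>R (a0, a, p)"
  have u: "unit_covector \<xi>"
  proof -
    have "(a0 / L)\<^sup>2 + (norm a / L)\<^sup>2 = E / L\<^sup>2" by (simp only: EL(1) power_divide add_divide_distrib)
    also have "\<dots> = 1" unfolding L(2)[symmetric] using L(1) by simp
    finally show ?thesis using L(1) by (simp add: \<xi>_def unit_covector_def)
  qed
  have e: "helix \<xi> L = \<gamma> T" using helix_scale[of "1 / L" "(a0, a, p)" L] L p(2) by (simp add: \<xi>_def)
  have pL: "norm (snd (snd \<xi>)) * L \<le> 2 * pi" using p(1) L by (simp add: \<xi>_def)
  have "L \<le> T"
  proof -
    have "sr_length 0 L (helix \<xi>) \<le> sr_length 0 T \<gamma>"
      by (rule minimizing_le[OF minimizing_helix[OF u L(1) pL] _ h]) (use T 0 e in auto)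
    then show ?thesis using sr_length_helix[OF u, of 0 L] unit[of 0 T] L T by simp
  qed
  moreover have "T \<le> L"
    using min[OF _ horizontal_curve_helix, of 0 L \<xi>] sr_length_helix[OF u, of 0 L] L(1) e 0 by simp
  ultimately have LT: "L = T" by simp
  obtain c0 c r where x: "\<xi> = (c0, c, r)" by (cases \<xi>)
  have hjT: "hj r T (\<gamma> T) = T"
    using hj_helix[of T r c0 c] T pL u e LT by (simp add: x unit_covector_def)
  have rT: "norm r * T < 2 * pi \<or> (norm r * T = 2 * pi \<and> fst (\<gamma> T) = 0 \<and> r \<bullet> fst (snd (\<gamma> T)) = 0)"
    using helix_planar_zero[of r T c0 c] pL e LT by (auto simp: x)
  have "\<exists>a0 a. unit_covector (a0, a, r) \<and> (\<forall>t\<in>{0..T}. \<gamma> t = helix (a0, a, r) t)"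
    by (rule helix_of_hj_eq[OF h T 0 unit rT hjT])
  then obtain b0 b where "unit_covector (b0, b, r)" "\<forall>t\<in>{0..T}. \<gamma> t = helix (b0, b, r) t" by blast
  moreover have "norm r * T \<le> 2 * pi" using pL LT by (simp add: x)
  ultimately show ?thesis by (intro exI[of _ "(b0, b, r)"]) simp
qed

section \<open>Geodesics and cut times\<close>

definition unit_speed :: "real \<Rightarrow> real \<Rightarrow> (real \<Rightarrow> 'n::finite pgroup) \<Rightarrow> bool" where
  "unit_speed a b \<gamma> \<longleftrightarrow> horizontal_curve a b \<gamma> \<and>
     (\<forall>s t. a \<le> s \<longrightarrow> s \<le> t \<longrightarrow> t \<le> b \<longrightarrow> sr_length s t \<gamma> = t - s)"

lemma unit_speedD:
  assumes "unit_speed a b \<gamma>" "a \<le> s" "t \<le> b"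
  shows "horizontal_curve s t \<gamma>" and "s \<le> t \<Longrightarrow> sr_length s t \<gamma> = t - s"
  using assms horizontal_curve_subset[of a b \<gamma> s t] by (auto simp: unit_speed_def)

lemma unit_speed_cong:
  assumes "unit_speed a b \<gamma>" "\<And>t. t \<in> {a..b} \<Longrightarrow> \<gamma> t = \<gamma>' t"
  shows "unit_speed a b \<gamma>'"
  unfolding unit_speed_def
proof (intro conjI allI impI)
  show "horizontal_curve a b \<gamma>'"
    using horizontal_curve_cong[of a b \<gamma> \<gamma>', OF assms(2)] assms(1) by (simp add: unit_speed_def)
  fix s t assume st: "a \<le> s" "s \<le> t" "t \<le> b"
  show "sr_length s t \<gamma>' = t - s"
    using sr_length_cong[of s t \<gamma> \<gamma>'] unit_speedD[OF assms(1) st(1,3)] assms(2) st by simp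
qed

lemma unit_speed_join:
  assumes "unit_speed a b \<gamma>" "unit_speed b c \<gamma>" "a \<le> b" "b \<le> c"
  shows "unit_speed a c \<gamma>"
proof -
  have h: "horizontal_curve a c \<gamma>"
    using horizontal_curve_join assms unfolding unit_speed_def by blast
  have "sr_length s t \<gamma> = t - s" if st: "a \<le> s" "s \<le> t" "t \<le> c" for s t
  proof (cases "t \<le> b \<or> b \<le> s")
    case True
    then show ?thesis using assms(1,2) st by (auto simp: unit_speed_def)
  next
    case False
    have "sr_length s t \<gamma> = sr_length s b \<gamma> + sr_length b t \<gamma>"
      by (rule sr_length_add[OF horizontal_curve_subset[OF h]]) (use False st in auto)
    then show ?thesis using assms(1,2) st False by (auto simp: unit_speed_def)
  qed
  with h show ?thesis by (simp add: unit_speed_def)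
qed

lemma unit_speed_translate:
  assumes "unit_speed a b \<gamma>"
  shows "unit_speed a b (\<lambda>t. pg_mult g (\<gamma> t))"
  unfolding unit_speed_def
proof (intro conjI allI impI)
  show "horizontal_curve a b (\<lambda>t. pg_mult g (\<gamma> t))"
    by (rule horizontal_curve_translate) (use assms in \<open>simp add: unit_speed_def\<close>)
  fix s t assume st: "a \<le> s" "s \<le> t" "t \<le> b"
  show "sr_length s t (\<lambda>t. pg_mult g (\<gamma> t)) = t - s"
    using sr_length_translate[OF unit_speedD(1)[OF assms st(1,3)]] unit_speedD(2)[OF assms st(1,3,2)] by simp
qed

lemma unit_speed_shift:
  assumes "unit_speed (a + c) (b + c) \<gamma>"
  shows "unit_speed a b (\<lambda>t. \<gamma> (t + c))"
  unfolding unit_speed_def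
proof (intro conjI allI impI)
  show "horizontal_curve a b (\<lambda>t. \<gamma> (t + c))"
    by (rule horizontal_curve_shift) (use assms in \<open>simp add: unit_speed_def\<close>)
  fix s t assume st: "a \<le> s" "s \<le> t" "t \<le> b"
  show "sr_length s t (\<lambda>t. \<gamma> (t + c)) = t - s"
    using sr_length_shift[of s c t \<gamma>] unit_speedD[OF assms, of "s + c" "t + c"] st by simp
qed

lemma unit_speed_helix: "unit_covector \<xi> \<Longrightarrow> unit_speed a b (helix \<xi>)"
  by (simp add: unit_speed_def horizontal_curve_helix sr_length_helix)

lemma pg_mult_cancel: "pg_mult g x = pg_mult g y \<longleftrightarrow> x = y"
  by (metis pg_mult_0(1) pg_mult_assoc pg_mult_minus(1))

lemma pg_mult_minus_cancel: "pg_mult g (pg_mult (- g) x) = x" "pg_mult (- g) (pg_mult g x) = x"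
  by (metis pg_mult_0(1) pg_mult_assoc pg_mult_minus)+

lemma minimizing_translate:
  assumes "minimizing a b \<gamma>"
  shows "minimizing a b (\<lambda>t. pg_mult g (\<gamma> t))"
  unfolding minimizing_def
proof (intro conjI allI impI)
  note h = minimizing_horizontal[OF assms]
  show "horizontal_curve a b (\<lambda>t. pg_mult g (\<gamma> t))" by (rule horizontal_curve_translate[OF h])
  fix c d \<eta> assume \<eta>: "c \<le> d \<and> horizontal_curve c d \<eta> \<and> \<eta> c = pg_mult g (\<gamma> a) \<and> \<eta> d = pg_mult g (\<gamma> b)"
  have "sr_length a b \<gamma> \<le> sr_length c d (\<lambda>t. pg_mult (- g) (\<eta> t))"
    by (rule minimizing_le[OF assms])
      (use \<eta> horizontal_curve_translate[of c d \<eta> "- g"] in \<open>auto simp: pg_mult_minus_cancel\<close>)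
  then show "sr_length a b (\<lambda>t. pg_mult g (\<gamma> t)) \<le> sr_length c d \<eta>"
    using sr_length_translate[OF h] sr_length_translate[of c d \<eta> "- g"] \<eta> by simp
qed

lemma minimizing_shift_iff:
  "minimizing a b (\<lambda>t. \<gamma> (t + c)) \<longleftrightarrow> minimizing (a + c) (b + c) \<gamma>"
proof -
  have 1: "minimizing a b (\<lambda>t. \<gamma> (t + c))" if m: "minimizing (a + c) (b + c) \<gamma>" for a b c and \<gamma> :: "real \<Rightarrow> 'a pgroup"
    unfolding minimizing_def
  proof (intro conjI allI impI)
    note h = minimizing_horizontal[OF m]
    show "horizontal_curve a b (\<lambda>t. \<gamma> (t + c))" by (rule horizontal_curve_shift[OF h])
    fix c' d \<eta> assume "c' \<le> d \<and> horizontal_curve c' d \<eta> \<and> \<eta> c' = \<gamma> (a + c) \<and> \<eta> d = \<gamma> (b + c)"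
    then show "sr_length a b (\<lambda>t. \<gamma> (t + c)) \<le> sr_length c' d \<eta>"
      unfolding sr_length_shift[OF h] by (intro minimizing_le[OF m]) auto
  qed
  show ?thesis using 1[where c = c and \<gamma> = \<gamma> and a = a and b = b]
      1[where c = "- c" and \<gamma> = "\<lambda>t. \<gamma> (t + c)" and a = "a + c" and b = "b + c"] by auto
qed

lemma minimizing_cong:
  assumes "minimizing a b \<gamma>" "a \<le> b" "\<And>t. t \<in> {a..b} \<Longrightarrow> \<gamma> t = \<gamma>' t"
  shows "minimizing a b \<gamma>'"
  unfolding minimizing_def
proof (intro conjI allI impI)
  note h = minimizing_horizontal[OF assms(1)]
  show "horizontal_curve a b \<gamma>'" using h horizontal_curve_cong[of a b \<gamma> \<gamma>', OF assms(3)] by simp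
  fix c d \<eta> assume "c \<le> d \<and> horizontal_curve c d \<eta> \<and> \<eta> c = \<gamma>' a \<and> \<eta> d = \<gamma>' b"
  then have "sr_length a b \<gamma> \<le> sr_length c d \<eta>"
    using assms(2,3) by (intro minimizing_le[OF assms(1)]) auto
  then show "sr_length a b \<gamma>' \<le> sr_length c d \<eta>" using sr_length_cong[OF h assms(3)] by simp
qed

section \<open>Continuation of helices and local minimality\<close>

text \<open>The covector of the extremal at time s, translated back to the identity: its frame
  components are the control, and its vertical part is conserved.\<close>

definition helix_flow :: "'n::finite pgroup \<Rightarrow> real \<Rightarrow> 'n pgroup" where
  "helix_flow \<xi> s = (fst (helix_control \<xi> s), snd (helix_control \<xi> s), snd (snd \<xi>))"

lemma unit_helix_flow: "unit_covector \<xi> \<Longrightarrow> unit_covector (helix_flow \<xi> s)"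
proof -
  assume u: "unit_covector \<xi>"
  obtain a0 a p where \<xi>: "\<xi> = (a0, a, p)" by (cases \<xi>)
  obtain v w where c: "helix_control \<xi> s = (v, w)" by (cases "helix_control \<xi> s")
  show ?thesis using helix_control_norm[of a0 a p s] u c
    by (simp add: unit_covector_def helix_flow_def \<xi> norm_Pair)
qed

lemma hel_x_add:
  "hel_x a b w (s + t) = hel_x a b w s + hel_x (hel_u a b w s) (b - w\<^sup>2 * hel_x a b w s) w t"
proof (cases "w = 0")
  case True
  then show ?thesis by (simp add: hel_x_def hel_u_def power2_eq_square field_simps)
next
  case False
  define S C S' C' where SC: "S = sin (w * s)" "C = cos (w * s)" "S' = sin (w * t)" "C' = cos (w * t)"
  have 1: "b - w\<^sup>2 * hel_x a b w s = b * C - w * a * S"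
    using False by (simp add: hel_x_def SC power2_eq_square field_simps)
  have "hel_x a b w (s + t) = a * (S * C' + C * S') / w + b * (1 - (C * C' - S * S')) / w\<^sup>2"
    using False by (simp add: hel_x_def SC distrib_left sin_add cos_add)
  also have "\<dots> = (a * S / w + b * (1 - C) / w\<^sup>2) + ((a * C + b * S / w) * S' / w + (b * C - w * a * S) * (1 - C') / w\<^sup>2)"
    using False by (simp add: power2_eq_square field_simps)
  finally show ?thesis unfolding 1 using False by (simp add: hel_x_def hel_u_def SC)
qed

lemma hel_i1_add:
  "hel_i1 a b w (s + t) = hel_i1 a b w s + t * hel_x a b w s + hel_i1 (hel_u a b w s) (b - w\<^sup>2 * hel_x a b w s) w t"
proof -
  let ?f = "\<lambda>t. hel_i1 a b w (s + t) - (t * hel_x a b w s + hel_i1 (hel_u a b w s) (b - w\<^sup>2 * hel_x a b w s) w t)"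
  have "(?f has_real_derivative 0) (at t)" for t
  proof -
    have "((\<lambda>t. hel_i1 a b w (s + t)) has_real_derivative hel_x a b w (s + t)) (at t)"
      using DERIV_shift[of "hel_i1 a b w" "hel_x a b w (s + t)" t s] hel_i1_deriv[of a b w "t + s" UNIV]
      by (simp add: add.commute)
    then have "(?f has_real_derivative hel_x a b w (s + t) - (hel_x a b w s + hel_x (hel_u a b w s) (b - w\<^sup>2 * hel_x a b w s) w t)) (at t)"
      by (auto intro!: derivative_eq_intros hel_i1_deriv)
    then show ?thesis by (simp add: hel_x_add)
  qed
  then have "?f t = ?f 0" by (intro DERIV_isconst_all) auto
  then show ?thesis by simp
qed

text \<open>Restarting the oscillator at time s with its current velocity and acceleration gives the
  planar parts; the vertical part follows by horizontality.\<close>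

lemma helix_add: "0 \<le> t \<Longrightarrow> helix \<xi> (s + t) = pg_mult (helix \<xi> s) (helix (helix_flow \<xi> s) t)"
proof -
  assume t: "0 \<le> t"
  obtain a0 a p where \<xi>: "\<xi> = (a0, a, p)" by (cases \<xi>)
  define v where "v = a - hel_x a0 (a \<bullet> p) (norm p) s *\<^sub>R p"
  have fl: "helix_flow \<xi> s = (hel_u a0 (a \<bullet> p) (norm p) s, v, p)"
    by (simp add: helix_flow_def \<xi> helix_control_def v_def)
  have b: "v \<bullet> p = a \<bullet> p - (norm p)\<^sup>2 * hel_x a0 (a \<bullet> p) (norm p) s"
    by (simp add: inner_simps power2_norm_eq_inner v_def)
  have hp: "hproj (pg_mult g q) = hproj g + hproj q" for g q :: "'a pgroup"
    by (cases g; cases q) (simp add: hproj_def)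
  show ?thesis
  proof (rule horizontal_curve_eqI[where a = 0 and b = t and t = t])
    show "horizontal_curve 0 t (\<lambda>t. helix \<xi> (s + t))"
      using horizontal_curve_shift[OF horizontal_curve_helix, of 0 t \<xi> s] by (simp add: add.commute)
    show "horizontal_curve 0 t (\<lambda>t. pg_mult (helix \<xi> s) (helix (helix_flow \<xi> s) t))"
      by (rule horizontal_curve_translate[OF horizontal_curve_helix])
    show "helix \<xi> (s + 0) = pg_mult (helix \<xi> s) (helix (helix_flow \<xi> s) 0)" by (simp add: pg_mult_0)
    fix r assume "r \<in> {0..t}"
    show "hproj (helix \<xi> (s + r)) = hproj (pg_mult (helix \<xi> s) (helix (helix_flow \<xi> s) r))"
      unfolding hp fl unfolding \<xi> helix_def Let_def hproj_def prod.case fst_conv snd_conv b hel_x_add hel_i1_add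
      by (simp add: v_def scaleR_add_left scaleR_diff_right)
  qed (use t in auto)
qed

lemma minimizing_helix_arc:
  assumes "unit_covector \<xi>" "s < t" "norm (snd (snd \<xi>)) * (t - s) \<le> 2 * pi"
  shows "minimizing s t (helix \<xi>)"
proof -
  have "minimizing 0 (t - s) (helix (helix_flow \<xi> s))"
    by (rule minimizing_helix[OF unit_helix_flow[OF assms(1)]]) (use assms in \<open>auto simp: helix_flow_def\<close>)
  from minimizing_translate[OF this, of "helix \<xi> s"]
  have "minimizing 0 (t - s) (\<lambda>r. helix \<xi> (r + s))"
    by (rule minimizing_cong) (use assms(2) in \<open>auto simp: helix_add[symmetric] add.commute[of s]\<close>)
  then show ?thesis unfolding minimizing_shift_iff by simp
qed

lemma geodesic_on_helix:
  assumes "unit_covector \<xi>"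
  shows "geodesic_on I (helix \<xi>)"
  unfolding geodesic_on_def
proof (intro conjI ballI impI)
  fix a b :: real assume "a \<le> b"
  then show "horizontal_curve a b (helix \<xi>)" "sr_length a b (helix \<xi>) = b - a"
    using unit_speed_helix[OF assms, of a b] by (auto simp: unit_speed_def)
next
  fix t :: real
  define w where "w = norm (snd (snd \<xi>))"
  have w: "w \<ge> 0" by (simp add: w_def)
  \<comment> \<open>Arcs inside this neighbourhood have duration below 2 e and thus turn by at most
    a full period; the summand 1 covers w = 0.\<close>
  define e where "e = pi / (w + 1)"
  have e: "e > 0" "w * (2 * e) \<le> 2 * pi" using w pi_gt_zero by (auto simp: e_def field_simps)
  have "minimizing a b (helix \<xi>)" if "t - e < a" "a < b" "b < t + e" for a b
  proof (rule minimizing_helix_arc[OF assms that(2)])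
    have "w * (b - a) \<le> w * (2 * e)" using that w by (intro mult_left_mono) auto
    then show "norm (snd (snd \<xi>)) * (b - a) \<le> 2 * pi" using e by (simp add: w_def)
  qed
  then show "\<exists>e>0. \<forall>a\<in>I. \<forall>b\<in>I. t - e < a \<and> a < b \<and> b < t + e \<longrightarrow> minimizing a b (helix \<xi>)"
    using e(1) by blast
qed

lemma helix_control_eq:
  assumes s: "0 < s" and eq: "\<And>t. t \<in> {0..s} \<Longrightarrow> helix \<xi> t = helix \<zeta> t" and t: "t \<in> {0..s}"
  shows "helix_control \<xi> t = helix_control \<zeta> t"
proof -
  have "(helix \<xi> has_vector_derivative hlift (helix \<zeta> t) (helix_control \<zeta> t)) (at t within {0..s})"
    by (rule has_vector_derivative_transform[OF t _ helix_has_vector_derivative]) (simp add: eq)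
  from vector_derivative_unique_within[OF _ helix_has_vector_derivative this]
  have "hlift (helix \<xi> t) (helix_control \<xi> t) = hlift (helix \<zeta> t) (helix_control \<zeta> t)"
    using s t by (simp add: trivial_limit_within islimpt_Icc)
  then show ?thesis using hproj_hlift by metis
qed

lemma hel_u_zero:
  assumes "0 < s" "\<And>t. t \<in> {0<..<s} \<Longrightarrow> hel_u a b w t = 0"
  shows "a = 0 \<and> b = 0"
proof -
  have cont: "continuous_on UNIV (hel_u a b w)"
    by (rule DERIV_continuous_on) (rule hel_u_deriv)
  have c: "hel_u a b w t = 0" if "t \<in> {0..s}" for t
    by (rule continuous_constant_on_closure[of "{0<..<s}" _ 0])
       (use assms that in \<open>auto intro: continuous_on_subset[OF cont]\<close>)
  have a: "a = 0" using c[of 0] assms(1) by simp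
  define m where "m = s / 2"
  have m: "0 < m" "m < s" using assms(1) by (auto simp: m_def)
  have "(hel_u a b w has_real_derivative 0) (at m)"
    by (rule has_field_derivative_transform_within_open[of "\<lambda>_. 0" _ _ "{0<..<s}"]) (use m c in auto)
  then have "b - w\<^sup>2 * hel_x a b w m = 0" using DERIV_unique hel_u_deriv by blast
  moreover have "hel_x a b w m = hel_x a b w 0"
  proof (rule DERIV_isconst2[of 0 s])
    show "continuous_on {0..s} (hel_x a b w)"
      by (rule DERIV_continuous_on) (rule hel_x_deriv)
    show "(hel_x a b w has_real_derivative 0) (at x)" if "0 < x" "x < s" for x
      using hel_x_deriv[of a b w x UNIV] c[of x] that by simp
  qed (use m in auto)
  ultimately show ?thesis using a by simp
qed

text \<open>Either the oscillator is at rest or there is no rotation; both give straight lines.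
  These are the helices that do not determine \<open>p\<close>.\<close>

definition straight :: "'n::finite pgroup \<Rightarrow> bool" where
  "straight \<xi> \<longleftrightarrow> fst \<xi> = 0 \<and> fst (snd \<xi>) \<bullet> snd (snd \<xi>) = 0 \<or> snd (snd \<xi>) = 0"

text \<open>The control at time 0 shows the two horizontal components of the covector. The vertical
  part is read off from the control a - x p at a time with x \<noteq> 0, which exists unless the
  oscillator is at rest.\<close>

lemma helix_eq_imp:
  assumes s: "0 < s" and eq: "\<And>t. t \<in> {0..s} \<Longrightarrow> helix \<xi> t = helix \<zeta> t"
  shows "\<xi> = \<zeta> \<or> (straight \<xi> \<and> straight \<zeta> \<and> helix \<xi> = helix \<zeta>)"
proof -
  obtain a0 a p where \<xi>: "\<xi> = (a0, a, p)" by (cases \<xi>)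
  obtain c0 c r where \<zeta>: "\<zeta> = (c0, c, r)" by (cases \<zeta>)
  have ctl: "helix_control \<xi> t = helix_control \<zeta> t" if "t \<in> {0..s}" for t
    by (rule helix_control_eq[OF s eq that])
  have 0: "a0 = c0" "a = c"
    using ctl[of 0] s by (simp_all add: \<xi> \<zeta> helix_control_def)
  show ?thesis
  proof (cases "\<exists>t\<in>{0..s}. fst (helix \<xi> t) \<noteq> 0")
    case True
    then obtain t where t: "t \<in> {0..s}" "hel_x a0 (a \<bullet> p) (norm p) t \<noteq> 0"
      by (auto simp: \<xi> helix_def Let_def)
    have "hel_x a0 (a \<bullet> p) (norm p) t = hel_x c0 (c \<bullet> r) (norm r) t"
      using eq[OF t(1)] by (simp add: \<xi> \<zeta> helix_def Let_def)
    then have "hel_x a0 (a \<bullet> p) (norm p) t *\<^sub>R p = hel_x a0 (a \<bullet> p) (norm p) t *\<^sub>R r"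
      using ctl[OF t(1)] 0 by (simp add: \<xi> \<zeta> helix_control_def)
    then have "p = r" using t(2) by simp
    then show ?thesis using 0 by (simp add: \<xi> \<zeta>)
  next
    case False
    have z: "c0 = 0 \<and> b = 0" if "\<And>t. t \<in> {0..s} \<Longrightarrow> hel_x c0 b w t = 0" for c0 b w
    proof (rule hel_u_zero[OF s])
      fix t assume t: "t \<in> {0<..<s}"
      have "(hel_x c0 b w has_real_derivative 0) (at t)"
        by (rule has_field_derivative_transform_within_open[of "\<lambda>_. 0" _ _ "{0<..<s}"]) (use t that in auto)
      then show "hel_u c0 b w t = 0" using DERIV_unique hel_x_deriv by blast
    qed
    have 1: "a0 = 0 \<and> a \<bullet> p = 0"
      by (rule z[where w = "norm p"]) (use False in \<open>simp add: \<xi> helix_def Let_def\<close>)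
    have 2: "c0 = 0 \<and> c \<bullet> r = 0"
      by (rule z[where w = "norm r"]) (use False eq in \<open>simp add: \<xi> \<zeta> helix_def Let_def\<close>)
    have h0: "hel_x 0 0 w t = 0" "hel_i1 0 0 w t = 0" "hel_i2 0 0 w t = 0" for w t
      by (simp_all add: hel_x_def hel_i1_def hel_i2_def)
    have "helix \<xi> = helix \<zeta>" using 1 2 0 by (simp add: fun_eq_iff \<xi> \<zeta> helix_def Let_def h0)
    then show ?thesis using 1 2 by (simp add: straight_def \<xi> \<zeta>)
  qed
qed

lemma helix_eq_extend:
  assumes "0 < s" "\<And>t. t \<in> {0..s} \<Longrightarrow> helix \<xi> t = helix \<zeta> t"
  shows "helix \<xi> = helix \<zeta>"
  using helix_eq_imp[of s \<xi> \<zeta>] assms by blast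

lemma minimizing_arc_is_helix:
  assumes m: "minimizing a b \<gamma>" and u: "unit_speed a b \<gamma>" and ab: "a < b"
  shows "\<exists>\<xi>. unit_covector \<xi> \<and> (\<forall>t\<in>{0..b-a}. \<gamma> (a + t) = pg_mult (\<gamma> a) (helix \<xi> t))"
proof -
  define \<eta> where "\<eta> t = pg_mult (- \<gamma> a) (\<gamma> (t + a))" for t
  have "minimizing 0 (b - a) (\<lambda>t. \<gamma> (t + a))" unfolding minimizing_shift_iff using m by simp
  then have m': "minimizing 0 (b - a) \<eta>" unfolding \<eta>_def by (rule minimizing_translate)
  have "unit_speed 0 (b - a) (\<lambda>t. \<gamma> (t + a))" by (rule unit_speed_shift) (use u in simp)
  then have u': "unit_speed 0 (b - a) \<eta>" unfolding \<eta>_def by (rule unit_speed_translate)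
  have "\<exists>\<xi>. unit_covector \<xi> \<and> norm (snd (snd \<xi>)) * (b - a) \<le> 2 * pi \<and> (\<forall>t\<in>{0..b-a}. \<eta> t = helix \<xi> t)"
    by (rule minimizer_is_helix[OF m']) (use ab u' in \<open>auto simp: \<eta>_def pg_mult_minus unit_speed_def\<close>)
  then obtain \<xi> where \<xi>: "unit_covector \<xi>" "\<And>t. t \<in> {0..b-a} \<Longrightarrow> \<eta> t = helix \<xi> t" by blast
  have "\<gamma> (a + t) = pg_mult (\<gamma> a) (helix \<xi> t)" if "t \<in> {0..b-a}" for t
    using \<xi>(2)[OF that] by (simp add: \<eta>_def pg_mult_minus_cancel add.commute flip: \<xi>(2)[OF that])
  with \<xi>(1) show ?thesis by blast
qed

text \<open>Continuation argument: around the supremum of the times up to which \<gamma> is a helix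
  there is a minimizing arc. It is a helix too and overlaps with the first one, so unique
  continuation extends the helix beyond the supremum.\<close>

lemma geodesic_imp_helix:
  assumes "geodesic \<gamma>"
  shows "\<exists>\<xi>. unit_covector \<xi> \<and> (\<forall>t\<ge>0. \<gamma> t = helix \<xi> t)"
proof -
  have 0: "\<gamma> 0 = 0" and hor: "\<And>a b. 0 \<le> a \<Longrightarrow> a \<le> b \<Longrightarrow> horizontal_curve a b \<gamma> \<and> sr_length a b \<gamma> = b - a"
    using assms by (auto simp: geodesic_def geodesic_on_def)
  have loc: "\<exists>e>0. \<forall>a\<in>{0..}. \<forall>b\<in>{0..}. t - e < a \<and> a < b \<and> b < t + e \<longrightarrow> minimizing a b \<gamma>" if "0 \<le> t" for t
    using assms that unfolding geodesic_def geodesic_on_def by (metis atLeast_iff)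
  have us: "unit_speed a b \<gamma>" if "0 \<le> a" "a \<le> b" for a b
    using hor that by (auto simp: unit_speed_def)
  define P where "P T \<longleftrightarrow> (\<exists>\<xi>. unit_covector \<xi> \<and> (\<forall>t\<in>{0..T}. \<gamma> t = helix \<xi> t))" for T
  obtain e0 where e0: "e0 > 0" "\<And>a b. a \<ge> 0 \<Longrightarrow> b \<ge> 0 \<Longrightarrow> 0 - e0 < a \<Longrightarrow> a < b \<Longrightarrow> b < 0 + e0 \<Longrightarrow> minimizing a b \<gamma>"
    using loc[of 0] by auto
  have start: "P (e0 / 2)"
    using minimizing_arc_is_helix[OF e0(2)[of 0 "e0 / 2"] us[of 0 "e0 / 2"]] e0(1)
    by (simp add: P_def 0 pg_mult_0)
  have mono: "P s" if "P T" "s \<le> T" for s T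
    using that unfolding P_def by (meson atLeastAtMost_iff order_trans)
  have all: "P T" for T
  proof (rule ccontr)
    assume nP: "\<not> P T"
    define A where "A = {T. P T}"
    have ne: "A \<noteq> {}" using start by (auto simp: A_def)
    have bd: "bdd_above A" using nP mono by (metis A_def bdd_aboveI linorder_le_cases mem_Collect_eq)
    define M where "M = Sup A"
    have Mge: "e0 / 2 \<le> M" unfolding M_def by (rule cSup_upper[OF _ bd]) (use start in \<open>simp add: A_def\<close>)
    obtain e where e: "e > 0" "\<And>a b. a \<ge> 0 \<Longrightarrow> b \<ge> 0 \<Longrightarrow> M - e < a \<Longrightarrow> a < b \<Longrightarrow> b < M + e \<Longrightarrow> minimizing a b \<gamma>"
      using loc[of M] Mge e0(1) by auto
    obtain T1 where T1: "P T1" "max (M - e / 2) (M / 2) < T1"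
      using less_cSup_iff[OF ne bd, of "max (M - e / 2) (M / 2)"] Mge e e0(1) unfolding M_def[symmetric]
      by (auto simp: A_def)
    have T1M: "T1 \<le> M" unfolding M_def by (rule cSup_upper[OF _ bd]) (use T1 in \<open>simp add: A_def\<close>)
    \<comment> \<open>The point \<open>s\<close> is positive, lies in the neighbourhood where arcs
      minimize, and precedes \<open>T1\<close>, so that the arc overlaps with the known helix on
      [s, T1].\<close>
    define s b where sb: "s = max (M - e / 2) (M / 2)" "b = M + e / 2"
    have s: "0 < s" "s < T1" "s < b" "M - e < s" "b < M + e" using T1 T1M Mge e(1) e0(1) by (auto simp: sb)
    obtain \<xi> where \<xi>: "unit_covector \<xi>" "\<And>t. t \<in> {0..T1} \<Longrightarrow> \<gamma> t = helix \<xi> t" using T1(1) by (auto simp: P_def)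
    obtain \<zeta> where \<zeta>: "\<And>t. t \<in> {0..b-s} \<Longrightarrow> \<gamma> (s + t) = pg_mult (\<gamma> s) (helix \<zeta> t)"
      using minimizing_arc_is_helix[OF e(2)[of s b] us[of s b]] s by auto
    have "helix \<zeta> t = helix (helix_flow \<xi> s) t" if t: "t \<in> {0..T1 - s}" for t
    proof -
      have "pg_mult (\<gamma> s) (helix \<zeta> t) = pg_mult (\<gamma> s) (helix (helix_flow \<xi> s) t)"
        using \<zeta>[of t] \<xi>(2)[of "s + t"] \<xi>(2)[of s] helix_add[of t \<xi> s] t s T1M sb by simp
      then show ?thesis by (simp add: pg_mult_cancel)
    qed
    then have eq: "helix \<zeta> = helix (helix_flow \<xi> s)" using s by (intro helix_eq_extend[of "T1 - s"]) auto
    have "\<gamma> t = helix \<xi> t" if t: "t \<in> {0..b}" for t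
    proof (cases "t \<le> T1")
      case False
      then show ?thesis
        using \<zeta>[of "t - s"] \<xi>(2)[of s] helix_add[of "t - s" \<xi> s] t s by (simp add: eq)
    qed (use \<xi>(2) t in auto)
    then have "P b" unfolding P_def using \<xi>(1) by (intro exI[of _ \<xi>]) simp
    then have "b \<le> M" unfolding M_def by (intro cSup_upper[OF _ bd]) (simp add: A_def)
    then show False using e(1) by (simp add: sb)
  qed
  \<comment> \<open>So far the covector depends on the end time. All these helices agree on [0, 1]
    and hence everywhere.\<close>
  obtain \<xi> where \<xi>: "unit_covector \<xi>" "\<And>t. t \<in> {0..1} \<Longrightarrow> \<gamma> t = helix \<xi> t" using all[of 1] by (auto simp: P_def)
  have "\<gamma> t = helix \<xi> t" if t: "0 \<le> t" for t
  proof -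
    obtain \<zeta> where \<zeta>: "\<And>s. s \<in> {0..max 1 t} \<Longrightarrow> \<gamma> s = helix \<zeta> s" using all[of "max 1 t"] by (auto simp: P_def)
    have "helix \<zeta> = helix \<xi>"
      by (rule helix_eq_extend[of 1]) (use \<xi>(2) \<zeta> in \<open>auto simp flip: \<zeta> \<xi>(2)\<close>)
    then show ?thesis using \<zeta>[of t] t by simp
  qed
  with \<xi>(1) show ?thesis by blast
qed

section \<open>Loss of optimality after a full period, and the cut time\<close>

lemma helix_period:
  assumes p: "p \<noteq> 0"
  shows "helix (a0, a, p) (2 * pi / norm p) = (let P = 2 * pi / norm p; w = norm p; b = a \<bullet> p in
     (0, P *\<^sub>R a - (b * P / w\<^sup>2) *\<^sub>R p,
      - (b * P / w\<^sup>2) *\<^sub>R a + ((a0\<^sup>2 * P + 3 * b * (b * P / w\<^sup>2)) / (2 * w\<^sup>2)) *\<^sub>R p))"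
  using p by (simp add: helix_def Let_def hel_x_def hel_i1_def hel_i2_def)

text \<open>The arc over one period starting at \<open>t0\<close> is exchanged for its mirror image,
  which has the same end points and length. If the helix were minimizing, so would be the new curve;
  it would then be a helix and, agreeing with the old one on [0, t0], equal to it. But the controls
  at \<open>t0\<close> differ in sign along X_0.\<close>

lemma not_minimizing_after_period:
  assumes u: "unit_covector \<xi>" and ns: "\<not> straight \<xi>" and T: "2 * pi / norm (snd (snd \<xi>)) < T"
  shows "\<not> minimizing 0 T (helix \<xi>)"
proof
  assume m: "minimizing 0 T (helix \<xi>)"
  obtain a0 a p where \<xi>: "\<xi> = (a0, a, p)" by (cases \<xi>)
  have p: "p \<noteq> 0" and ab: "\<not> (a0 = 0 \<and> a \<bullet> p = 0)" using ns by (auto simp: straight_def \<xi>)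
  define P where "P = 2 * pi / norm p"
  have P: "P > 0" "P < T" using p T by (auto simp: P_def \<xi>)
  \<comment> \<open>Positivity of \<open>t0\<close> leaves an initial arc that identifies the helix,
    t0 + P < T makes room for the exchange, and a nonzero speed along X_0 makes the mirror image
    different.\<close>
  obtain t0 where t0: "0 < t0" "t0 < T - P" "hel_u a0 (a \<bullet> p) (norm p) t0 \<noteq> 0"
    using hel_u_zero[of "T - P" a0 "a \<bullet> p" "norm p"] ab P by force
  define u0 a' where u0: "u0 = hel_u a0 (a \<bullet> p) (norm p) t0" "a' = a - hel_x a0 (a \<bullet> p) (norm p) t0 *\<^sub>R p"
  have fl: "helix_flow \<xi> t0 = (u0, a', p)" by (simp add: helix_flow_def \<xi> helix_control_def u0)
  define \<zeta> where "\<zeta> = (- u0, a', p)"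
  have u\<zeta>: "unit_covector \<zeta>" using unit_helix_flow[OF u, of t0] by (simp add: fl \<zeta>_def unit_covector_def)
  define \<eta> where "\<eta> t = (if t0 \<le> t \<and> t \<le> t0 + P then pg_mult (helix \<xi> t0) (helix \<zeta> (t - t0)) else helix \<xi> t)" for t
  have start: "\<eta> t = helix \<xi> t" if "t \<le> t0" for t
    using that P by (auto simp: \<eta>_def pg_mult_0)
  have "helix \<zeta> P = helix (u0, a', p) P"
    unfolding P_def \<zeta>_def helix_period[OF p] by simp
  then have mid: "\<eta> (t0 + P) = helix \<xi> (t0 + P)"
    using helix_add[of P \<xi> t0] P by (simp add: \<eta>_def fl)
  have fin: "\<eta> t = helix \<xi> t" if "t0 + P \<le> t" for t
    using that mid P by (cases "t = t0 + P") (auto simp: \<eta>_def)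
  have "unit_speed 0 t0 \<eta>"
    by (rule unit_speed_cong[OF unit_speed_helix[OF u]]) (use start in auto)
  moreover have "unit_speed t0 (t0 + P) \<eta>"
  proof (rule unit_speed_cong)
    have "unit_speed t0 (t0 + P) (\<lambda>t. helix \<zeta> (t + - t0))"
      by (rule unit_speed_shift[OF unit_speed_helix[OF u\<zeta>]])
    from unit_speed_translate[OF this]
    show "unit_speed t0 (t0 + P) (\<lambda>t. pg_mult (helix \<xi> t0) (helix \<zeta> (t + - t0)))" .
  qed (simp add: \<eta>_def)
  moreover have "unit_speed (t0 + P) T \<eta>"
    by (rule unit_speed_cong[OF unit_speed_helix[OF u]]) (use fin in auto)
  ultimately have us: "unit_speed 0 T \<eta>"
    using unit_speed_join[of 0 t0 \<eta> "t0 + P"] unit_speed_join[of 0 "t0 + P" \<eta> T] t0 P by simp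
  have T0: "T > 0" using P by simp
  have min\<eta>: "minimizing 0 T \<eta>"
    unfolding minimizing_def
  proof (intro conjI allI impI)
    show "horizontal_curve 0 T \<eta>" using us by (simp add: unit_speed_def)
    fix c d \<theta> assume "c \<le> d \<and> horizontal_curve c d \<theta> \<and> \<theta> c = \<eta> 0 \<and> \<theta> d = \<eta> T"
    then have "sr_length 0 T (helix \<xi>) \<le> sr_length c d \<theta>"
      using start[of 0] fin[of T] t0 P by (intro minimizing_le[OF m]) auto
    then show "sr_length 0 T \<eta> \<le> sr_length c d \<theta>"
      using sr_length_helix[OF u, of 0 T] unit_speedD(2)[OF us, of 0 T] T0 by simp
  qed
  have "\<exists>\<rho>. unit_covector \<rho> \<and> norm (snd (snd \<rho>)) * T \<le> 2 * pi \<and> (\<forall>t\<in>{0..T}. \<eta> t = helix \<rho> t)"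
    by (rule minimizer_is_helix[OF min\<eta> T0]) (use start[of 0] t0 us in \<open>auto simp: unit_speed_def\<close>)
  then obtain \<rho> where \<rho>: "\<And>t. t \<in> {0..T} \<Longrightarrow> \<eta> t = helix \<rho> t" by blast
  have "helix \<rho> = helix \<xi>"
  proof (rule helix_eq_extend[OF t0(1)])
    fix t assume t: "t \<in> {0..t0}"
    show "helix \<rho> t = helix \<xi> t" using \<rho>[of t] start[of t] t t0 P by simp
  qed
  then have eq: "\<eta> t = helix \<xi> t" if "t \<in> {0..T}" for t using \<rho>[OF that] by simp
  have "helix (helix_flow \<xi> t0) t = helix \<zeta> t" if t: "t \<in> {0..P}" for t
  proof -
    have "pg_mult (helix \<xi> t0) (helix (helix_flow \<xi> t0) t) = pg_mult (helix \<xi> t0) (helix \<zeta> t)"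
      using eq[of "t0 + t"] helix_add[of t \<xi> t0] t t0 P by (simp add: \<eta>_def)
    then show ?thesis by (simp add: pg_mult_cancel)
  qed
  from helix_control_eq[OF P(1) this, of 0] P(1)
  have "u0 = - u0" by (simp add: fl \<zeta>_def helix_control_def)
  then show False using t0(3) u0(1) by simp
qed

lemma cut_time_cong:
  assumes "\<And>t. 0 \<le> t \<Longrightarrow> \<gamma> t = \<gamma>' t"
  shows "cut_time \<gamma> = cut_time \<gamma>'"
proof -
  have "{t. 0 < t \<and> minimizing 0 t \<gamma>} = {t. 0 < t \<and> minimizing 0 t \<gamma>'}"
    using minimizing_cong[of 0 _ \<gamma> \<gamma>'] minimizing_cong[of 0 _ \<gamma>' \<gamma>] assms by auto
  then show ?thesis by (simp add: cut_time_def)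
qed

lemma cut_time_helix:
  assumes u: "unit_covector \<xi>"
  shows "cut_time (helix \<xi>) = (if straight \<xi> then \<infinity> else ereal (2 * pi / norm (snd (snd \<xi>))))"
proof (cases "straight \<xi>")
  case True
  obtain a0 a p where \<xi>: "\<xi> = (a0, a, p)" by (cases \<xi>)
  have h0: "hel_x 0 0 w t = 0" "hel_i1 0 0 w t = 0" "hel_i2 0 0 w t = 0" for w t
    by (simp_all add: hel_x_def hel_i1_def hel_i2_def)
  \<comment> \<open>A straight curve is also the helix with vertical covector 0, whose calibration
    is valid for all times.\<close>
  have "helix \<xi> = helix (a0, a, 0)"
    using True by (auto simp: straight_def \<xi> fun_eq_iff helix_def Let_def h0)
  moreover have "minimizing 0 t (helix (a0, a, 0))" if "0 < t" for t
    by (rule minimizing_helix[OF _ that]) (use u in \<open>auto simp: \<xi> unit_covector_def\<close>)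
  ultimately have "{t. 0 < t \<and> minimizing 0 t (helix \<xi>)} = {0<..}" by auto
  moreover have "Sup (ereal ` {0<..}) = \<infinity>"
  proof (rule Sup_eqI)
    fix y :: ereal assume y: "\<And>z. z \<in> ereal ` {0<..} \<Longrightarrow> z \<le> y"
    have "ereal (real n) \<le> y" for n
    proof -
      have "ereal (real n) \<le> ereal (real n + 1)" by simp
      also have "\<dots> \<le> y" by (rule y) (simp add: add_nonneg_pos)
      finally show ?thesis .
    qed
    then show "\<infinity> \<le> y" by (metis ereal_less_eq(1) ereal_top ereal_infty_less_eq(1) ereal_le_real order_trans real_arch_simple ereal_less_eq(3))
  qed simp
  ultimately show ?thesis using True by (simp add: cut_time_def)
next
  case False
  define P where "P = 2 * pi / norm (snd (snd \<xi>))"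
  have p: "snd (snd \<xi>) \<noteq> 0" using False by (auto simp: straight_def)
  then have P: "P > 0" by (simp add: P_def)
  have "{t. 0 < t \<and> minimizing 0 t (helix \<xi>)} = {0<..P}"
  proof (intro equalityI subsetI)
    fix t assume "t \<in> {t. 0 < t \<and> minimizing 0 t (helix \<xi>)}"
    then show "t \<in> {0<..P}" using not_minimizing_after_period[OF u False, of t] by (force simp: P_def)
  next
    fix t assume "t \<in> {0<..P}"
    then show "t \<in> {t. 0 < t \<and> minimizing 0 t (helix \<xi>)}"
      using minimizing_helix[OF u, of t] p by (simp add: P_def field_simps)
  qed
  moreover have "Sup (ereal ` {0<..P}) = ereal P"
    by (rule Sup_eqI) (use P in auto)
  ultimately show ?thesis using False by (simp add: cut_time_def P_def)
qed

lemma geodesic_helix: "unit_covector \<xi> \<Longrightarrow> geodesic (helix \<xi>)"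
  by (simp add: geodesic_def geodesic_on_helix)

lemma geodesic_cut_time:
  assumes "geodesic \<gamma>" "cut_time \<gamma> = ereal T"
  shows "\<exists>\<xi>. unit_covector \<xi> \<and> \<not> straight \<xi> \<and> T = 2 * pi / norm (snd (snd \<xi>)) \<and> (\<forall>t\<ge>0. \<gamma> t = helix \<xi> t)"
proof -
  obtain \<xi> where \<xi>: "unit_covector \<xi>" "\<And>t. t \<ge> 0 \<Longrightarrow> \<gamma> t = helix \<xi> t" using geodesic_imp_helix[OF assms(1)] by blast
  have "cut_time (helix \<xi>) = ereal T" using assms(2) cut_time_cong[of \<gamma> "helix \<xi>", OF \<xi>(2)] by simp
  then have "\<not> straight \<xi> \<and> T = 2 * pi / norm (snd (snd \<xi>))"
    using cut_time_helix[OF \<xi>(1)] by (auto split: if_splits)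
  then show ?thesis using \<xi> by (intro exI[of _ \<xi>]) simp
qed

lemma cut_locus_eq:
  "cut_locus = {helix \<xi> (2 * pi / norm (snd (snd \<xi>))) | \<xi>. unit_covector \<xi> \<and> \<not> straight \<xi>}"
proof (intro equalityI subsetI)
  fix q :: "'a pgroup" assume "q \<in> cut_locus"
  then obtain \<gamma> T where "q = \<gamma> T" "geodesic \<gamma>" "cut_time \<gamma> = ereal T" by (auto simp: cut_locus_def)
  then show "q \<in> {helix \<xi> (2 * pi / norm (snd (snd \<xi>))) | \<xi>. unit_covector \<xi> \<and> \<not> straight \<xi>}"
    using geodesic_cut_time[of \<gamma> T] by fastforce
next
  fix q :: "'a pgroup" assume "q \<in> {helix \<xi> (2 * pi / norm (snd (snd \<xi>))) | \<xi>. unit_covector \<xi> \<and> \<not> straight \<xi>}"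
  then show "q \<in> cut_locus"
    using geodesic_helix cut_time_helix unfolding cut_locus_def by fastforce
qed

section \<open>The exponential map\<close>

lemma hamiltonian_eq:
  "hamiltonian ((x, l, y), (\<alpha>, \<beta>, p)) = ((\<alpha> + (p \<bullet> l) / 2)\<^sup>2 + (\<beta> - (x / 2) *\<^sub>R p) \<bullet> (\<beta> - (x / 2) *\<^sub>R p)) / 2"
proof -
  have "(\<beta> - (x / 2) *\<^sub>R p) \<bullet> (\<beta> - (x / 2) *\<^sub>R p) = (\<Sum>i\<in>UNIV. (\<beta> $ i - (x / 2) * p $ i)\<^sup>2)"
    unfolding inner_vec_def by (simp add: power2_eq_square)
  moreover have "(\<Sum>a\<in>UNIV. ((\<alpha>, \<beta>, p) \<bullet> frame a (x, l, y))\<^sup>2)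
      = (\<alpha> + (p \<bullet> l) / 2)\<^sup>2 + (\<Sum>i\<in>UNIV. (\<beta> $ i - (x / 2) * p $ i)\<^sup>2)"
    by (simp add: UNIV_option_conv sum.reindex inner_axis)
  ultimately show ?thesis by simp
qed

lemma hamiltonian_0: "hamiltonian (0, \<xi>) = 1 / 2 \<longleftrightarrow> unit_covector \<xi>"
  by (cases \<xi>) (auto simp add: zero_prod_def hamiltonian_eq unit_covector_def power2_norm_eq_inner simp del: hamiltonian.simps)

text \<open>The momenta along the frame fields; by Hamilton's equations they are the control of the
  projected curve.\<close>

definition ham_control :: "'n::finite pgroup \<times> 'n pgroup \<Rightarrow> real \<times> (real ^ 'n)" where
  "ham_control c = (fst (snd c) + (snd (snd (snd c)) \<bullet> fst (snd (fst c))) / 2,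
     fst (snd (snd c)) - (fst (fst c) / 2) *\<^sub>R snd (snd (snd c)))"

definition ham_field :: "'n::finite pgroup \<times> 'n pgroup \<Rightarrow> 'n pgroup \<times> 'n pgroup" where
  "ham_field c = (hlift (fst c) (ham_control c),
     (snd (snd (snd c)) \<bullet> snd (ham_control c) / 2, - (fst (ham_control c) / 2) *\<^sub>R snd (snd (snd c)), 0))"

lemma hamiltonian_has_derivative:
  fixes c :: "'n::finite pgroup \<times> 'n pgroup"
  shows "(hamiltonian has_derivative (\<lambda>(u, \<mu>). fst (ham_field c) \<bullet> \<mu> - snd (ham_field c) \<bullet> u)) (at c)"
proof -
  have eq: "hamiltonian = (\<lambda>c :: 'n pgroup \<times> 'n pgroup.
      ((fst (ham_control c))\<^sup>2 + snd (ham_control c) \<bullet> snd (ham_control c)) / 2)"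
  proof
    fix c :: "'n pgroup \<times> 'n pgroup"
    obtain x l y \<alpha> \<beta> p where c: "c = ((x, l, y), (\<alpha>, \<beta>, p))" by (metis prod.collapse)
    show "hamiltonian c = ((fst (ham_control c))\<^sup>2 + snd (ham_control c) \<bullet> snd (ham_control c)) / 2"
      unfolding c hamiltonian_eq by (simp add: ham_control_def)
  qed
  obtain x l y \<alpha> \<beta> p where c: "c = ((x, l, y), (\<alpha>, \<beta>, p))" by (metis prod.collapse)
  define U u where Uu: "U = \<alpha> + (p \<bullet> l) / 2" "u = \<beta> - (x / 2) *\<^sub>R p"
  have "(hamiltonian has_derivative (\<lambda>h. U * (fst (snd h) + (p \<bullet> fst (snd (fst h)) + snd (snd (snd h)) \<bullet> l) / 2)
      + u \<bullet> (fst (snd (snd h)) - ((x / 2) *\<^sub>R snd (snd (snd h)) + (fst (fst h) / 2) *\<^sub>R p)))) (at c)"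
    unfolding eq ham_control_def fst_conv snd_conv Uu
    by (auto intro!: derivative_eq_intros simp: c fun_eq_iff inner_commute field_simps)
  also have "(\<lambda>h. U * (fst (snd h) + (p \<bullet> fst (snd (fst h)) + snd (snd (snd h)) \<bullet> l) / 2)
      + u \<bullet> (fst (snd (snd h)) - ((x / 2) *\<^sub>R snd (snd (snd h)) + (fst (fst h) / 2) *\<^sub>R p)))
      = (\<lambda>(u, \<mu>). fst (ham_field c) \<bullet> \<mu> - snd (ham_field c) \<bullet> u)"
  proof -
    have cu: "ham_control c = (U, u)" by (simp add: ham_control_def c Uu)
    show ?thesis
      unfolding ham_field_def cu fun_eq_iff by (auto simp: c hlift_def inner_simps inner_commute field_simps)
  qed
  finally show ?thesis .
qed

lemma hamiltonian_curve_iff: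
  fixes c :: "real \<Rightarrow> 'n::finite pgroup \<times> 'n pgroup"
  shows "hamiltonian_curve c \<longleftrightarrow> (\<forall>t. (c has_vector_derivative ham_field (c t)) (at t))"
proof
  assume h: "hamiltonian_curve c"
  show "\<forall>t. (c has_vector_derivative ham_field (c t)) (at t)"
  proof
    fix t
    obtain dq d\<xi> where D: "(c has_vector_derivative (dq, d\<xi>)) (at t)"
      and H: "(hamiltonian has_derivative (\<lambda>(u, \<mu>). dq \<bullet> \<mu> - d\<xi> \<bullet> u)) (at (c t))"
      using h unfolding hamiltonian_curve_def by blast
    have eq: "(\<lambda>(u, \<mu>). dq \<bullet> \<mu> - d\<xi> \<bullet> u) = (\<lambda>(u, \<mu>). fst (ham_field (c t)) \<bullet> \<mu> - snd (ham_field (c t)) \<bullet> u)"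
      by (rule has_derivative_unique[OF H hamiltonian_has_derivative])
    have "dq \<bullet> \<mu> = fst (ham_field (c t)) \<bullet> \<mu>" for \<mu> using fun_cong[OF eq, of "(0, \<mu>)"] by simp
    then have 1: "dq = fst (ham_field (c t))" by (metis vector_eq_rdot)
    have "d\<xi> \<bullet> u = snd (ham_field (c t)) \<bullet> u" for u using fun_cong[OF eq, of "(u, 0)"] by simp
    then have 2: "d\<xi> = snd (ham_field (c t))" by (metis vector_eq_rdot)
    show "(c has_vector_derivative ham_field (c t)) (at t)" using D 1 2 by simp
  qed
next
  assume D: "\<forall>t. (c has_vector_derivative ham_field (c t)) (at t)"
  show "hamiltonian_curve c"
    unfolding hamiltonian_curve_def
  proof
    fix t
    show "\<exists>dq d\<xi>. (c has_vector_derivative (dq, d\<xi>)) (at t) \<and>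
        (hamiltonian has_derivative (\<lambda>(u, \<mu>). dq \<bullet> \<mu> - d\<xi> \<bullet> u)) (at (c t))"
      using D hamiltonian_has_derivative[of "c t"]
      by (intro exI[of _ "fst (ham_field (c t))"] exI[of _ "snd (ham_field (c t))"]) simp
  qed
qed

lemma helix_control_deriv:
  assumes "\<xi> = (a0, a, p)"
  shows "((\<lambda>t. fst (helix_control \<xi> t)) has_real_derivative p \<bullet> snd (helix_control \<xi> t)) (at t)"
    and "((\<lambda>t. snd (helix_control \<xi> t)) has_vector_derivative - fst (helix_control \<xi> t) *\<^sub>R p) (at t)"
proof -
  have e: "p \<bullet> (a - x *\<^sub>R p) = a \<bullet> p - (norm p)\<^sup>2 * x" for x
    by (simp add: inner_simps inner_commute power2_norm_eq_inner)
  show "((\<lambda>t. fst (helix_control \<xi> t)) has_real_derivative p \<bullet> snd (helix_control \<xi> t)) (at t)"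
    using hel_u_deriv[of a0 "a \<bullet> p" "norm p" t UNIV] by (simp add: helix_control_def assms e)
  show "((\<lambda>t. snd (helix_control \<xi> t)) has_vector_derivative - fst (helix_control \<xi> t) *\<^sub>R p) (at t)"
    by (auto intro!: derivative_eq_intros hel_x_deriv simp: helix_control_def assms)
qed

lemma hamiltonian_curve_helix:
  "\<exists>c. hamiltonian_curve c \<and> c 0 = (0, \<xi>) \<and> fst (c 1) = helix \<xi> 1"
proof -
  obtain a0 a p where \<xi>: "\<xi> = (a0, a, p)" by (cases \<xi>)
  define U u x l where defs: "U t = fst (helix_control \<xi> t)" "u t = snd (helix_control \<xi> t)"
    "x t = fst (helix \<xi> t)" "l t = fst (snd (helix \<xi> t))" for t
  \<comment> \<open>The coordinate momenta are recovered from the frame momenta by removing the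
    vertical components of the frame fields, paired with the constant \<open>p\<close>.\<close>
  define c where "c t = (helix \<xi> t, (U t - (p \<bullet> l t) / 2, u t + (x t / 2) *\<^sub>R p, p))" for t
  have DH: "(helix \<xi> has_vector_derivative hlift (helix \<xi> t) (U t, u t)) (at t)" for t
    using helix_has_vector_derivative[of \<xi> t UNIV] by (simp add: defs)
  have DU: "(U has_real_derivative p \<bullet> u t) (at t)" and Du: "(u has_vector_derivative - U t *\<^sub>R p) (at t)" for t
    using helix_control_deriv[OF \<xi>, of t] by (simp_all add: defs[abs_def])
  have Dx: "(x has_real_derivative U t) (at t)" and Dl: "(l has_vector_derivative u t) (at t)" for t
    using bounded_linear.has_vector_derivative[OF bounded_linear_fst DH[of t]]
      bounded_linear.has_vector_derivative[OF bounded_linear_fst_comp[OF bounded_linear_snd] DH[of t]]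
    by (simp_all add: hlift_def defs(3,4)[abs_def] has_real_derivative_iff_has_vector_derivative)
  have ctl: "ham_control (c t) = (U t, u t)" for t
    by (simp add: ham_control_def c_def defs)
  have "(c has_vector_derivative ham_field (c t)) (at t)" for t
  proof -
    have 1: "((\<lambda>t. U t - (p \<bullet> l t) / 2) has_vector_derivative p \<bullet> u t / 2) (at t)"
      unfolding has_real_derivative_iff_has_vector_derivative[symmetric]
    proof -
      have "((\<lambda>t. p \<bullet> l t) has_real_derivative p \<bullet> u t) (at t)"
        using bounded_linear.has_vector_derivative[OF bounded_linear_inner_right[of p] Dl[of t]]
        by (simp add: has_real_derivative_iff_has_vector_derivative)
      from DERIV_diff[OF DU[of t] DERIV_cdivide[OF this, of 2]]
      show "((\<lambda>t. U t - (p \<bullet> l t) / 2) has_real_derivative p \<bullet> u t / 2) (at t)" by simp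
    qed
    have 2: "((\<lambda>t. u t + (x t / 2) *\<^sub>R p) has_vector_derivative - (U t / 2) *\<^sub>R p) (at t)"
    proof -
      have "((\<lambda>t. u t + (x t / 2) *\<^sub>R p) has_vector_derivative - U t *\<^sub>R p + (U t / 2) *\<^sub>R p) (at t)"
        by (auto intro!: derivative_eq_intros Du Dx)
      moreover have "- U t *\<^sub>R p + (U t / 2) *\<^sub>R p = - (U t / 2) *\<^sub>R p"
        unfolding scaleR_add_left[symmetric] by simp
      ultimately show ?thesis by (simp only:)
    qed
    have "(c has_vector_derivative (hlift (helix \<xi> t) (U t, u t), (p \<bullet> u t / 2, - (U t / 2) *\<^sub>R p, 0))) (at t)"
      unfolding c_def[abs_def] by (intro has_vector_derivative_Pair DH 1 2 has_vector_derivative_const)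
    moreover have "fst (c t) = helix \<xi> t" "snd (snd (snd (c t))) = p" by (simp_all add: c_def)
    ultimately show ?thesis unfolding ham_field_def ctl by simp
  qed
  moreover have "c 0 = (0, \<xi>)"
    by (simp add: c_def defs \<xi> helix_control_def zero_prod_def)
  moreover have "fst (c 1) = helix \<xi> 1" by (simp add: c_def)
  ultimately show ?thesis unfolding hamiltonian_curve_iff by blast
qed

lemma has_vector_derivative_zero_eq:
  fixes f :: "real \<Rightarrow> 'a::real_normed_vector"
  assumes "\<And>t. (f has_vector_derivative 0) (at t)"
  shows "f t = f 0"
proof -
  have "\<exists>c. \<forall>t\<in>UNIV. f t = c"
    by (rule has_derivative_zero_constant)
      (use assms in \<open>auto simp: has_vector_derivative_def\<close>)
  then show ?thesis by auto
qed

text \<open>Once \<open>p\<close> is known to be conserved, the frame momenta obey a linear system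
  with a skew matrix. The squared distance between two solutions is therefore constant, which gives
  uniqueness without a Gronwall estimate.\<close>

lemma hamiltonian_curve_unique:
  fixes c :: "real \<Rightarrow> 'n::finite pgroup \<times> 'n pgroup"
  assumes c: "hamiltonian_curve c" and 0: "c 0 = (0, \<xi>)"
  shows "fst (c t) = helix \<xi> t"
proof -
  obtain a0 a p where \<xi>: "\<xi> = (a0, a, p)" by (cases \<xi>)
  have D: "(c has_vector_derivative ham_field (c t)) (at t)" for t using c by (simp add: hamiltonian_curve_iff)
  define U u where Uu: "U t = fst (ham_control (c t))" "u t = snd (ham_control (c t))" for t
  have bl: "bounded_linear (\<lambda>c :: 'n pgroup \<times> 'n pgroup. snd (snd (snd c)))"
    "bounded_linear (\<lambda>c :: 'n pgroup \<times> 'n pgroup. fst (fst c))"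
    "bounded_linear (\<lambda>c :: 'n pgroup \<times> 'n pgroup. fst (snd (fst c)))"
    "bounded_linear (\<lambda>c :: 'n pgroup \<times> 'n pgroup. fst (snd c))"
    "bounded_linear (\<lambda>c :: 'n pgroup \<times> 'n pgroup. fst (snd (snd c)))"
    by (intro bounded_linear_fst_comp bounded_linear_snd_comp bounded_linear_fst bounded_linear_snd bounded_linear_ident)+
  have pc: "snd (snd (snd (c t))) = p" for t
  proof -
    have "((\<lambda>t. snd (snd (snd (c t)))) has_vector_derivative 0) (at t)" for t
      using bounded_linear.has_vector_derivative[OF bl(1) D[of t]] by (simp add: ham_field_def)
    from has_vector_derivative_zero_eq[OF this, of t] show ?thesis by (simp add: 0 \<xi>)
  qed
  have Dx: "((\<lambda>t. fst (fst (c t))) has_real_derivative U t) (at t)"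
    and Dl: "((\<lambda>t. fst (snd (fst (c t)))) has_vector_derivative u t) (at t)"
    and D\<alpha>: "((\<lambda>t. fst (snd (c t))) has_real_derivative p \<bullet> u t / 2) (at t)"
    and D\<beta>: "((\<lambda>t. fst (snd (snd (c t)))) has_vector_derivative - (U t / 2) *\<^sub>R p) (at t)" for t
    using bounded_linear.has_vector_derivative[OF bl(2) D[of t]] bounded_linear.has_vector_derivative[OF bl(3) D[of t]]
      bounded_linear.has_vector_derivative[OF bl(4) D[of t]] bounded_linear.has_vector_derivative[OF bl(5) D[of t]]
    by (simp_all add: ham_field_def hlift_def Uu pc has_real_derivative_iff_has_vector_derivative)
  have Ueq: "U t = fst (snd (c t)) + (p \<bullet> fst (snd (fst (c t)))) / 2" for t
    by (simp add: Uu ham_control_def pc)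
  have ueq: "u t = fst (snd (snd (c t))) - (fst (fst (c t)) / 2) *\<^sub>R p" for t
    by (simp add: Uu ham_control_def pc)
  have DU: "(U has_real_derivative p \<bullet> u t) (at t)" for t
  proof -
    have "((\<lambda>t. p \<bullet> fst (snd (fst (c t)))) has_real_derivative p \<bullet> u t) (at t)"
      using bounded_linear.has_vector_derivative[OF bounded_linear_inner_right[of p] Dl[of t]]
      by (simp add: has_real_derivative_iff_has_vector_derivative)
    from DERIV_add[OF D\<alpha>[of t] DERIV_cdivide[OF this, of 2]] show ?thesis by (simp add: Ueq[abs_def])
  qed
  have Du: "(u has_vector_derivative - U t *\<^sub>R p) (at t)" for t
  proof -
    have "((\<lambda>t. fst (snd (snd (c t))) - (fst (fst (c t)) / 2) *\<^sub>R p) has_vector_derivative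
      - (U t / 2) *\<^sub>R p - (U t / 2) *\<^sub>R p) (at t)"
      by (auto intro!: derivative_eq_intros D\<beta> Dx)
    moreover have "- (U t / 2) *\<^sub>R p - (U t / 2) *\<^sub>R p = - U t *\<^sub>R p"
      unfolding scaleR_diff_left[symmetric] by simp
    ultimately show ?thesis by (simp only: ueq[abs_def])
  qed
  define V v where Vv: "V t = fst (helix_control \<xi> t)" "v t = snd (helix_control \<xi> t)" for t
  have DV: "(V has_real_derivative p \<bullet> v t) (at t)" and Dv: "(v has_vector_derivative - V t *\<^sub>R p) (at t)" for t
    using helix_control_deriv[OF \<xi>, of t] by (simp_all add: Vv[abs_def])
  \<comment> \<open>The squared distance of the frame momenta from those of the helix: the two cross
    terms of its derivative cancel, and it is 0 at time 0.\<close>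
  define e where "e t = (U t - V t)\<^sup>2 + (u t - v t) \<bullet> (u t - v t)" for t
  have "(e has_vector_derivative 0) (at t)" for t
  proof -
    define d where "d t = u t - v t" for t
    have dd: "(d has_vector_derivative - (U t - V t) *\<^sub>R p) (at t)"
      unfolding d_def[abs_def] using has_vector_derivative_diff[OF Du[of t] Dv[of t]] by (simp add: algebra_simps)
    have 1: "((\<lambda>t. d t \<bullet> d t) has_real_derivative - 2 * (U t - V t) * (p \<bullet> d t)) (at t)"
      unfolding has_field_derivative_def
      by (rule has_derivative_eq_rhs[OF has_derivative_inner[OF dd[unfolded has_vector_derivative_def]
          dd[unfolded has_vector_derivative_def]]]) (simp add: fun_eq_iff inner_commute)
    have 2: "((\<lambda>t. (U t - V t)\<^sup>2) has_real_derivative 2 * (U t - V t) * (p \<bullet> d t)) (at t)"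
      by (auto intro!: derivative_eq_intros DU DV simp: d_def inner_diff_right algebra_simps)
    have "((\<lambda>t. (U t - V t)\<^sup>2 + d t \<bullet> d t) has_real_derivative 0) (at t)"
      by (rule DERIV_cong[OF DERIV_add[OF 2 1]]) (simp add: algebra_simps)
    then show ?thesis
      unfolding e_def[abs_def] d_def[symmetric] has_real_derivative_iff_has_vector_derivative .
  qed
  from has_vector_derivative_zero_eq[OF this]
  have "e t = 0" for t
    by (simp add: e_def Uu Vv ham_control_def 0 \<xi> helix_control_def)
  then have UV: "U t = V t" "u t = v t" for t
    by (auto simp: e_def add_nonneg_eq_0_iff)
  have ctl: "ham_control (c t) = helix_control \<xi> t" for t
    using UV[of t] by (simp add: prod_eq_iff Uu Vv)
  have Dq: "((\<lambda>t. fst (c t)) has_vector_derivative hlift (fst (c t)) (helix_control \<xi> t)) (at t)" for t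
    using bounded_linear.has_vector_derivative[OF bounded_linear_fst D[of t]]
    by (simp add: ham_field_def ctl)
  have hp: "hproj (fst (c t)) = hproj (helix \<xi> t)" for t
  proof -
    have b: "bounded_linear hproj" using linear_hproj linear_conv_bounded_linear by blast
    have "((\<lambda>t. hproj (fst (c t)) - hproj (helix \<xi> t)) has_vector_derivative 0) (at t)" for t
      using has_vector_derivative_diff[OF bounded_linear.has_vector_derivative[OF b Dq[of t]]
          bounded_linear.has_vector_derivative[OF b helix_has_vector_derivative[of \<xi> t UNIV]]] by simp
    from has_vector_derivative_zero_eq[OF this, of t] show ?thesis by (simp add: 0)
  qed
  have "((\<lambda>t. fst (c t) - helix \<xi> t) has_vector_derivative 0) (at t)" for t
  proof -
    have "hlift (fst (c t)) w = hlift (helix \<xi> t) w" for w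
      using hp[of t] by (simp add: hlift_def hproj_def)
    then show ?thesis
      using has_vector_derivative_diff[OF Dq[of t] helix_has_vector_derivative[of \<xi> t UNIV]] by simp
  qed
  from has_vector_derivative_zero_eq[OF this, of t] show ?thesis by (simp add: 0)
qed

lemma sr_exp_eq: "sr_exp \<xi> = helix \<xi> 1"
  unfolding sr_exp_def
  by (rule the_equality) (metis hamiltonian_curve_helix, metis hamiltonian_curve_unique)

lemma sr_exp_scale: "0 < t \<Longrightarrow> sr_exp (t *\<^sub>R \<xi>) = helix \<xi> t"
  by (simp add: sr_exp_eq helix_scale)

section \<open>Conjugate points\<close>

text \<open>Variations of the functions \<^const>\<open>hel_x\<close>, \<^const>\<open>hel_u\<close>, \<^const>\<open>hel_i1\<close>, \<^const>\<open>hel_i2\<close>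
  with respect to their first three arguments in the direction \<^term>\<open>(a', b', w')\<close>.\<close>

definition hel_dx :: "real \<Rightarrow> real \<Rightarrow> real \<Rightarrow> real \<Rightarrow> real \<Rightarrow> real \<Rightarrow> real \<Rightarrow> real" where
  "hel_dx a b w a' b' w' t = a' * sin (w * t) / w + b' * (1 - cos (w * t)) / w\<^sup>2
     + w' * (a * (t * cos (w * t) / w - sin (w * t) / w\<^sup>2) + b * (t * sin (w * t) / w\<^sup>2 - 2 * (1 - cos (w * t)) / w ^ 3))"

definition hel_du :: "real \<Rightarrow> real \<Rightarrow> real \<Rightarrow> real \<Rightarrow> real \<Rightarrow> real \<Rightarrow> real \<Rightarrow> real" where
  "hel_du a b w a' b' w' t = a' * cos (w * t) + b' * sin (w * t) / w
     + w' * (- a * t * sin (w * t) + b * (t * cos (w * t) / w - sin (w * t) / w\<^sup>2))"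

definition hel_di :: "real \<Rightarrow> real \<Rightarrow> real \<Rightarrow> real \<Rightarrow> real \<Rightarrow> real \<Rightarrow> real \<Rightarrow> real" where
  "hel_di a b w a' b' w' t = a' * (1 - cos (w * t)) / w\<^sup>2 + b' * (t - sin (w * t) / w) / w\<^sup>2
     + w' * (a * (t * sin (w * t) / w\<^sup>2 - 2 * (1 - cos (w * t)) / w ^ 3)
       + b * ((sin (w * t) / w\<^sup>2 - t * cos (w * t) / w) / w\<^sup>2 - 2 * (t - sin (w * t) / w) / w ^ 3))"

definition hel_dj :: "real \<Rightarrow> real \<Rightarrow> real \<Rightarrow> real \<Rightarrow> real \<Rightarrow> real \<Rightarrow> real \<Rightarrow> real" where
  "hel_dj a b w a' b' w' t = (2 * a * a' * t + 3 * b' * hel_i1 a b w t + 3 * b * hel_di a b w a' b' w' t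
     - hel_dx a b w a' b' w' t * hel_u a b w t - hel_x a b w t * hel_du a b w a' b' w' t) / (2 * w\<^sup>2)
     - 2 * hel_i2 a b w t * w' / w"

context
  fixes A B N :: "'a::real_normed_vector \<Rightarrow> real" and A' B' N' :: "'a \<Rightarrow> real" and z :: 'a
  assumes A: "(A has_derivative A') (at z)" and B: "(B has_derivative B') (at z)"
    and N: "(N has_derivative N') (at z)" and N0: "N z \<noteq> 0"
begin

text \<open>Near \<open>z\<close> the frequency stays nonzero, so the case distinctions in the helix
  functions can be replaced by their generic branches before differentiating.\<close>

lemma eventually_N_nonzero: "\<forall>\<^sub>F y in at z. N y \<noteq> 0"
proof -
  have "(N \<longlongrightarrow> N z) (at z)" using has_derivative_continuous[OF N] by (simp add: isCont_def)
  then show ?thesis using N0 by (rule tendsto_imp_eventually_ne)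
qed

lemma hel_x_has_derivative:
  "((\<lambda>y. hel_x (A y) (B y) (N y) t) has_derivative (\<lambda>h. hel_dx (A z) (B z) (N z) (A' h) (B' h) (N' h) t)) (at z)"
proof -
  have "((\<lambda>y. A y * sin (N y * t) / N y + B y * (1 - cos (N y * t)) / (N y)\<^sup>2) has_derivative
     (\<lambda>h. hel_dx (A z) (B z) (N z) (A' h) (B' h) (N' h) t)) (at z)"
    by (rule has_derivative_eq_rhs, (rule derivative_intros A B N N0 power_not_zero | simp add: N0)+,
      simp add: fun_eq_iff hel_dx_def N0 field_simps eval_nat_numeral)
  then show ?thesis
    by (rule has_derivative_transform_eventually)
      (use eventually_N_nonzero N0 in \<open>auto elim!: eventually_mono simp: hel_x_def\<close>)
qed

lemma hel_u_has_derivative: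
  "((\<lambda>y. hel_u (A y) (B y) (N y) t) has_derivative (\<lambda>h. hel_du (A z) (B z) (N z) (A' h) (B' h) (N' h) t)) (at z)"
proof -
  have "((\<lambda>y. A y * cos (N y * t) + B y * sin (N y * t) / N y) has_derivative
     (\<lambda>h. hel_du (A z) (B z) (N z) (A' h) (B' h) (N' h) t)) (at z)"
    by (rule has_derivative_eq_rhs, (rule derivative_intros A B N N0 power_not_zero | simp add: N0)+,
      simp add: fun_eq_iff hel_du_def N0 field_simps eval_nat_numeral)
  then show ?thesis
    by (rule has_derivative_transform_eventually)
      (use eventually_N_nonzero N0 in \<open>auto elim!: eventually_mono simp: hel_u_def\<close>)
qed

lemma hel_i1_has_derivative:
  "((\<lambda>y. hel_i1 (A y) (B y) (N y) t) has_derivative (\<lambda>h. hel_di (A z) (B z) (N z) (A' h) (B' h) (N' h) t)) (at z)"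
proof -
  have "((\<lambda>y. A y * (1 - cos (N y * t)) / (N y)\<^sup>2 + B y * (t - sin (N y * t) / N y) / (N y)\<^sup>2) has_derivative
     (\<lambda>h. hel_di (A z) (B z) (N z) (A' h) (B' h) (N' h) t)) (at z)"
    by (rule has_derivative_eq_rhs, (rule derivative_intros A B N N0 power_not_zero | simp add: N0)+,
      simp add: fun_eq_iff hel_di_def N0 field_simps eval_nat_numeral)
  then show ?thesis
    by (rule has_derivative_transform_eventually)
      (use eventually_N_nonzero N0 in \<open>auto elim!: eventually_mono simp: hel_i1_def\<close>)
qed

lemma hel_i2_has_derivative:
  "((\<lambda>y. hel_i2 (A y) (B y) (N y) t) has_derivative (\<lambda>h. hel_dj (A z) (B z) (N z) (A' h) (B' h) (N' h) t)) (at z)"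
proof -
  define I X U where IXU: "I y = hel_i1 (A y) (B y) (N y) t" "X y = hel_x (A y) (B y) (N y) t" "U y = hel_u (A y) (B y) (N y) t" for y
  note D = hel_i1_has_derivative[of t, folded IXU] hel_x_has_derivative[of t, folded IXU] hel_u_has_derivative[of t, folded IXU]
  have j: "hel_i2 (A y) (B y) (N y) t = ((A y)\<^sup>2 * t + 3 * B y * I y - X y * U y) / (2 * (N y)\<^sup>2)" if "N y \<noteq> 0" for y
    using that by (simp add: hel_i2_def IXU)
  have "((\<lambda>y. ((A y)\<^sup>2 * t + 3 * B y * I y - X y * U y) / (2 * (N y)\<^sup>2)) has_derivative
     (\<lambda>h. hel_dj (A z) (B z) (N z) (A' h) (B' h) (N' h) t)) (at z)"
    by (rule has_derivative_eq_rhs, (rule derivative_intros A B N D N0 power_not_zero | simp add: N0)+,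
      simp add: fun_eq_iff hel_dj_def N0 j[OF N0] IXU[symmetric] field_simps eval_nat_numeral)
  then show ?thesis
    by (rule has_derivative_transform_eventually)
      (use eventually_N_nonzero N0 in \<open>auto elim!: eventually_mono simp: j\<close>)
qed

end

lemma hel_d0 [simp]: "hel_dx a b w a' b' w' 0 = 0" "hel_di a b w a' b' w' 0 = 0" "hel_dj a b w a' b' w' 0 = 0"
  by (simp_all add: hel_dx_def hel_di_def hel_dj_def)

lemma hel_du_eq:
  assumes "w \<noteq> 0"
  shows "hel_du a b w a' b' w' t = a' + b' * t - 2 * w * w' * hel_i1 a b w t - w\<^sup>2 * hel_di a b w a' b' w' t"
  using assms by (simp add: hel_du_def hel_i1_def hel_di_def divide_simps eval_nat_numeral) (simp add: algebra_simps)

lemma hel_dx_deriv: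
  assumes "w \<noteq> 0"
  shows "((\<lambda>t. hel_dx a b w a' b' w' t) has_real_derivative hel_du a b w a' b' w' t) (at t)"
  unfolding hel_dx_def
  using assms by (auto intro!: derivative_eq_intros simp: hel_du_def field_simps eval_nat_numeral)

lemma hel_di_deriv:
  assumes "w \<noteq> 0"
  shows "((\<lambda>t. hel_di a b w a' b' w' t) has_real_derivative hel_dx a b w a' b' w' t) (at t)"
  unfolding hel_di_def
  using assms by (auto intro!: derivative_eq_intros simp: hel_dx_def field_simps eval_nat_numeral)

lemma hel_du_deriv:
  assumes "w \<noteq> 0"
  shows "((\<lambda>t. hel_du a b w a' b' w' t) has_real_derivative
    b' - 2 * w * w' * hel_x a b w t - w\<^sup>2 * hel_dx a b w a' b' w' t) (at t)"
  unfolding hel_du_eq[OF assms]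
  by (auto intro!: derivative_eq_intros hel_i1_deriv hel_di_deriv[OF assms])

text \<open>The conserved energy is differentiated at s = 0 along the affine family of parameters (a
  + s a', b + s b', w + s w').\<close>

lemma hel_energy_variation:
  fixes a b w a' b' w' t :: real
  assumes w: "w \<noteq> 0"
  defines "x \<equiv> hel_x a b w t" and "u \<equiv> hel_u a b w t"
    and "dx \<equiv> hel_dx a b w a' b' w' t" and "du \<equiv> hel_du a b w a' b' w' t"
  shows "u * du + w * w' * x\<^sup>2 + w\<^sup>2 * x * dx - b' * x - b * dx = a * a'"
proof -
  define A B N where ABN: "A s = a + s * a'" "B s = b + s * b'" "N s = w + s * w'" for s
  have lin: "(A has_derivative (\<lambda>h. h * a')) (at 0)" "(B has_derivative (\<lambda>h. h * b')) (at 0)"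
    "(N has_derivative (\<lambda>h. h * w')) (at 0)"
    unfolding ABN[abs_def] by (auto intro!: derivative_eq_intros)
  have N0: "N 0 \<noteq> 0" using w by (simp add: ABN)
  have scale: "hel_dx a b w (h * a') (h * b') (h * w') t = dx * h" "hel_du a b w (h * a') (h * b') (h * w') t = du * h" for h
    by (simp_all add: hel_dx_def hel_du_def dx_def du_def algebra_simps add_divide_distrib diff_divide_distrib)
  have DX: "((\<lambda>s. hel_x (A s) (B s) (N s) t) has_real_derivative dx) (at 0)"
    using hel_x_has_derivative[OF lin N0, of t] by (simp add: has_field_derivative_def scale ABN mult_commute_abs)
  have DU: "((\<lambda>s. hel_u (A s) (B s) (N s) t) has_real_derivative du) (at 0)"
    using hel_u_has_derivative[OF lin N0, of t] by (simp add: has_field_derivative_def scale ABN mult_commute_abs)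
  have DABN: "(A has_real_derivative a') (at 0)" "(B has_real_derivative b') (at 0)" "(N has_real_derivative w') (at 0)"
    unfolding ABN[abs_def] by (auto intro!: derivative_eq_intros)
  define X U where XU: "X s = hel_x (A s) (B s) (N s) t" "U s = hel_u (A s) (B s) (N s) t" for s
  have v: "X 0 = x" "U 0 = u" "A 0 = a" "B 0 = b" "N 0 = w" by (simp_all add: XU ABN x_def u_def)
  have "((\<lambda>s. (U s)\<^sup>2 + (N s)\<^sup>2 * (X s)\<^sup>2 - 2 * B s * X s)
     has_real_derivative (2 * u * du + (2 * w * w' * x\<^sup>2 + w\<^sup>2 * (2 * x * dx)) - (2 * b' * x + 2 * b * dx))) (at 0)"
    using DX DU unfolding XU[symmetric]
    by (auto intro!: derivative_eq_intros DABN simp: v algebra_simps)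
  then have "((\<lambda>s. (A s)\<^sup>2) has_real_derivative (2 * u * du + (2 * w * w' * x\<^sup>2 + w\<^sup>2 * (2 * x * dx)) - (2 * b' * x + 2 * b * dx))) (at 0)"
    by (simp only: XU hel_energy)
  moreover have "((\<lambda>s. (A s)\<^sup>2) has_real_derivative 2 * a * a') (at 0)"
    by (auto intro!: derivative_eq_intros DABN simp: ABN)
  ultimately have "2 * u * du + (2 * w * w' * x\<^sup>2 + w\<^sup>2 * (2 * x * dx)) - (2 * b' * x + 2 * b * dx) = 2 * a * a'"
    by (rule DERIV_unique)
  then show ?thesis by (simp add: algebra_simps)
qed

lemma hel_dj_deriv:
  assumes w: "w \<noteq> 0"
  shows "((\<lambda>t. hel_dj a b w a' b' w' t) has_real_derivative 2 * hel_x a b w t * hel_dx a b w a' b' w' t) (at t)"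
proof -
  define x u dx du where d: "x = hel_x a b w t" "u = hel_u a b w t"
    "dx = hel_dx a b w a' b' w' t" "du = hel_du a b w a' b' w' t"
  have "((\<lambda>t. hel_dj a b w a' b' w' t) has_real_derivative
    (2 * a * a' + 3 * b' * x + 3 * b * dx - (du * u + dx * (b - w\<^sup>2 * x)) - (u * du + x * (b' - 2 * w * w' * x - w\<^sup>2 * dx))) / (2 * w\<^sup>2)
     - 2 * x\<^sup>2 * w' / w) (at t)"
    unfolding hel_dj_def d
    by (auto intro!: derivative_eq_intros hel_i1_deriv hel_i2_deriv hel_x_deriv hel_u_deriv
        hel_di_deriv[OF w] hel_dx_deriv[OF w] hel_du_deriv[OF w] simp: w eval_nat_numeral field_simps)
  also have "2 * a * a' + 3 * b' * x + 3 * b * dx - (du * u + dx * (b - w\<^sup>2 * x)) - (u * du + x * (b' - 2 * w * w' * x - w\<^sup>2 * dx))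
     = 4 * w * w' * x\<^sup>2 + 4 * w\<^sup>2 * x * dx"
    using hel_energy_variation[OF w, of a b t a' b' w'] unfolding d[symmetric] by (simp add: power2_eq_square algebra_simps)
  also have "(4 * w * w' * x\<^sup>2 + 4 * w\<^sup>2 * x * dx) / (2 * w\<^sup>2) - 2 * x\<^sup>2 * w' / w = 2 * x * dx"
    using w by (simp add: power2_eq_square field_simps)
  finally show ?thesis by (simp add: d)
qed

text \<open>The differential of the helix with respect to its covector, a Jacobi field as a function
  of t; b' and w' are the variations of a.p and |p|.\<close>

definition helix_var :: "'n::finite pgroup \<Rightarrow> 'n pgroup \<Rightarrow> real \<Rightarrow> 'n pgroup" where
  "helix_var \<xi> \<zeta> t = (let a0 = fst \<xi>; a = fst (snd \<xi>); p = snd (snd \<xi>);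
     a0' = fst \<zeta>; a' = fst (snd \<zeta>); p' = snd (snd \<zeta>);
     b = a \<bullet> p; w = norm p; b' = a' \<bullet> p + a \<bullet> p'; w' = p' \<bullet> sgn p;
     x = hel_x a0 b w t; i = hel_i1 a0 b w t; l = t *\<^sub>R a - i *\<^sub>R p;
     dx = hel_dx a0 b w a0' b' w' t; di = hel_di a0 b w a0' b' w' t; dj = hel_dj a0 b w a0' b' w' t;
     dl = t *\<^sub>R a' - (i *\<^sub>R p' + di *\<^sub>R p)
     in (dx, dl, ((x / 2) *\<^sub>R dl + (dx / 2) *\<^sub>R l) - (i *\<^sub>R a' + di *\<^sub>R a) + (hel_i2 a0 b w t *\<^sub>R p' + dj *\<^sub>R p)))"

lemma helix_has_derivative:
  fixes \<xi> :: "'n::finite pgroup"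
  assumes p: "snd (snd \<xi>) \<noteq> 0"
  shows "((\<lambda>\<xi>. helix \<xi> t) has_derivative (\<lambda>\<zeta>. helix_var \<xi> \<zeta> t)) (at \<xi>)"
proof -
  define A B N where ABN: "A \<xi> = fst \<xi>" "B \<xi> = fst (snd \<xi>) \<bullet> snd (snd \<xi>)" "N \<xi> = norm (snd (snd \<xi>))" for \<xi> :: "'n pgroup"
  define B' N' where BN': "B' \<zeta> = fst (snd \<zeta>) \<bullet> snd (snd \<xi>) + fst (snd \<xi>) \<bullet> snd (snd \<zeta>)"
    "N' \<zeta> = snd (snd \<zeta>) \<bullet> sgn (snd (snd \<xi>))" for \<zeta> :: "'n pgroup"
  have DA: "(A has_derivative fst) (at \<xi>)" unfolding ABN[abs_def] by (auto intro!: derivative_eq_intros)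
  have DB: "(B has_derivative B') (at \<xi>)" unfolding ABN[abs_def] BN'[abs_def] by (auto intro!: derivative_eq_intros)
  have DN: "(N has_derivative N') (at \<xi>)"
  proof -
    have "((\<lambda>\<xi> :: 'n pgroup. snd (snd \<xi>)) has_derivative (\<lambda>\<zeta>. snd (snd \<zeta>))) (at \<xi>)"
      by (auto intro!: derivative_eq_intros)
    from has_derivative_compose[OF this has_derivative_norm[OF p]]
    show ?thesis unfolding ABN[abs_def] BN'[abs_def] .
  qed
  have N0: "N \<xi> \<noteq> 0" using p by (simp add: ABN)
  define X I J where XIJ: "X \<xi> = hel_x (A \<xi>) (B \<xi>) (N \<xi>) t" "I \<xi> = hel_i1 (A \<xi>) (B \<xi>) (N \<xi>) t"
    "J \<xi> = hel_i2 (A \<xi>) (B \<xi>) (N \<xi>) t" for \<xi> :: "'n pgroup"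
  define X' I' J' where XIJ': "X' \<zeta> = hel_dx (A \<xi>) (B \<xi>) (N \<xi>) (fst \<zeta>) (B' \<zeta>) (N' \<zeta>) t"
    "I' \<zeta> = hel_di (A \<xi>) (B \<xi>) (N \<xi>) (fst \<zeta>) (B' \<zeta>) (N' \<zeta>) t"
    "J' \<zeta> = hel_dj (A \<xi>) (B \<xi>) (N \<xi>) (fst \<zeta>) (B' \<zeta>) (N' \<zeta>) t" for \<zeta> :: "'n pgroup"
  have D: "(X has_derivative X') (at \<xi>)" "(I has_derivative I') (at \<xi>)" "(J has_derivative J') (at \<xi>)"
    unfolding XIJ[abs_def] XIJ'[abs_def]
    by (rule hel_x_has_derivative[OF DA DB DN N0] hel_i1_has_derivative[OF DA DB DN N0]
        hel_i2_has_derivative[OF DA DB DN N0])+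
  have L: "((\<lambda>\<xi>. t *\<^sub>R fst (snd \<xi>) - I \<xi> *\<^sub>R snd (snd \<xi>)) has_derivative
     (\<lambda>\<zeta>. t *\<^sub>R fst (snd \<zeta>) - (I \<xi> *\<^sub>R snd (snd \<zeta>) + I' \<zeta> *\<^sub>R snd (snd \<xi>)))) (at \<xi>)"
    by (auto intro!: derivative_eq_intros D)
  have V: "((\<lambda>\<xi>. J \<xi> *\<^sub>R snd (snd \<xi>) - I \<xi> *\<^sub>R fst (snd \<xi>)) has_derivative
     (\<lambda>\<zeta>. (J \<xi> *\<^sub>R snd (snd \<zeta>) + J' \<zeta> *\<^sub>R snd (snd \<xi>)) - (I \<xi> *\<^sub>R fst (snd \<zeta>) + I' \<zeta> *\<^sub>R fst (snd \<xi>)))) (at \<xi>)"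
    by (auto intro!: derivative_eq_intros D)
  have X2: "((\<lambda>\<xi>. X \<xi> / 2) has_derivative (\<lambda>\<zeta>. X' \<zeta> / 2)) (at \<xi>)"
    by (auto intro!: derivative_eq_intros D)
  have eq: "(\<lambda>\<xi>. helix \<xi> t) = (\<lambda>\<xi>. (X \<xi>, t *\<^sub>R fst (snd \<xi>) - I \<xi> *\<^sub>R snd (snd \<xi>),
     (X \<xi> / 2) *\<^sub>R (t *\<^sub>R fst (snd \<xi>) - I \<xi> *\<^sub>R snd (snd \<xi>)) + (J \<xi> *\<^sub>R snd (snd \<xi>) - I \<xi> *\<^sub>R fst (snd \<xi>))))"
    by (simp add: fun_eq_iff helix_def Let_def ABN XIJ)
  show ?thesis unfolding eq
    by (rule has_derivative_eq_rhs[OF has_derivative_Pair[OF D(1) has_derivative_Pair[OF L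
            has_derivative_add[OF has_derivative_scaleR[OF X2 L] V]]]])
      (simp add: fun_eq_iff helix_var_def Let_def ABN BN' XIJ XIJ')
qed

text \<open>Domain and codomain have equal finite dimension, so the differential fails to be onto
  exactly if a nontrivial Jacobi field vanishes at time 1.\<close>

lemma critical_point_iff:
  assumes p: "snd (snd \<xi>) \<noteq> 0"
  shows "critical_point sr_exp \<xi> \<longleftrightarrow> (\<exists>\<zeta>. \<zeta> \<noteq> 0 \<and> helix_var \<xi> \<zeta> 1 = 0)"
proof -
  have D: "(sr_exp has_derivative (\<lambda>\<zeta>. helix_var \<xi> \<zeta> 1)) (at \<xi>)"
    using helix_has_derivative[OF p, of 1] by (simp add: sr_exp_eq[abs_def])
  then have lin: "linear (\<lambda>\<zeta>. helix_var \<xi> \<zeta> 1)" by (rule has_derivative_linear)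
  have "critical_point sr_exp \<xi> \<longleftrightarrow> \<not> surj (\<lambda>\<zeta>. helix_var \<xi> \<zeta> 1)"
    unfolding critical_point_def using D has_derivative_unique by blast
  also have "\<dots> \<longleftrightarrow> \<not> inj (\<lambda>\<zeta>. helix_var \<xi> \<zeta> 1)"
    using lin linear_injective_imp_surjective linear_surjective_imp_injective by blast
  also have "\<dots> \<longleftrightarrow> (\<exists>\<zeta>. \<zeta> \<noteq> 0 \<and> helix_var \<xi> \<zeta> 1 = 0)"
    using linear_injective_0[OF lin] by auto
  finally show ?thesis .
qed

section \<open>No conjugate points before the end of the period\<close>

text \<open>In the plane of rotation, the end point is linear in the initial momenta, with
  determinant proportional to (sin w)^2 + (1 - cos w)^2 = 2 (1 - cos w), positive for 0 < w < 2 pi.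
  This is the uniqueness counterpart of \<open>shoot_end\<close>.\<close>

lemma helix_hproj_eq_0:
  assumes p: "p \<noteq> 0" "norm p < 2 * pi" and 0: "hproj (helix (c0, c, p) 1) = 0"
  shows "c0 = 0 \<and> c = 0"
proof -
  define w b where wb: "w = norm p" "b = c \<bullet> p"
  define r where "r = b / w"
  have w: "w > 0" using p by (simp add: wb)
  define S C where SC: "S = sin w" "C = cos w"
  have pos: "1 - C > 0" using one_minus_cos_pos[of w] w p by (simp add: SC wb)
  have X: "hel_x c0 b w 1 = 0" and L: "c - hel_i1 c0 b w 1 *\<^sub>R p = 0"
    using 0 by (simp_all add: hproj_def helix_def Let_def wb zero_prod_def)
  have "p \<bullet> (c - hel_i1 c0 b w 1 *\<^sub>R p) = hel_u c0 b w 1 - c0"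
    by (simp add: inner_simps hel_u_eq power2_norm_eq_inner wb inner_commute[of p c])
  then have U: "hel_u c0 b w 1 = c0" using L by simp
  have 1: "c0 * S + r * (1 - C) = 0" using X w by (simp add: hel_x_def SC r_def power2_eq_square field_simps)
  have 2: "r * S - c0 * (1 - C) = 0" using U w by (simp add: hel_u_def SC r_def algebra_simps)
  have "(c0\<^sup>2 + r\<^sup>2) * (1 - C) = r * (c0 * S + r * (1 - C)) - c0 * (r * S - c0 * (1 - C))"
    by (simp add: power2_eq_square algebra_simps)
  then have "(c0\<^sup>2 + r\<^sup>2) * (1 - C) = 0" using 1 2 by simp
  then have "c0\<^sup>2 + r\<^sup>2 = 0" using pos by simp
  then have z: "c0 = 0" "b = 0" using w by (auto simp: add_nonneg_eq_0_iff r_def)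
  have "hel_i1 0 0 w 1 = 0" by (simp add: hel_i1_def)
  then show ?thesis using L z by simp
qed

lemma continuous_eq_0_closed_interval:
  fixes f :: "real \<Rightarrow> 'a::real_normed_vector"
  assumes "continuous_on {a..b} f" "\<And>t. a < t \<Longrightarrow> t < b \<Longrightarrow> f t = 0" "a < b" "t \<in> {a..b}"
  shows "f t = 0"
proof -
  have cl: "closure {a<..<b} = {a..b}" using assms(3) by simp
  show ?thesis
    by (rule continuous_constant_on_closure[of "{a<..<b}" f 0 t]) (use assms in \<open>simp_all only: cl greaterThanLessThan_iff\<close>)
qed

text \<open>A Jacobi field vanishing at both ends: the calibration that proves minimality, applied to the
  field instead of the curve, forces it to solve the flow of \<^const>\<open>half_grad\<close>.\<close>

lemma helix_var_inj:
  fixes \<xi> \<zeta> :: "'n::finite pgroup"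
  assumes p: "snd (snd \<xi>) \<noteq> 0" "norm (snd (snd \<xi>)) < 2 * pi" and ns: "\<not> straight \<xi>"
    and var: "helix_var \<xi> \<zeta> 1 = 0"
  shows "\<zeta> = 0"
proof -
  obtain a0 a q where \<xi>: "\<xi> = (a0, a, q)" by (cases \<xi>)
  obtain a0' a' q' where \<zeta>: "\<zeta> = (a0', a', q')" by (cases \<zeta>)
  define w b w' b' where wb: "w = norm q" "b = a \<bullet> q" "w' = q' \<bullet> sgn q" "b' = a' \<bullet> q + a \<bullet> q'"
  have w: "w \<noteq> 0" "0 < w" "w < 2 * pi" using p by (simp_all add: wb \<xi>)
  have ww: "w * w' = q \<bullet> q'" using w by (simp add: wb sgn_div_norm inner_commute)
  have qq: "q \<bullet> q = w\<^sup>2" by (simp add: wb power2_norm_eq_inner)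
  \<comment> \<open>(f, g) is the planar part of the Jacobi field and d the derivative of f. V is
    the vertical part after removal of the terms that vanish together with f and g.\<close>
  define x U i f d di V where defs: "x = hel_x a0 b w" "U = hel_u a0 b w" "i = hel_i1 a0 b w"
    "f = hel_dx a0 b w a0' b' w'" "d = hel_du a0 b w a0' b' w'" "di = hel_di a0 b w a0' b' w'"
    "V = (\<lambda>t. (hel_i2 a0 b w t *\<^sub>R q' + hel_dj a0 b w a0' b' w' t *\<^sub>R q) - (i t *\<^sub>R a' + di t *\<^sub>R a))"
  define l where "l t = t *\<^sub>R a - i t *\<^sub>R q" for t
  define g where "g t = t *\<^sub>R a' - (i t *\<^sub>R q' + di t *\<^sub>R q)" for t
  define g' where "g' t = a' - (x t *\<^sub>R q' + f t *\<^sub>R q)" for t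
  have end1: "f 1 = 0" "g 1 = 0"
    using var by (simp_all add: helix_var_def \<xi> \<zeta> Let_def zero_prod_def defs g_def wb)
  have endV: "V 1 = 0"
  proof -
    have "snd (snd (helix_var \<xi> \<zeta> 1)) = ((x 1 / 2) *\<^sub>R g 1 + (f 1 / 2) *\<^sub>R l 1) + V 1"
      by (simp add: helix_var_def \<xi> \<zeta> Let_def defs g_def l_def wb algebra_simps)
    then show ?thesis using var end1 by (simp add: zero_prod_def)
  qed
  have start: "f 0 = 0" "g 0 = 0" "V 0 = 0" "x 0 = 0" "i 0 = 0" by (simp_all add: defs g_def)
  have Dx: "(x has_real_derivative U t) (at t)" and Di: "(i has_real_derivative x t) (at t)"
    and Df: "(f has_real_derivative d t) (at t)" and Ddi: "(di has_real_derivative f t) (at t)" for t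
    unfolding defs by (rule hel_x_deriv hel_i1_deriv hel_dx_deriv[OF w(1)] hel_di_deriv[OF w(1)])+
  have Dl: "(l has_vector_derivative a - x t *\<^sub>R q) (at t)" for t
    unfolding l_def[abs_def] by (auto intro!: derivative_eq_intros Di)
  have Dg: "(g has_vector_derivative g' t) (at t)" for t
    unfolding g_def[abs_def] g'_def by (auto intro!: derivative_eq_intros Di Ddi)
  have DV: "(V has_vector_derivative - f t *\<^sub>R (a - x t *\<^sub>R q) - x t *\<^sub>R g' t) (at t)" for t
  proof -
    have "(V has_vector_derivative ((x t)\<^sup>2 *\<^sub>R q' + (2 * x t * f t) *\<^sub>R q) - (x t *\<^sub>R a' + f t *\<^sub>R a)) (at t)"
      unfolding defs(7) using hel_i2_deriv[of a0 b w t UNIV] hel_dj_deriv[OF w(1), of a0 b a0' b' w' t]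
      by (auto intro!: derivative_eq_intros Di Ddi simp: defs(1,4))
    also have "((x t)\<^sup>2 *\<^sub>R q' + (2 * x t * f t) *\<^sub>R q) - (x t *\<^sub>R a' + f t *\<^sub>R a) = - f t *\<^sub>R (a - x t *\<^sub>R q) - x t *\<^sub>R g' t"
    proof -
      have "(2 * x t * f t) *\<^sub>R q = (x t * f t) *\<^sub>R q + (x t * f t) *\<^sub>R q"
        by (simp flip: scaleR_add_left)
      then show ?thesis by (simp add: g'_def power2_eq_square algebra_simps)
    qed
    finally show ?thesis .
  qed
  \<comment> \<open>A and B are the inhomogeneous terms of the linearized equations d = A + q.g and
    g' = B - f q. They would be constant if the vertical covector were not varied.\<close>
  define A where "A t = a0' + q' \<bullet> l t" for t
  define B where "B t = a' - x t *\<^sub>R q'" for t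
  have d: "d t = A t + q \<bullet> g t" for t
  proof -
    have "d t = a0' + b' * t - 2 * (q \<bullet> q') * i t - w\<^sup>2 * di t"
      using hel_du_eq[OF w(1), of a0 b a0' b' w' t] unfolding defs ww[symmetric] by (simp add: mult_ac)
    then show ?thesis unfolding A_def l_def g_def
      by (simp add: inner_simps qq wb(4) inner_commute[of q' a] inner_commute[of q a'] inner_commute[of q' q] algebra_simps)
  qed
  have g'B: "g' t = B t - f t *\<^sub>R q" for t by (simp add: g'_def B_def)
  have cont: "continuous_on S x" "continuous_on S f" "continuous_on S d" "continuous_on S g" "continuous_on S l" for S
  proof -
    show 1: "continuous_on S x" "continuous_on S f"
      by (rule DERIV_continuous_on, rule has_field_derivative_at_within, rule Dx)
        (rule DERIV_continuous_on, rule has_field_derivative_at_within, rule Df)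
    show 2: "continuous_on S g" "continuous_on S l"
      by (rule continuous_on_vector_derivative, rule has_vector_derivative_at_within, rule Dg)
        (rule continuous_on_vector_derivative, rule has_vector_derivative_at_within, rule Dl)
    show "continuous_on S d" unfolding d A_def by (intro continuous_intros 2)
  qed
  have contg': "continuous_on S g'" for S unfolding g'_def by (intro continuous_intros cont)
  \<comment> \<open>A vertical coordinate that makes (f, g, Y) a horizontal curve, so that the
    formula for the derivative of W applies to the field itself. The wider interval makes the
    derivative two-sided at time 1.\<close>
  obtain Y where Y: "\<And>t. t \<in> {-1..2} \<Longrightarrow> (Y has_vector_derivative (1/2) *\<^sub>R (d t *\<^sub>R g t - f t *\<^sub>R g' t)) (at t within {-1..2})"
    by (rule antiderivative_continuous[where a = "-1" and b = 2 and f = "\<lambda>t. (1/2) *\<^sub>R (d t *\<^sub>R g t - f t *\<^sub>R g' t)"])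
      (intro continuous_intros cont contg', blast)
  have DY: "(Y has_vector_derivative (1/2) *\<^sub>R (d t *\<^sub>R g t - f t *\<^sub>R g' t)) (at t)" if "0 < t" "t \<le> 1" for t
    using Y[of t] at_within_interior[of t "{-1..2}"] that by (simp add: interior_atLeastAtMost_real)
  define c where "c t = (f t, g t, Y t)" for t
  have Dc: "(c has_vector_derivative hlift (c t) (d t, g' t)) (at t)" if "0 < t" "t \<le> 1" for t
  proof -
    have "(c has_vector_derivative (d t, g' t, (1/2) *\<^sub>R (d t *\<^sub>R g t - f t *\<^sub>R g' t))) (at t)"
      unfolding c_def[abs_def] using Df[of t] Dg[of t] DY[OF that]
      by (intro has_vector_derivative_Pair) (simp_all add: has_real_derivative_iff_has_vector_derivative)
    then show ?thesis by (simp add: hlift_def c_def)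
  qed
  \<comment> \<open>The first two terms pair the field with A and B; the other two cancel the
    derivatives of A and B. So the derivative of Z is the pairing of the velocity with (A, B), and Z
    vanishes at both ends.\<close>
  define Z where "Z t = f t * A t + g t \<bullet> B t + q' \<bullet> V t + x t * (q' \<bullet> g t)" for t
  have DZ: "(Z has_real_derivative d t * A t + g' t \<bullet> B t) (at t)" for t
  proof -
    have "((\<lambda>t. q' \<bullet> l t) has_vector_derivative q' \<bullet> (a - x t *\<^sub>R q)) (at t)"
      by (rule bounded_linear.has_vector_derivative[OF bounded_linear_inner_right Dl])
    then have DA: "(A has_real_derivative q' \<bullet> (a - x t *\<^sub>R q)) (at t)"
      unfolding A_def[abs_def] has_real_derivative_iff_has_vector_derivative
      by (auto intro!: derivative_eq_intros)
    have DB: "(B has_vector_derivative - U t *\<^sub>R q') (at t)"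
      unfolding B_def[abs_def] by (auto intro!: derivative_eq_intros Dx)
    have DgB: "((\<lambda>t. g t \<bullet> B t) has_real_derivative g t \<bullet> (- U t *\<^sub>R q') + g' t \<bullet> B t) (at t)"
      unfolding has_field_derivative_def
      by (rule has_derivative_eq_rhs[OF has_derivative_inner[OF Dg[unfolded has_vector_derivative_def]
            DB[unfolded has_vector_derivative_def]]]) (simp add: fun_eq_iff algebra_simps)
    have DqV: "((\<lambda>t. q' \<bullet> V t) has_real_derivative q' \<bullet> (- f t *\<^sub>R (a - x t *\<^sub>R q) - x t *\<^sub>R g' t)) (at t)"
      unfolding has_real_derivative_iff_has_vector_derivative
      by (rule bounded_linear.has_vector_derivative[OF bounded_linear_inner_right DV])
    have Dqg: "((\<lambda>t. q' \<bullet> g t) has_real_derivative q' \<bullet> g' t) (at t)"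
      unfolding has_real_derivative_iff_has_vector_derivative
      by (rule bounded_linear.has_vector_derivative[OF bounded_linear_inner_right Dg])
    show ?thesis
      unfolding Z_def[abs_def]
      by (rule DERIV_cong[OF DERIV_add[OF DERIV_add[OF DERIV_add[OF DERIV_mult[OF Df DA] DgB] DqV] DERIV_mult[OF Dx Dqg]]])
        (simp add: inner_diff_right inner_commute[of q' "g t"] algebra_simps)
  qed
  \<comment> \<open>Subtracting the contributions of Y and Z removes the squared speed from the
    derivative of W; only the negative square remains.\<close>
  define \<Psi> where "\<Psi> t = hj q t (c t) - 2 * (q \<bullet> Y t) - Z t" for t
  have D\<Psi>: "(\<Psi> has_real_derivative - (norm ((d t, g' t) - half_grad q t (c t)))\<^sup>2) (at t)" if t: "0 < t" "t \<le> 1" for t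
  proof -
    have "w * t \<le> w * 1" using t w by (intro mult_left_mono) auto
    then have "w * t < 2 * pi" using w(3) by linarith
    then have 1: "((\<lambda>t. hj q t (c t)) has_real_derivative (norm (d t, g' t))\<^sup>2 - (norm ((d t, g' t) - half_grad q t (c t)))\<^sup>2) (at t)"
      using hj_vector_derivative[OF Dc[OF t] t(1), of q] by (simp add: wb)
    have 2: "((\<lambda>t. 2 * (q \<bullet> Y t)) has_real_derivative 2 * (q \<bullet> ((1/2) *\<^sub>R (d t *\<^sub>R g t - f t *\<^sub>R g' t)))) (at t)"
      by (rule DERIV_cmult) (use bounded_linear.has_vector_derivative[OF bounded_linear_inner_right DY[OF t]]
          in \<open>simp only: has_real_derivative_iff_has_vector_derivative\<close>)
    have 3: "(norm (d t, g' t))\<^sup>2 = d t * (A t + q \<bullet> g t) + g' t \<bullet> (B t - f t *\<^sub>R q)"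
      unfolding d[symmetric] g'B[symmetric] by (simp add: norm_Pair dot_square_norm power2_eq_square[of "d t"])
    have 4: "2 * (q \<bullet> ((1/2) *\<^sub>R (d t *\<^sub>R g t - f t *\<^sub>R g' t))) = d t * (q \<bullet> g t) - f t * (q \<bullet> g' t)"
      by (simp add: inner_diff_right)
    show ?thesis
      unfolding \<Psi>_def[abs_def]
      by (rule DERIV_cong[OF DERIV_diff[OF DERIV_diff[OF 1 2] DZ]])
        (simp add: 3 4 inner_diff_right inner_commute[of q "g' t"] algebra_simps)
  qed
  have mono: "\<Psi> t \<le> \<Psi> s" if st: "0 < s" "s \<le> t" "t \<le> 1" for s t
  proof (rule DERIV_nonpos_imp_nonincreasing[OF st(2)])
    fix r assume "s \<le> r" "r \<le> t"
    then show "\<exists>y. (\<Psi> has_real_derivative y) (at r) \<and> y \<le> 0"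
      using st by (intro exI[of _ "- (norm ((d r, g' r) - half_grad q r (c r)))\<^sup>2"] conjI D\<Psi>) auto
  qed
  have \<Psi>1: "\<Psi> 1 = 0" by (simp add: \<Psi>_def c_def Z_def end1 endV hj_def)
  have \<Psi>le: "\<Psi> t \<le> (f t * f t + g t \<bullet> g t) / t - Z t" if t: "0 < t" "t \<le> 1" for t
  proof -
    have "w * t \<le> w * 1" using t w by (intro mult_left_mono) auto
    then have "w * t < 2 * pi" using w(3) by linarith
    then have "hj q t (f t, g t, 0) \<le> (norm (hproj (f t, g t, 0 :: real ^ 'n)))\<^sup>2 / t"
      using hj_le[of t q "(f t, g t, 0)"] t by (simp add: wb)
    moreover have "(norm (hproj (f t, g t, 0 :: real ^ 'n)))\<^sup>2 = f t * f t + g t \<bullet> g t"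
      by (simp add: hproj_def norm_Pair power2_norm_eq_inner) (simp add: power2_eq_square)
    ultimately show ?thesis by (simp add: \<Psi>_def c_def hj_def)
  qed
  \<comment> \<open>The field starts at 0 with finite velocity, so its square divided by t tends to
    0. This bounds \<Psi> from above as \<open>hj_le\<close> does for curves.\<close>
  have lim: "((\<lambda>t. (f t * f t + g t \<bullet> g t) / t - Z t) \<longlongrightarrow> 0) (at_right 0)"
  proof -
    have "((\<lambda>t. g t \<bullet> g t) has_real_derivative 0) (at 0)"
      unfolding has_field_derivative_def
      by (rule has_derivative_eq_rhs[OF has_derivative_inner[OF Dg[of 0, unfolded has_vector_derivative_def]
            Dg[of 0, unfolded has_vector_derivative_def]]]) (simp add: fun_eq_iff start)
    from DERIV_add[OF DERIV_mult[OF Df[of 0] Df[of 0]] this]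
    have "((\<lambda>t. f t * f t + g t \<bullet> g t) has_real_derivative 0) (at 0)" by (simp add: start)
    then have "((\<lambda>t. (f t * f t + g t \<bullet> g t) / t) \<longlongrightarrow> 0) (at 0)"
      by (simp add: has_field_derivative_iff start)
    moreover have "(Z \<longlongrightarrow> Z 0) (at 0)" using DERIV_isCont[OF DZ[of 0]] by (simp add: isCont_def)
    ultimately have "((\<lambda>t. (f t * f t + g t \<bullet> g t) / t - Z t) \<longlongrightarrow> 0 - Z 0) (at 0)" by (rule tendsto_diff)
    moreover have "Z 0 = 0" by (simp add: Z_def start)
    ultimately show ?thesis by (simp add: filterlim_at_split)
  qed
  have \<Psi>0: "\<Psi> t = 0" if t: "0 < t" "t < 1" for t
  proof (rule antisym)
    have "\<forall>\<^sub>F s in at_right 0. \<Psi> t \<le> (f s * f s + g s \<bullet> g s) / s - Z s"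
      unfolding eventually_at_right[OF t(1)]
    proof (intro exI[of _ t] conjI allI impI t(1))
      fix s assume s: "0 < s" "s < t"
      have "\<Psi> t \<le> \<Psi> s" using mono[of s t] s t by simp
      also have "\<dots> \<le> (f s * f s + g s \<bullet> g s) / s - Z s" using \<Psi>le[of s] s t by simp
      finally show "\<Psi> t \<le> (f s * f s + g s \<bullet> g s) / s - Z s" .
    qed
    then show "\<Psi> t \<le> 0" using tendsto_lowerbound[OF lim] by simp
    show "0 \<le> \<Psi> t" using mono[of t 1] t \<Psi>1 by simp
  qed
  have hg: "(d t, g' t) = half_grad q t (c t)" if t: "0 < t" "t < 1" for t
  proof -
    have "(\<Psi> has_real_derivative 0) (at t)"
      by (rule has_field_derivative_transform_within_open[of "\<lambda>_. 0" _ _ "{0<..<1}"]) (use t \<Psi>0 in auto)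
    then have "0 = - (norm ((d t, g' t) - half_grad q t (c t)))\<^sup>2"
      by (rule DERIV_unique[OF _ D\<Psi>]) (use t in auto)
    then show ?thesis by simp
  qed
  have Dh: "((\<lambda>t. hproj (c t)) has_vector_derivative half_grad q t (c t)) (at t)" if t: "0 < t" "t < 1" for t
  proof -
    have "((\<lambda>t. (f t, g t)) has_vector_derivative (d t, g' t)) (at t)" using Df[of t] Dg[of t]
      by (intro has_vector_derivative_Pair) (simp_all add: has_real_derivative_iff_has_vector_derivative)
    then show ?thesis unfolding hg[OF t, symmetric] by (simp add: c_def hproj_def)
  qed
  obtain c0 k where ck: "\<And>t. 0 < t \<Longrightarrow> t < 1 \<Longrightarrow> hproj (c t) = hproj (helix (c0, k, q) t)"
    using half_grad_flow[of 1 q c, OF _ _ Dh] w by (auto simp: wb)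
  have bl: "bounded_linear hproj" using linear_hproj linear_conv_bounded_linear by blast
  have ch: "continuous_on {0..1} (\<lambda>t. hproj (helix (c0, k, q) t))"
    by (intro continuous_on_compose2[OF linear_continuous_on[OF bl, of UNIV]]
        continuous_on_vector_derivative[OF helix_has_vector_derivative]) auto
  have fg: "continuous_on {0..1} (\<lambda>t. (f t, g t) - hproj (helix (c0, k, q) t))"
    by (intro continuous_intros cont ch)
  have "(f 1, g 1) - hproj (helix (c0, k, q) 1) = 0"
  proof (rule continuous_eq_0_closed_interval[OF fg])
    fix t :: real assume "0 < t" "t < 1"
    from ck[OF this] show "(f t, g t) - hproj (helix (c0, k, q) t) = 0"
      unfolding c_def by (simp add: hproj_def[of "(f t, g t, Y t)"])
  qed auto
  then have h1: "hproj (helix (c0, k, q) 1) = 0" unfolding end1 by (simp add: zero_prod_def[symmetric])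
  have "q \<noteq> 0" "norm q < 2 * pi" using w by (simp_all add: wb)
  from helix_hproj_eq_0[OF this h1] have "c0 = 0" "k = 0" by simp_all
  then have fg0: "f t = 0 \<and> g t = 0" if "0 < t" "t < 1" for t
    using ck[OF that] by (simp add: helix_trivial c_def hproj_def zero_prod_def)
  have A0: "A t = 0" if t: "0 < t" "t < 1" for t
  proof -
    have "(f has_real_derivative 0) (at t)"
      by (rule has_field_derivative_transform_within_open[of "\<lambda>_. 0" _ _ "{0<..<1}"]) (use t fg0 in auto)
    then have "d t = 0" using Df DERIV_unique by blast
    then show ?thesis using d[of t] fg0[OF t] by simp
  qed
  have B0: "B t = 0" if t: "0 < t" "t < 1" for t
  proof -
    have "(g has_vector_derivative 0) (at t)"
      by (rule has_vector_derivative_transform_within_open[of "\<lambda>_. 0" _ _ "{0<..<1}"]) (use t fg0 in auto)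
    then have "g' t = 0" using Dg vector_derivative_unique_at by blast
    then show ?thesis using g'B[of t] fg0[OF t] by simp
  qed
  have cA: "continuous_on {0..1} A" and cB: "continuous_on {0..1} B"
    unfolding A_def[abs_def] B_def[abs_def] by (intro continuous_intros cont)+
  have "A 0 = 0"
    by (rule continuous_eq_0_closed_interval[OF cA]) (use A0 in auto)
  then have 1: "a0' = 0" by (simp add: A_def l_def start)
  have "B 0 = 0"
    by (rule continuous_eq_0_closed_interval[OF cB]) (use B0 in auto)
  then have 2: "a' = 0" by (simp add: B_def start)
  \<comment> \<open>Once the horizontal variation is 0, the term B is - x q'. If q' were nonzero,
    the oscillator would be at rest and the helix straight.\<close>
  have 3: "q' = 0"
  proof (rule ccontr)
    assume "q' \<noteq> 0"
    then have x0: "x t = 0" if "0 < t" "t < 1" for t using B0[OF that] 2 by (simp add: B_def)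
    have "U t = 0" if t: "t \<in> {0<..<1}" for t
    proof -
      have "(x has_real_derivative 0) (at t)"
        by (rule has_field_derivative_transform_within_open[of "\<lambda>_. 0" _ _ "{0<..<1}"]) (use t x0 in auto)
      then show ?thesis using Dx DERIV_unique by blast
    qed
    then have "a0 = 0 \<and> b = 0" using hel_u_zero[of 1 a0 b w] by (simp add: defs)
    then show False using ns by (simp add: straight_def \<xi> wb)
  qed
  show ?thesis using 1 2 3 by (simp add: \<zeta> zero_prod_def)
qed

text \<open>Covectors in adapted coordinates: \<^term>\<open>w\<close> is the frequency of the helix, \<^term>\<open>e\<close> the
  unit vector spanning with $X_0$ its plane of rotation, and \<^term>\<open>v\<close> the translational part.\<close>

definition covec :: "real \<Rightarrow> real \<Rightarrow> real ^ 'n::finite \<Rightarrow> real ^ 'n \<Rightarrow> real \<Rightarrow> 'n pgroup" where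
  "covec \<alpha> \<beta> v e w = (\<alpha>, v + \<beta> *\<^sub>R e, w *\<^sub>R e)"

definition adapted :: "real ^ 'n::finite \<Rightarrow> real ^ 'n \<Rightarrow> real \<Rightarrow> bool" where
  "adapted v e w \<longleftrightarrow> norm e = 1 \<and> v \<bullet> e = 0 \<and> 0 < w"

lemma adaptedD:
  assumes "adapted v e w"
  shows "e \<bullet> e = 1" "v \<bullet> e = 0" "e \<bullet> v = 0" "0 < w" "e \<noteq> 0" "norm (w *\<^sub>R e) = w" "w *\<^sub>R e \<noteq> 0"
  using assms by (auto simp: adapted_def inner_commute dot_square_norm)

lemma covec_exists:
  assumes "snd (snd \<xi>) \<noteq> 0"
  shows "\<exists>\<alpha> \<beta> v e w. \<xi> = covec \<alpha> \<beta> v e w \<and> adapted v e w"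
proof -
  obtain a0 a p where \<xi>: "\<xi> = (a0, a, p)" by (cases \<xi>)
  have p: "p \<noteq> 0" using assms by (simp add: \<xi>)
  have "sgn p \<bullet> sgn p = 1" using p by (simp add: norm_sgn dot_square_norm)
  then have "adapted (a - (a \<bullet> sgn p) *\<^sub>R sgn p) (sgn p) (norm p)"
    using p by (simp add: adapted_def norm_sgn inner_diff_left)
  moreover have "\<xi> = covec a0 (a \<bullet> sgn p) (a - (a \<bullet> sgn p) *\<^sub>R sgn p) (sgn p) (norm p)"
    by (simp add: covec_def \<xi> norm_scaleR_sgn)
  ultimately show ?thesis by blast
qed

lemma unit_covec:
  assumes "adapted v e w"
  shows "unit_covector (covec \<alpha> \<beta> v e w) \<longleftrightarrow> \<alpha>\<^sup>2 + \<beta>\<^sup>2 + (norm v)\<^sup>2 = 1"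
proof -
  have "(norm (v + \<beta> *\<^sub>R e))\<^sup>2 = (norm v)\<^sup>2 + \<beta>\<^sup>2"
    unfolding power2_norm_eq_inner using adaptedD[OF assms]
    by (simp add: inner_simps power2_eq_square)
  then show ?thesis by (simp add: unit_covector_def covec_def algebra_simps)
qed

lemma straight_covec:
  assumes "adapted v e w"
  shows "straight (covec \<alpha> \<beta> v e w) \<longleftrightarrow> \<alpha> = 0 \<and> \<beta> = 0"
  using adaptedD[OF assms] by (auto simp: straight_def covec_def inner_simps)

section \<open>The end of a full period in adapted coordinates\<close>

text \<open>For given \<open>w\<close>, \<open>v\<close>, \<open>e\<close> the end point depends on
  \<alpha> and \<beta> only through \<alpha>^2 + \<beta>^2 and \<beta> v. The number of optimal
  geodesics and the degeneracy of the differential are both read off from this.\<close>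

lemma helix_covec_period:
  assumes ad: "adapted v e w" and P: "P = 2 * pi / w"
  shows "helix (covec \<alpha> \<beta> v e w) P = (0, P *\<^sub>R v, - (\<beta> * P / w) *\<^sub>R v + (P * (\<alpha>\<^sup>2 + \<beta>\<^sup>2) / (2 * w)) *\<^sub>R e)"
proof -
  note a = adaptedD[OF ad]
  have b: "(v + \<beta> *\<^sub>R e) \<bullet> (w *\<^sub>R e) = w * \<beta>" using a by (simp add: inner_simps)
  have "helix (covec \<alpha> \<beta> v e w) P = (0, P *\<^sub>R (v + \<beta> *\<^sub>R e) - (w * \<beta> * P / w\<^sup>2) *\<^sub>R (w *\<^sub>R e),
      - (w * \<beta> * P / w\<^sup>2) *\<^sub>R (v + \<beta> *\<^sub>R e) + ((\<alpha>\<^sup>2 * P + 3 * (w * \<beta>) * (w * \<beta> * P / w\<^sup>2)) / (2 * w\<^sup>2)) *\<^sub>R (w *\<^sub>R e))"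
    unfolding covec_def P
    using helix_period[OF a(7), of \<alpha> "v + \<beta> *\<^sub>R e"] unfolding b a(6) Let_def .
  also have "w * \<beta> * P / w\<^sup>2 = \<beta> * P / w" using a(4) by (simp add: power2_eq_square)
  also have "P *\<^sub>R (v + \<beta> *\<^sub>R e) - (\<beta> * P / w) *\<^sub>R (w *\<^sub>R e) = P *\<^sub>R v"
    using a(4) by (simp add: algebra_simps)
  also have "- (\<beta> * P / w) *\<^sub>R (v + \<beta> *\<^sub>R e) + ((\<alpha>\<^sup>2 * P + 3 * (w * \<beta>) * (\<beta> * P / w)) / (2 * w\<^sup>2)) *\<^sub>R (w *\<^sub>R e)
     = - (\<beta> * P / w) *\<^sub>R v + (((\<alpha>\<^sup>2 * P + 3 * (w * \<beta>) * (\<beta> * P / w)) / (2 * w\<^sup>2)) * w - (\<beta> * P / w) * \<beta>) *\<^sub>R e"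
    by (simp add: algebra_simps)
  also have "((\<alpha>\<^sup>2 * P + 3 * (w * \<beta>) * (\<beta> * P / w)) / (2 * w\<^sup>2)) * w - (\<beta> * P / w) * \<beta> = P * (\<alpha>\<^sup>2 + \<beta>\<^sup>2) / (2 * w)"
    using a(4) by (simp add: power2_eq_square field_simps)
  finally show ?thesis .
qed

lemma covec_scale:
  assumes "adapted v e w" "0 < t"
  shows "t *\<^sub>R covec \<alpha> \<beta> v e w = covec (t * \<alpha>) (t * \<beta>) (t *\<^sub>R v) e (t * w)" "adapted (t *\<^sub>R v) e (t * w)"
  using assms by (auto simp: covec_def adapted_def scaleR_add_right)

text \<open>Scaling has normalized the period to 1, so sin w = 0 and cos w = 1 and the variation
  formulas become rational.\<close>

lemma helix_var_2pi:
  fixes \<alpha> \<beta> :: real and v e :: "real ^ 'n::finite"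
  assumes ad: "adapted v e (2 * pi)"
  defines "w \<equiv> 2 * pi" and "\<xi> \<equiv> covec \<alpha> \<beta> v e (2 * pi)"
  shows "helix_var \<xi> \<zeta> 1 = (let \<alpha>' = fst \<zeta>; a' = fst (snd \<zeta>); p' = snd (snd \<zeta>); w' = p' \<bullet> e;
     b' = w * (a' \<bullet> e) + (v + \<beta> *\<^sub>R e) \<bullet> p'; i = \<beta> / w; j = (\<alpha>\<^sup>2 + 3 * \<beta>\<^sup>2) / (2 * w\<^sup>2); dx = w' * \<alpha> / w;
     di = b' / w\<^sup>2 - 3 * \<beta> * w' / w\<^sup>2;
     dj = (2 * \<alpha> * \<alpha>' + 3 * b' * i + 3 * (w * \<beta>) * di - dx * \<alpha>) / (2 * w\<^sup>2) - 2 * j * w' / w;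
     dl = a' - (i *\<^sub>R p' + (di * w) *\<^sub>R e)
     in (dx, dl, (dx / 2) *\<^sub>R v - (i *\<^sub>R a' + di *\<^sub>R (v + \<beta> *\<^sub>R e)) + (j *\<^sub>R p' + (dj * w) *\<^sub>R e)))"
proof -
  note a = adaptedD[OF ad, folded w_def]
  have w0: "w \<noteq> 0" using a(4) by simp
  have sc: "sin w = 0" "cos w = 1" by (simp_all add: w_def)
  have sg: "sgn (w *\<^sub>R e) = e" using a(4) ad by (simp add: sgn_scaleR sgn_div_norm adapted_def)
  have b: "(v + \<beta> *\<^sub>R e) \<bullet> (w *\<^sub>R e) = w * \<beta>" using a by (simp add: inner_simps)
  have b': "a' \<bullet> (w *\<^sub>R e) + (v + \<beta> *\<^sub>R e) \<bullet> p' = w * (a' \<bullet> e) + (v + \<beta> *\<^sub>R e) \<bullet> p'" for a' p' by simp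
  have x: "hel_x \<alpha> (w * \<beta>) w 1 = 0" using w0 by (simp add: hel_x_def sc)
  have u: "hel_u \<alpha> (w * \<beta>) w 1 = \<alpha>" using w0 by (simp add: hel_u_def sc)
  have i: "hel_i1 \<alpha> (w * \<beta>) w 1 = \<beta> / w" using w0 by (simp add: hel_i1_def sc power2_eq_square)
  have j: "hel_i2 \<alpha> (w * \<beta>) w 1 = (\<alpha>\<^sup>2 + 3 * \<beta>\<^sup>2) / (2 * w\<^sup>2)"
    using w0 by (simp add: hel_i2_def x i power2_eq_square)
  have dx: "hel_dx \<alpha> (w * \<beta>) w \<alpha>' b' w' 1 = w' * \<alpha> / w" for \<alpha>' b' w' using w0 by (simp add: hel_dx_def sc)
  have di: "hel_di \<alpha> (w * \<beta>) w \<alpha>' b' w' 1 = b' / w\<^sup>2 - 3 * \<beta> * w' / w\<^sup>2" for \<alpha>' b' w'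
    using w0 by (simp add: hel_di_def sc power2_eq_square power3_eq_cube field_simps)
  have dj: "hel_dj \<alpha> (w * \<beta>) w \<alpha>' b' w' 1 = (2 * \<alpha> * \<alpha>' + 3 * b' * (\<beta> / w) + 3 * (w * \<beta>) * (b' / w\<^sup>2 - 3 * \<beta> * w' / w\<^sup>2)
      - w' * \<alpha> / w * \<alpha>) / (2 * w\<^sup>2) - 2 * ((\<alpha>\<^sup>2 + 3 * \<beta>\<^sup>2) / (2 * w\<^sup>2)) * w' / w" for \<alpha>' b' w'
    by (simp only: hel_dj_def x u i j dx di mult_1_right mult_zero_left diff_0_right)
  have l: "1 *\<^sub>R (v + \<beta> *\<^sub>R e) - (\<beta> / w) *\<^sub>R (w *\<^sub>R e) = v" using w0 by simp
  show ?thesis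
    unfolding \<xi>_def covec_def w_def[symmetric] helix_var_def Let_def fst_conv snd_conv a(6) b b' sg x i j dx di dj l
    by simp
qed

text \<open>If \<alpha> and v are nonzero, the X_0 component of a kernel vector forces the frequency
  variation to vanish, and pairing with v forces \<open>di\<close> to vanish. Then p' = 0, because j
  - i^2 is the variance of the oscillator over a period and hence positive; the remaining components
  follow.\<close>

lemma critical_2pi:
  assumes ad: "adapted v e (2 * pi)" and ns: "\<alpha> \<noteq> 0 \<or> \<beta> \<noteq> 0"
  shows "critical_point sr_exp (covec \<alpha> \<beta> v e (2 * pi)) \<longleftrightarrow> \<alpha> = 0 \<or> v = 0"
proof -
  define w :: real where "w = 2 * pi"
  note a = adaptedD[OF ad, folded w_def]
  note H = helix_var_2pi[OF ad, of \<alpha> \<beta>, folded w_def]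
  have iff: "critical_point sr_exp (covec \<alpha> \<beta> v e w) \<longleftrightarrow> (\<exists>\<zeta>. \<zeta> \<noteq> 0 \<and> helix_var (covec \<alpha> \<beta> v e w) \<zeta> 1 = 0)"
    by (rule critical_point_iff) (use a in \<open>simp add: covec_def\<close>)
  have w: "w > 0" by (rule a(4))
  have "\<zeta> = 0" if nz: "\<alpha> \<noteq> 0" "v \<noteq> 0" and 0: "helix_var (covec \<alpha> \<beta> v e w) \<zeta> 1 = 0" for \<zeta>
  proof -
    obtain \<alpha>' a' p' where \<zeta>: "\<zeta> = (\<alpha>', a', p')" by (cases \<zeta>)
    define b' where "b' = w * (a' \<bullet> e) + (v + \<beta> *\<^sub>R e) \<bullet> p'"
    have w'0: "p' \<bullet> e = 0" using 0 nz w unfolding H by (simp add: \<zeta> Let_def zero_prod_def)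
    define i j di dj where ij: "i = \<beta> / w" "j = (\<alpha>\<^sup>2 + 3 * \<beta>\<^sup>2) / (2 * w\<^sup>2)" "di = b' / w\<^sup>2"
      "dj = (2 * \<alpha> * \<alpha>' + 3 * b' * i + 3 * (w * \<beta>) * di) / (2 * w\<^sup>2)"
    have "helix_var (covec \<alpha> \<beta> v e w) \<zeta> 1 = (0, a' - (i *\<^sub>R p' + (di * w) *\<^sub>R e),
        - (i *\<^sub>R a' + di *\<^sub>R (v + \<beta> *\<^sub>R e)) + (j *\<^sub>R p' + (dj * w) *\<^sub>R e))"
      unfolding H Let_def \<zeta> fst_conv snd_conv w'0 b'_def[symmetric] ij by simp
    with 0 have 1: "a' - (i *\<^sub>R p' + (di * w) *\<^sub>R e) = 0"
      and 2: "- (i *\<^sub>R a' + di *\<^sub>R (v + \<beta> *\<^sub>R e)) + (j *\<^sub>R p' + (dj * w) *\<^sub>R e) = 0"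
      by (simp_all only: zero_prod_def prod.inject)
    have a': "a' = i *\<^sub>R p' + (di * w) *\<^sub>R e" using 1 by simp
    have ep: "e \<bullet> p' = 0" using w'0 by (simp add: inner_commute)
    have "b' = w * (di * w) + v \<bullet> p'" unfolding b'_def a' using a by (simp add: inner_simps w'0 ep)
    moreover have "w * (di * w) = b'" using w by (simp add: ij power2_eq_square)
    ultimately have vp: "v \<bullet> p' = 0" by simp
    have "v \<bullet> (- (i *\<^sub>R a' + di *\<^sub>R (v + \<beta> *\<^sub>R e)) + (j *\<^sub>R p' + (dj * w) *\<^sub>R e)) = - di * (v \<bullet> v)"
      unfolding a' using a vp by (simp add: inner_simps)
    then have di: "di = 0" using 2 nz by simp
    have "(j - i\<^sup>2) *\<^sub>R p' + (dj * w) *\<^sub>R e = 0" using 2 unfolding a' di by (simp add: power2_eq_square algebra_simps)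
    then have "(j - i\<^sup>2) * (p' \<bullet> p') = 0 \<and> dj * w = 0"
    proof -
      assume z: "(j - i\<^sup>2) *\<^sub>R p' + (dj * w) *\<^sub>R e = 0"
      have "((j - i\<^sup>2) *\<^sub>R p' + (dj * w) *\<^sub>R e) \<bullet> p' = (j - i\<^sup>2) * (p' \<bullet> p')" by (simp add: inner_add_left ep)
      moreover have "((j - i\<^sup>2) *\<^sub>R p' + (dj * w) *\<^sub>R e) \<bullet> e = dj * w" using a by (simp add: inner_add_left w'0)
      ultimately show ?thesis using z by simp
    qed
    moreover have "j - i\<^sup>2 = (\<alpha>\<^sup>2 + \<beta>\<^sup>2) / (2 * w\<^sup>2)" using w by (simp add: ij power2_eq_square field_simps)
    moreover have "\<alpha>\<^sup>2 + \<beta>\<^sup>2 > 0" using nz by (simp add: add_pos_nonneg)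
    ultimately have "p' = 0" "dj = 0" using w by auto
    then show ?thesis using a' di ij w nz by (auto simp: \<zeta> zero_prod_def)
  qed
  \<comment> \<open>The end point depends on \<alpha> through its square, so at \<alpha> = 0 varying
    \<alpha> has no first-order effect.\<close>
  moreover have "\<exists>\<zeta>. \<zeta> \<noteq> 0 \<and> helix_var (covec \<alpha> \<beta> v e w) \<zeta> 1 = 0" if "\<alpha> = 0"
    by (rule exI[of _ "(1, 0, 0)"], unfold H) (simp add: Let_def that zero_prod_def)
  \<comment> \<open>For v = 0 only \<alpha>^2 + \<beta>^2 enters; the kernel vector is tangent to
    the rotations of (\<alpha>, \<beta>).\<close>
  moreover have "\<exists>\<zeta>. \<zeta> \<noteq> 0 \<and> helix_var (covec \<alpha> \<beta> v e w) \<zeta> 1 = 0" if "v = 0"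
  proof (intro exI conjI)
    show "(\<beta>, - \<alpha> *\<^sub>R e, 0) \<noteq> 0" using ns a by (auto simp: zero_prod_def)
    have "(2 * \<alpha> * \<beta> + 3 * (w * - \<alpha>) * (\<beta> / w) + 3 * (w * \<beta>) * (w * - \<alpha> / w\<^sup>2)) / (2 * w\<^sup>2) * w = - 2 * \<alpha> * \<beta> / w"
      using w by (simp add: power2_eq_square field_simps)
    then show "helix_var (covec \<alpha> \<beta> v e w) (\<beta>, - \<alpha> *\<^sub>R e, 0) 1 = 0"
      unfolding H using a w by (simp add: Let_def that zero_prod_def power2_eq_square field_simps)
        (simp add: vec_eq_iff)
  qed
  ultimately have "critical_point sr_exp (covec \<alpha> \<beta> v e w) \<longleftrightarrow> \<alpha> = 0 \<or> v = 0"
    unfolding iff by blast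
  then show ?thesis by (simp add: w_def)
qed

section \<open>The first conjugate time\<close>

lemma continuous_on_helix_var:
  fixes S :: "'z::real_normed_vector set"
  assumes \<xi>: "continuous_on S \<xi>" and \<zeta>: "continuous_on S \<zeta>" and nz: "\<And>z. z \<in> S \<Longrightarrow> snd (snd (\<xi> z)) \<noteq> 0"
  shows "continuous_on S (\<lambda>z. helix_var (\<xi> z) (\<zeta> z) 1)"
proof -
  define A B N where ABN: "A z = fst (\<xi> z)" "B z = fst (snd (\<xi> z)) \<bullet> snd (snd (\<xi> z))" "N z = norm (snd (snd (\<xi> z)))" for z
  define A' B' N' where ABN': "A' z = fst (\<zeta> z)" "B' z = fst (snd (\<zeta> z)) \<bullet> snd (snd (\<xi> z)) + fst (snd (\<xi> z)) \<bullet> snd (snd (\<zeta> z))"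
    "N' z = snd (snd (\<zeta> z)) \<bullet> sgn (snd (snd (\<xi> z)))" for z
  have c: "continuous_on S A" "continuous_on S B" "continuous_on S N" "continuous_on S A'" "continuous_on S B'"
    unfolding ABN[abs_def] ABN'[abs_def] by (intro continuous_intros \<xi> \<zeta>)+
  have cN': "continuous_on S N'"
    unfolding ABN'[abs_def] sgn_div_norm by (intro continuous_intros \<xi> \<zeta>) (use nz in auto)
  have N0: "N z \<noteq> 0" if "z \<in> S" for z using nz[OF that] by (simp add: ABN)
  note ci = continuous_on_hel_i[OF c(1,2,3)]
  have sc: "continuous_on S (\<lambda>z. sin (N z * 1))" "continuous_on S (\<lambda>z. cos (N z * 1))"
    using continuous_on_sin[OF c(3)] continuous_on_cos[OF c(3)] by simp_all
  have cx: "continuous_on S (\<lambda>z. hel_x (A z) (B z) (N z) 1)" by (intro continuous_intros c)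
  have cu: "continuous_on S (\<lambda>z. hel_u (A z) (B z) (N z) 1)" unfolding hel_u_eq by (intro continuous_intros c ci)
  have cdx: "continuous_on S (\<lambda>z. hel_dx (A z) (B z) (N z) (A' z) (B' z) (N' z) 1)"
    unfolding hel_dx_def by (intro continuous_intros sc c cN') (use N0 in auto)
  have cdi: "continuous_on S (\<lambda>z. hel_di (A z) (B z) (N z) (A' z) (B' z) (N' z) 1)"
    unfolding hel_di_def by (intro continuous_intros sc c cN') (use N0 in auto)
  have cdu: "continuous_on S (\<lambda>z. hel_du (A z) (B z) (N z) (A' z) (B' z) (N' z) 1)"
    unfolding hel_du_def by (intro continuous_intros sc c cN') (use N0 in auto)
  have cdj: "continuous_on S (\<lambda>z. hel_dj (A z) (B z) (N z) (A' z) (B' z) (N' z) 1)"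
    unfolding hel_dj_def by (intro continuous_intros c cN' ci cx cu cdx cdi cdu) (use N0 in auto)
  show ?thesis
    unfolding helix_var_def Let_def ABN[symmetric] ABN'[symmetric]
    by (intro continuous_intros \<xi> \<zeta> c cN' ci cx cdx cdi cdj) auto
qed

text \<open>The conjugate time is an infimum and might be T as a limit of later critical times. This
  is excluded by compactness: normalized kernel vectors at times decreasing to T subconverge to a
  kernel vector at T.\<close>

lemma not_critical_right_nbhd:
  fixes \<xi> :: "'n::finite pgroup"
  assumes p: "snd (snd \<xi>) \<noteq> 0" and T: "0 < T" and nc: "\<not> critical_point sr_exp (T *\<^sub>R \<xi>)"
  shows "\<exists>d>0. \<forall>t. T \<le> t \<and> t < T + d \<longrightarrow> \<not> critical_point sr_exp (t *\<^sub>R \<xi>)"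
proof (rule ccontr)
  assume "\<not> ?thesis"
  then have "\<exists>t. T \<le> t \<and> t < T + d \<and> critical_point sr_exp (t *\<^sub>R \<xi>)" if "d > 0" for d using that by blast
  from this[of "1 / real (Suc n)" for n]
  have "\<exists>t. T \<le> t \<and> t < T + 1 / real (Suc n) \<and> critical_point sr_exp (t *\<^sub>R \<xi>)" for n by simp
  then obtain t where t: "\<And>n. T \<le> t n" "\<And>n. t n < T + 1 / real (Suc n)" "\<And>n. critical_point sr_exp (t n *\<^sub>R \<xi>)"
    by metis
  have pt: "snd (snd (s *\<^sub>R \<xi>)) \<noteq> 0" if "s \<ge> T" for s using p T that by simp
  have "\<exists>\<zeta>. norm \<zeta> = 1 \<and> helix_var (t n *\<^sub>R \<xi>) \<zeta> 1 = 0" for n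
  proof -
    obtain \<zeta> where \<zeta>: "\<zeta> \<noteq> 0" "helix_var (t n *\<^sub>R \<xi>) \<zeta> 1 = 0"
      using t(3)[of n] critical_point_iff[OF pt[OF t(1)]] by blast
    have "linear (\<lambda>\<zeta>. helix_var (t n *\<^sub>R \<xi>) \<zeta> 1)"
      by (rule has_derivative_linear[OF helix_has_derivative[OF pt[OF t(1)]]])
    from linear_scale[OF this, of "1 / norm \<zeta>" \<zeta>] \<zeta>
    show ?thesis by (intro exI[of _ "(1 / norm \<zeta>) *\<^sub>R \<zeta>"]) simp
  qed
  then obtain \<zeta> where \<zeta>: "\<And>n. norm (\<zeta> n) = 1" "\<And>n. helix_var (t n *\<^sub>R \<xi>) (\<zeta> n) 1 = 0" by metis
  have "compact (sphere (0 :: 'n pgroup) 1)" by simp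
  moreover have "\<zeta> n \<in> sphere 0 1" for n using \<zeta>(1) by simp
  ultimately obtain \<eta> r where r: "\<eta> \<in> sphere 0 1" "strict_mono r" "(\<zeta> \<circ> r) \<longlonglongrightarrow> \<eta>"
    unfolding compact_def by blast
  have "t \<longlonglongrightarrow> T"
  proof (rule tendsto_sandwich[of "\<lambda>_. T" _ _ "\<lambda>n. T + 1 / real (Suc n)"])
    have "(\<lambda>n. 1 / real (Suc n)) \<longlonglongrightarrow> 0" using LIMSEQ_inverse_real_of_nat by (simp add: divide_inverse)
    from tendsto_add[OF tendsto_const this] show "(\<lambda>n. T + 1 / real (Suc n)) \<longlonglongrightarrow> T" by simp
    show "\<forall>\<^sub>F n in sequentially. T \<le> t n" "\<forall>\<^sub>F n in sequentially. t n \<le> T + 1 / real (Suc n)"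
      using t by (auto intro!: always_eventually less_imp_le)
  qed simp
  from LIMSEQ_subseq_LIMSEQ[OF this r(2)] have lim: "(\<lambda>n. (t (r n), \<zeta> (r n))) \<longlonglongrightarrow> (T, \<eta>)"
    using r(3) by (intro tendsto_Pair) (simp_all add: o_def)
  have "continuous_on {z :: real \<times> 'n pgroup. T \<le> fst z} (\<lambda>z. helix_var (fst z *\<^sub>R \<xi>) (snd z) 1)"
    by (intro continuous_on_helix_var continuous_intros) (use pt in auto)
  from continuous_on_tendsto_compose[OF this lim]
  have "(\<lambda>n. helix_var (t (r n) *\<^sub>R \<xi>) (\<zeta> (r n)) 1) \<longlonglongrightarrow> helix_var (T *\<^sub>R \<xi>) \<eta> 1"
    using t(1) by simp
  then have "helix_var (T *\<^sub>R \<xi>) \<eta> 1 = 0" using LIMSEQ_unique tendsto_const unfolding \<zeta>(2) by blast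
  moreover have "\<eta> \<noteq> 0" using r(1) by auto
  ultimately have "critical_point sr_exp (T *\<^sub>R \<xi>)"
    unfolding critical_point_iff[OF pt[OF order_refl]] by blast
  then show False using nc by simp
qed

lemma conjugate_time_covec:
  assumes ad: "adapted v e w" and ns: "\<alpha> \<noteq> 0 \<or> \<beta> \<noteq> 0"
  shows "conjugate_time (covec \<alpha> \<beta> v e w) = ereal (2 * pi / w) \<longleftrightarrow> \<alpha> = 0 \<or> v = 0"
proof -
  let ?\<xi> = "covec \<alpha> \<beta> v e w"
  define P where "P = 2 * pi / w"
  note a = adaptedD[OF ad]
  have P: "P > 0" "P * w = 2 * pi" using a(4) by (simp_all add: P_def)
  define A where "A = {t. 0 < t \<and> critical_point sr_exp (t *\<^sub>R ?\<xi>)}"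
  have ct: "conjugate_time ?\<xi> = Inf (ereal ` A)" by (simp add: conjugate_time_def A_def)
  have p: "snd (snd ?\<xi>) \<noteq> 0" using a by (simp add: covec_def)
  have lower: "P \<le> t" if "t \<in> A" for t
  proof (rule ccontr)
    assume tP: "\<not> P \<le> t"
    have t: "0 < t" "critical_point sr_exp (t *\<^sub>R ?\<xi>)" using that by (auto simp: A_def)
    note s = covec_scale(1)[OF ad t(1), of \<alpha> \<beta>] covec_scale(2)[OF ad t(1)]
    have "t * w < P * w" using tP a(4) by simp
    then have nl: "norm (snd (snd (t *\<^sub>R ?\<xi>))) < 2 * pi"
      unfolding s(1) using adaptedD[OF s(2)] P by (simp add: covec_def)
    have st: "\<not> straight (t *\<^sub>R ?\<xi>)" unfolding s(1) straight_covec[OF s(2)] using ns t(1) by simp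
    have pt: "snd (snd (t *\<^sub>R ?\<xi>)) \<noteq> 0" using p t(1) by simp
    show False using t(2) helix_var_inj[OF pt nl st] critical_point_iff[OF pt] by blast
  qed
  have crit: "P \<in> A \<longleftrightarrow> \<alpha> = 0 \<or> v = 0"
    using critical_2pi[of "P *\<^sub>R v" e "P * \<alpha>" "P * \<beta>"] covec_scale(1)[OF ad P(1), of \<alpha> \<beta>]
      covec_scale(2)[OF ad P(1)] P ns by (simp add: A_def)
  show ?thesis
  proof
    assume "\<alpha> = 0 \<or> v = 0"
    then have "P \<in> A" by (simp add: crit)
    then have "Inf (ereal ` A) = ereal P" using lower by (intro Inf_eqI) auto
    then show "conjugate_time ?\<xi> = ereal (2 * pi / w)" by (simp add: ct P_def)
  next
    assume c: "conjugate_time ?\<xi> = ereal (2 * pi / w)"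
    show "\<alpha> = 0 \<or> v = 0"
    proof (rule ccontr)
      assume "\<not> (\<alpha> = 0 \<or> v = 0)"
      then have "\<not> critical_point sr_exp (P *\<^sub>R ?\<xi>)" using crit P by (simp add: A_def)
      from not_critical_right_nbhd[OF p P(1) this]
      obtain d where d: "d > 0" "\<And>t. P \<le> t \<Longrightarrow> t < P + d \<Longrightarrow> \<not> critical_point sr_exp (t *\<^sub>R ?\<xi>)" by blast
      have "ereal (P + d) \<le> Inf (ereal ` A)"
      proof (rule Inf_greatest)
        fix z assume "z \<in> ereal ` A"
        then obtain t where t: "z = ereal t" "t \<in> A" by blast
        then have "P + d \<le> t" using lower[OF t(2)] d(2)[of t] by (force simp: A_def)
        then show "ereal (P + d) \<le> z" by (simp add: t)
      qed
      then show False using c d(1) by (simp add: ct P_def)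
    qed
  qed
qed

text \<open>A helix that is not straight determines its covector, so the covector asserted to exist
  can only be the given one.\<close>

lemma ends_at_first_conjugate_point_covec:
  assumes ad: "adapted v e w" and ns: "\<alpha> \<noteq> 0 \<or> \<beta> \<noteq> 0" and u: "unit_covector (covec \<alpha> \<beta> v e w)"
    and T: "T = 2 * pi / w" and \<gamma>: "\<And>t. t \<in> {0..T} \<Longrightarrow> \<gamma> t = helix (covec \<alpha> \<beta> v e w) t"
  shows "ends_at_first_conjugate_point T \<gamma> \<longleftrightarrow> \<alpha> = 0 \<or> v = 0"
proof -
  let ?\<xi> = "covec \<alpha> \<beta> v e w"
  have T0: "T > 0" using T adaptedD(4)[OF ad] by simp
  have exp: "sr_exp (t *\<^sub>R \<zeta>) = helix \<zeta> t" if "t \<in> {0..T}" for t \<zeta>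
    using that sr_exp_scale[of t \<zeta>] helix_trivial[of 0 1] by (cases "t = 0") (auto simp: sr_exp_eq zero_prod_def)
  have "ends_at_first_conjugate_point T \<gamma> \<longleftrightarrow> conjugate_time ?\<xi> = ereal T"
  proof
    assume "ends_at_first_conjugate_point T \<gamma>"
    then obtain \<zeta> where \<zeta>: "\<And>t. t \<in> {0..T} \<Longrightarrow> \<gamma> t = sr_exp (t *\<^sub>R \<zeta>)" "conjugate_time \<zeta> = ereal T"
      unfolding ends_at_first_conjugate_point_def by blast
    have "helix ?\<xi> t = helix \<zeta> t" if "t \<in> {0..T}" for t
      by (rule trans[OF \<gamma>[OF that, symmetric] trans[OF \<zeta>(1)[OF that] exp[OF that]]])
    then have "?\<xi> = \<zeta>" using helix_eq_imp[OF T0, of ?\<xi> \<zeta>] straight_covec[OF ad] ns by blast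
    then show "conjugate_time ?\<xi> = ereal T" using \<zeta>(2) by simp
  next
    assume "conjugate_time ?\<xi> = ereal T"
    then show "ends_at_first_conjugate_point T \<gamma>"
      unfolding ends_at_first_conjugate_point_def hamiltonian_0
    proof (intro exI[of _ ?\<xi>] conjI ballI u)
      fix t assume t: "t \<in> {0..T}"
      show "\<gamma> t = sr_exp (t *\<^sub>R ?\<xi>)" by (rule trans[OF \<gamma>[OF t] exp[OF t, symmetric]])
    qed
  qed
  then show ?thesis using conjugate_time_covec[OF ad ns] by (simp add: T)
qed

section \<open>The cut locus\<close>

lemma geodesic_on_cong:
  assumes "geodesic_on {0..T} \<gamma>" "\<And>t. t \<in> {0..T} \<Longrightarrow> \<gamma> t = \<gamma>' t"
  shows "geodesic_on {0..T} \<gamma>'"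
  unfolding geodesic_on_def
proof (intro conjI ballI impI)
  have eq: "\<gamma> t = \<gamma>' t" if "a \<in> {0..T}" "b \<in> {0..T}" "t \<in> {a..b}" for a b t using assms(2) that by auto
  fix a b assume ab: "a \<in> {0..T}" "b \<in> {0..T}" "a \<le> b"
  have h: "horizontal_curve a b \<gamma>" "sr_length a b \<gamma> = b - a" using assms(1) ab unfolding geodesic_on_def by blast+
  show "horizontal_curve a b \<gamma>'" using horizontal_curve_cong[of a b \<gamma> \<gamma>', OF eq[OF ab(1,2)]] h by simp
  show "sr_length a b \<gamma>' = b - a" using sr_length_cong[OF h(1) eq[OF ab(1,2)]] h by simp
next
  fix t assume t: "t \<in> {0..T}"
  then obtain e where e: "e > 0" "\<And>a b. a \<in> {0..T} \<Longrightarrow> b \<in> {0..T} \<Longrightarrow> t - e < a \<and> a < b \<and> b < t + e \<Longrightarrow> minimizing a b \<gamma>"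
    using assms(1) unfolding geodesic_on_def by meson
  have "minimizing a b \<gamma>'" if "a \<in> {0..T}" "b \<in> {0..T}" "t - e < a \<and> a < b \<and> b < t + e" for a b
    by (rule minimizing_cong[OF e(2)[OF that]]) (use that assms(2) in auto)
  with e(1) show "\<exists>e>0. \<forall>a\<in>{0..T}. \<forall>b\<in>{0..T}. t - e < a \<and> a < b \<and> b < t + e \<longrightarrow> minimizing a b \<gamma>'" by blast
qed

lemma optimal_geodesic_helix:
  assumes u: "unit_covector \<xi>" and T: "0 < T" "norm (snd (snd \<xi>)) * T \<le> 2 * pi"
  shows "optimal_geodesic (helix \<xi> T) T (restrict (helix \<xi>) {0..T})"
  unfolding optimal_geodesic_def
proof (intro conjI T(1))
  show "geodesic_on {0..T} (restrict (helix \<xi>) {0..T})"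
    by (rule geodesic_on_cong[OF geodesic_on_helix[OF u]]) auto
  show "minimizing 0 T (restrict (helix \<xi>) {0..T})"
    by (rule minimizing_cong[OF minimizing_helix[OF u T]]) (use T in auto)
qed (use T in auto)

text \<open>The calibration belonging to the known helix is saturated by every other minimizer to
  its end point, so all of them share the vertical covector and only the horizontal components are
  left open.\<close>

lemma optimal_geodesic_is_helix:
  assumes opt: "optimal_geodesic (helix \<xi> P) T \<gamma>" and u: "unit_covector \<xi>"
    and P: "0 < P" "norm (snd (snd \<xi>)) * P \<le> 2 * pi"
  shows "T = P \<and> (\<exists>a0 a. unit_covector (a0, a, snd (snd \<xi>)) \<and> \<gamma> = restrict (helix (a0, a, snd (snd \<xi>))) {0..P})"
proof -
  have \<gamma>: "0 < T" "\<gamma> \<in> extensional {0..T}" "geodesic_on {0..T} \<gamma>" "\<gamma> 0 = 0" "\<gamma> T = helix \<xi> P" "minimizing 0 T \<gamma>"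
    using opt by (simp_all add: optimal_geodesic_def)
  have us: "horizontal_curve s t \<gamma> \<and> sr_length s t \<gamma> = t - s" if "0 \<le> s" "s \<le> t" "t \<le> T" for s t
    using \<gamma>(3) that unfolding geodesic_on_def by auto
  have lh: "sr_length 0 P (helix \<xi>) = P" using sr_length_helix[OF u, of 0 P] P by simp
  have lT: "sr_length 0 T \<gamma> = T" using us[of 0 T] \<gamma>(1) by simp
  have "sr_length 0 T \<gamma> \<le> sr_length 0 P (helix \<xi>)"
    by (rule minimizing_le[OF \<gamma>(6) _ horizontal_curve_helix]) (use P \<gamma> in auto)
  moreover have "sr_length 0 P (helix \<xi>) \<le> sr_length 0 T \<gamma>"
    by (rule minimizing_le[OF minimizing_helix[OF u P] _ minimizing_horizontal[OF \<gamma>(6)]]) (use P \<gamma> in auto)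
  ultimately have TP: "T = P" using lh lT by simp
  obtain b0 b p where \<xi>: "\<xi> = (b0, b, p)" by (cases \<xi>)
  have "\<exists>a0 a. unit_covector (a0, a, p) \<and> (\<forall>t\<in>{0..P}. \<gamma> t = helix (a0, a, p) t)"
  proof -
    have h: "horizontal_curve 0 P \<gamma>" using minimizing_horizontal[OF \<gamma>(6)] by (simp add: TP)
    have us': "sr_length s t \<gamma> = t - s" if "0 \<le> s" "s \<le> t" "t \<le> P" for s t using us[of s t] that TP by simp
    have pP: "norm p * P < 2 * pi \<or> (norm p * P = 2 * pi \<and> fst (\<gamma> P) = 0 \<and> p \<bullet> fst (snd (\<gamma> P)) = 0)"
      using helix_planar_zero[of p P b0 b] P(2) \<gamma>(5) by (auto simp: \<xi> TP)
    have hjP: "hj p P (\<gamma> P) = P" using hj_helix[of P p b0 b] P \<gamma>(5) u by (simp add: \<xi> TP unit_covector_def)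
    show ?thesis by (rule helix_of_hj_eq[OF h P(1) \<gamma>(4) us' pP hjP])
  qed
  then obtain a0 a where a: "unit_covector (a0, a, p)" "\<And>t. t \<in> {0..P} \<Longrightarrow> \<gamma> t = helix (a0, a, p) t" by blast
  have "\<gamma> = restrict (helix (a0, a, p)) {0..P}"
    using \<gamma>(2) a(2) TP by (intro extensionalityI[of _ "{0..P}"]) auto
  then show ?thesis using a(1) TP by (auto simp: \<xi>)
qed

text \<open>With the vertical covector fixed, the planar end point gives v, the component of y along
  \<open>e\<close> gives \<alpha>^2 + \<beta>^2, and the component along v gives \<beta> v. For v
  \<noteq> 0 only the sign of \<alpha> is open, for v = 0 a whole circle.\<close>

lemma optimal_geodesic_covec_iff:
  assumes ad: "adapted v e w" and u: "unit_covector (covec \<alpha> \<beta> v e w)" and P: "P = 2 * pi / w"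
  shows "optimal_geodesic (helix (covec \<alpha> \<beta> v e w) P) T \<gamma> \<longleftrightarrow> T = P \<and>
    (\<exists>\<alpha>' \<beta>'. \<alpha>'\<^sup>2 + \<beta>'\<^sup>2 = \<alpha>\<^sup>2 + \<beta>\<^sup>2 \<and> \<beta>' *\<^sub>R v = \<beta> *\<^sub>R v \<and> \<gamma> = restrict (helix (covec \<alpha>' \<beta>' v e w)) {0..P})"
proof -
  note a = adaptedD[OF ad]
  have P0: "P > 0" "w * P = 2 * pi" using a(4) by (simp_all add: P)
  have nrm: "norm (snd (snd (covec \<alpha>' \<beta>' v' e w))) * P \<le> 2 * pi" for \<alpha>' \<beta>' v'
    using a P0 by (simp add: covec_def)
  note per = helix_covec_period[OF _ P]
  show ?thesis
  proof
    assume opt: "optimal_geodesic (helix (covec \<alpha> \<beta> v e w) P) T \<gamma>"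
    from optimal_geodesic_is_helix[OF opt u P0(1) nrm]
    obtain c0 c where c: "T = P" "unit_covector (c0, c, w *\<^sub>R e)" "\<gamma> = restrict (helix (c0, c, w *\<^sub>R e)) {0..P}"
      by (auto simp: covec_def)
    define \<beta>' v' where bv: "\<beta>' = c \<bullet> e" "v' = c - (c \<bullet> e) *\<^sub>R e"
    have cv: "(c0, c, w *\<^sub>R e) = covec c0 \<beta>' v' e w" by (simp add: covec_def bv)
    have ad': "adapted v' e w" using a by (simp add: adapted_def bv inner_diff_left dot_square_norm)
    have "\<gamma> P = helix (covec \<alpha> \<beta> v e w) P" using opt c(1) by (simp add: optimal_geodesic_def)
    then have "helix (covec c0 \<beta>' v' e w) P = helix (covec \<alpha> \<beta> v e w) P" using c(3) P0 by (simp add: cv)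
    then have 1: "P *\<^sub>R v' = P *\<^sub>R v"
      and 2: "- (\<beta>' * P / w) *\<^sub>R v' + (P * (c0\<^sup>2 + \<beta>'\<^sup>2) / (2 * w)) *\<^sub>R e
        = - (\<beta> * P / w) *\<^sub>R v + (P * (\<alpha>\<^sup>2 + \<beta>\<^sup>2) / (2 * w)) *\<^sub>R e"
      unfolding per[OF ad'] per[OF ad] by simp_all
    have v: "v' = v" using 1 P0 by simp
    have "(- (\<beta>' * P / w) *\<^sub>R v + (P * (c0\<^sup>2 + \<beta>'\<^sup>2) / (2 * w)) *\<^sub>R e) \<bullet> e = P * (c0\<^sup>2 + \<beta>'\<^sup>2) / (2 * w)"
      and "(- (\<beta> * P / w) *\<^sub>R v + (P * (\<alpha>\<^sup>2 + \<beta>\<^sup>2) / (2 * w)) *\<^sub>R e) \<bullet> e = P * (\<alpha>\<^sup>2 + \<beta>\<^sup>2) / (2 * w)"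
      using a by (simp_all add: inner_add_left inner_diff_left)
    then have r: "c0\<^sup>2 + \<beta>'\<^sup>2 = \<alpha>\<^sup>2 + \<beta>\<^sup>2" using 2 v P0 a(4) by simp
    then have "(\<beta>' * P / w) *\<^sub>R v = (\<beta> * P / w) *\<^sub>R v" using 2 v by simp
    then have "(P / w) *\<^sub>R (\<beta>' *\<^sub>R v) = (P / w) *\<^sub>R (\<beta> *\<^sub>R v)" by (simp add: mult.commute)
    then have "\<beta>' *\<^sub>R v = \<beta> *\<^sub>R v" using P0 a(4) by simp
    then show "T = P \<and> (\<exists>\<alpha>' \<beta>'. \<alpha>'\<^sup>2 + \<beta>'\<^sup>2 = \<alpha>\<^sup>2 + \<beta>\<^sup>2 \<and> \<beta>' *\<^sub>R v = \<beta> *\<^sub>R v \<and> \<gamma> = restrict (helix (covec \<alpha>' \<beta>' v e w)) {0..P})"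
      using c(1,3) r unfolding cv v by blast
  next
    assume "T = P \<and> (\<exists>\<alpha>' \<beta>'. \<alpha>'\<^sup>2 + \<beta>'\<^sup>2 = \<alpha>\<^sup>2 + \<beta>\<^sup>2 \<and> \<beta>' *\<^sub>R v = \<beta> *\<^sub>R v \<and> \<gamma> = restrict (helix (covec \<alpha>' \<beta>' v e w)) {0..P})"
    then obtain \<alpha>' \<beta>' where c: "T = P" "\<alpha>'\<^sup>2 + \<beta>'\<^sup>2 = \<alpha>\<^sup>2 + \<beta>\<^sup>2" "\<beta>' *\<^sub>R v = \<beta> *\<^sub>R v"
      "\<gamma> = restrict (helix (covec \<alpha>' \<beta>' v e w)) {0..P}" by blast
    have u': "unit_covector (covec \<alpha>' \<beta>' v e w)" using u c(2) unfolding unit_covec[OF ad] by simp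
    have "(\<beta>' * P / w) *\<^sub>R v = (P / w) *\<^sub>R (\<beta>' *\<^sub>R v)" by (simp add: mult.commute)
    also have "\<dots> = (\<beta> * P / w) *\<^sub>R v" unfolding c(3) by (simp add: mult.commute)
    finally have "helix (covec \<alpha>' \<beta>' v e w) P = helix (covec \<alpha> \<beta> v e w) P"
      unfolding per[OF ad] c(2) by simp
    then show "optimal_geodesic (helix (covec \<alpha> \<beta> v e w) P) T \<gamma>"
      using optimal_geodesic_helix[OF u' P0(1) nrm] c by simp
  qed
qed

section \<open>The angle condition in orthogonal components\<close>

lemma wedge_nonzero_iff: "wedge_nonzero l y \<longleftrightarrow> l \<noteq> 0 \<and> y \<notin> span {l}"
proof -
  have "independent {l, y} \<longleftrightarrow> l \<noteq> 0 \<and> y \<notin> span {l}" if "l \<noteq> y"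
    using that independent_insert[of y "{l}"] by (auto simp: insert_commute)
  moreover have "l \<noteq> y" if "y \<notin> span {l}" using that span_base by blast
  ultimately show ?thesis unfolding wedge_nonzero_def by blast
qed

context
  fixes l y e :: "real ^ 'n::finite" and s c :: real
  assumes l: "l \<noteq> 0" and e: "norm e = 1" "l \<bullet> e = 0" and c: "0 < c" and y: "y = s *\<^sub>R l + c *\<^sub>R e"
begin

lemma norm_sq_decomposition: "(norm y)\<^sup>2 = s\<^sup>2 * (norm l)\<^sup>2 + c\<^sup>2"
proof -
  have "e \<bullet> e = 1" "e \<bullet> l = 0" using e by (simp_all add: dot_square_norm inner_commute)
  then show ?thesis unfolding y power2_norm_eq_inner using e(2) by (simp add: inner_simps power2_eq_square)
qed

lemma norm_pos_decomposition: "0 < norm y"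
proof -
  have "0 < (norm y)\<^sup>2" unfolding norm_sq_decomposition using c by (simp add: add_nonneg_pos)
  then show ?thesis by simp
qed

lemma wedge_nonzero_decomposition: "wedge_nonzero l y"
  unfolding wedge_nonzero_iff
proof (intro conjI l notI)
  assume "y \<in> span {l}"
  then obtain k where "y = k *\<^sub>R l" by (auto simp: span_singleton)
  then have "y \<bullet> e = 0" using e by simp
  moreover have "y \<bullet> e = c" using e by (simp add: y inner_add_left dot_square_norm)
  ultimately show False using c by simp
qed

lemma cos_angle_decomposition: "cos (angle l y) = s * norm l / norm y"
proof -
  have "l \<bullet> y / (norm l * norm y) = s * norm l / norm y"
    using l e by (simp add: y inner_add_right dot_square_norm power2_eq_square)
  moreover have "\<bar>l \<bullet> y / (norm l * norm y)\<bar> \<le> 1"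
    using Cauchy_Schwarz_ineq2[of l y] l norm_pos_decomposition by (simp add: abs_divide abs_mult)
  ultimately show ?thesis unfolding angle_def by (simp add: cos_arccos_abs)
qed

lemma sin_angle_decomposition: "sin (angle l y) = c / norm y"
proof -
  have "0 \<le> sin (angle l y)"
  proof -
    have "\<bar>l \<bullet> y / (norm l * norm y)\<bar> \<le> 1"
      using Cauchy_Schwarz_ineq2[of l y] l norm_pos_decomposition by (simp add: abs_divide abs_mult)
    then have "- 1 \<le> l \<bullet> y / (norm l * norm y)" "l \<bullet> y / (norm l * norm y) \<le> 1" by linarith+
    then show ?thesis unfolding angle_def by (intro sin_ge_zero arccos_lbound arccos_ubound)
  qed
  moreover have "(sin (angle l y))\<^sup>2 = (c / norm y)\<^sup>2"
  proof -
    have "(sin (angle l y))\<^sup>2 = 1 - (s * norm l)\<^sup>2 / (norm y)\<^sup>2"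
      by (simp only: sin_squared_eq cos_angle_decomposition power_divide)
    also have "\<dots> = ((norm y)\<^sup>2 - (s * norm l)\<^sup>2) / (norm y)\<^sup>2"
      using norm_pos_decomposition by (simp add: diff_divide_distrib)
    also have "(norm y)\<^sup>2 - (s * norm l)\<^sup>2 = c\<^sup>2"
      by (simp add: norm_sq_decomposition power_mult_distrib)
    finally show ?thesis by (simp only: power_divide)
  qed
  ultimately show ?thesis using c norm_pos_decomposition by (simp add: power2_eq_iff_nonneg)
qed

text \<open>As cos \<phi> = s |l| / |y| and sin \<phi> = c / |y|, both sides of the condition
  contain the positive factor |l|^2 / |y|.\<close>

lemma angle_condition_decomposition:
  "pi * norm y * (cos (angle l y))\<^sup>2 \<le> (norm l)\<^sup>2 * sin (angle l y) \<longleftrightarrow> pi * s\<^sup>2 \<le> c"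
  "pi * norm y * (cos (angle l y))\<^sup>2 = (norm l)\<^sup>2 * sin (angle l y) \<longleftrightarrow> pi * s\<^sup>2 = c"
  "norm y * sin (angle l y) = c"
proof -
  have n: "norm y > 0" "norm l > 0" using norm_pos_decomposition l by auto
  have 1: "pi * norm y * (cos (angle l y))\<^sup>2 = ((norm l)\<^sup>2 / norm y) * (pi * s\<^sup>2)"
    unfolding cos_angle_decomposition using n by (simp add: power2_eq_square field_simps)
  have 2: "(norm l)\<^sup>2 * sin (angle l y) = ((norm l)\<^sup>2 / norm y) * c"
    unfolding sin_angle_decomposition by simp
  have 3: "(norm l)\<^sup>2 / norm y > 0" using n by simp
  show "pi * norm y * (cos (angle l y))\<^sup>2 \<le> (norm l)\<^sup>2 * sin (angle l y) \<longleftrightarrow> pi * s\<^sup>2 \<le> c"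
    unfolding 1 2 using 3 by (rule mult_le_cancel_left_pos)
  show "pi * norm y * (cos (angle l y))\<^sup>2 = (norm l)\<^sup>2 * sin (angle l y) \<longleftrightarrow> pi * s\<^sup>2 = c"
    unfolding 1 2 using 3 by (intro mult_left_cancel) linarith
  show "norm y * sin (angle l y) = c" unfolding sin_angle_decomposition using n by simp
qed

end

section \<open>Description of the cut points\<close>

text \<open>Here s = - \<beta> / w and c = pi (\<alpha>^2 + \<beta>^2) / w^2, so c - pi s^2 = pi
  \<alpha>^2 / w^2: the angle condition says \<alpha>^2 \<ge> 0, with equality for \<alpha> = 0. The
  time comes from P^2 (\<alpha>^2 + \<beta>^2 + |v|^2) = P^2, where the first two terms add up to 4
  pi c and the third is |l|^2.\<close>

lemma cut_point_covec:
  fixes v e l y :: "real ^ 'n::finite"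
  assumes ad: "adapted v e w" and u: "unit_covector (covec \<alpha> \<beta> v e w)" and ns: "\<alpha> \<noteq> 0 \<or> \<beta> \<noteq> 0"
    and P: "P = 2 * pi / w" and q: "helix (covec \<alpha> \<beta> v e w) P = (0, l, y)"
  shows "l = P *\<^sub>R v" and "wedge_nonzero l y \<longleftrightarrow> v \<noteq> 0" and "y \<noteq> 0"
    and "v \<noteq> 0 \<Longrightarrow> pi * norm y * (cos (angle l y))\<^sup>2 \<le> (norm l)\<^sup>2 * sin (angle l y)"
    and "v \<noteq> 0 \<Longrightarrow> pi * norm y * (cos (angle l y))\<^sup>2 = (norm l)\<^sup>2 * sin (angle l y) \<longleftrightarrow> \<alpha> = 0"
    and "P = (if wedge_nonzero l y then sqrt (4 * pi * norm y * sin (angle l y) + (norm l)\<^sup>2)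
             else sqrt (4 * pi * norm y))"
proof -
  note a = adaptedD[OF ad]
  have P0: "P > 0" using a(4) by (simp add: P)
  have l: "l = P *\<^sub>R v" and y: "y = - (\<beta> * P / w) *\<^sub>R v + (P * (\<alpha>\<^sup>2 + \<beta>\<^sup>2) / (2 * w)) *\<^sub>R e"
    using helix_covec_period[OF ad P, of \<alpha> \<beta>] unfolding q by simp_all
  define s c where sc: "s = - \<beta> / w" "c = pi * (\<alpha>\<^sup>2 + \<beta>\<^sup>2) / w\<^sup>2"
  have rr: "\<alpha>\<^sup>2 + \<beta>\<^sup>2 > 0" using ns by (auto simp: sum_power2_gt_zero_iff)
  have c0: "c > 0" using rr a(4) by (simp add: sc)
  have cP: "c = P * (\<alpha>\<^sup>2 + \<beta>\<^sup>2) / (2 * w)" using a(4) by (simp add: sc P power2_eq_square)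
  have y': "y = s *\<^sub>R l + c *\<^sub>R e" unfolding y l cP sc using a(4) by simp
  have e1: "norm e = 1" "l \<bullet> e = 0" using ad by (simp_all add: adapted_def l)
  have un: "\<alpha>\<^sup>2 + \<beta>\<^sup>2 + (norm v)\<^sup>2 = 1" using u unit_covec[OF ad] by simp
  show "l = P *\<^sub>R v" by (rule l)
  have "y \<bullet> e = c" using e1 by (simp add: y' inner_add_left dot_square_norm)
  then show "y \<noteq> 0" using c0 by auto
  have l0: "l \<noteq> 0" if "v \<noteq> 0" using that P0 l by simp
  show w: "wedge_nonzero l y \<longleftrightarrow> v \<noteq> 0"
    using wedge_nonzero_decomposition[OF l0 e1 c0 y'] l wedge_nonzero_iff[of l y] by auto
  note dec = angle_condition_decomposition[OF l0 e1 c0 y']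
  have k: "pi * s\<^sup>2 \<le> c \<longleftrightarrow> \<beta>\<^sup>2 \<le> \<alpha>\<^sup>2 + \<beta>\<^sup>2" "pi * s\<^sup>2 = c \<longleftrightarrow> \<beta>\<^sup>2 = \<alpha>\<^sup>2 + \<beta>\<^sup>2"
    using a(4) by (simp_all add: sc power_divide divide_simps)
  show "pi * norm y * (cos (angle l y))\<^sup>2 \<le> (norm l)\<^sup>2 * sin (angle l y)" if "v \<noteq> 0"
    unfolding dec(1)[OF that] k by simp
  show "pi * norm y * (cos (angle l y))\<^sup>2 = (norm l)\<^sup>2 * sin (angle l y) \<longleftrightarrow> \<alpha> = 0" if "v \<noteq> 0"
    unfolding dec(2)[OF that] k by simp
  have PP: "4 * pi * c = P\<^sup>2 * (\<alpha>\<^sup>2 + \<beta>\<^sup>2)" using a(4) by (simp add: sc P power2_eq_square field_simps)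
  show "P = (if wedge_nonzero l y then sqrt (4 * pi * norm y * sin (angle l y) + (norm l)\<^sup>2)
             else sqrt (4 * pi * norm y))"
  proof (cases "v = 0")
    case True
    have "norm y = c" using True c0 e1 by (simp add: y' l)
    then have "4 * pi * norm y = P\<^sup>2" using PP un True by simp
    then show ?thesis using w True P0 by simp
  next
    case False
    have "4 * pi * norm y * sin (angle l y) = 4 * pi * c"
      using dec(3)[OF False] by (simp only: mult.assoc)
    moreover have "(norm l)\<^sup>2 = P\<^sup>2 * (norm v)\<^sup>2" by (simp add: l power_mult_distrib)
    ultimately have "4 * pi * norm y * sin (angle l y) + (norm l)\<^sup>2 = 4 * pi * c + P\<^sup>2 * (norm v)\<^sup>2"
      by (simp only:)
    also have "\<dots> = P\<^sup>2 * (\<alpha>\<^sup>2 + \<beta>\<^sup>2 + (norm v)\<^sup>2)" unfolding PP by (simp add: distrib_left)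
    also have "\<dots> = P\<^sup>2" unfolding un by simp
    finally show ?thesis using w False P0 by simp
  qed
qed

lemma cut_locus_covec:
  "q \<in> cut_locus \<longleftrightarrow> (\<exists>\<alpha> \<beta> v e w. adapted v e w \<and> unit_covector (covec \<alpha> \<beta> v e w) \<and> (\<alpha> \<noteq> 0 \<or> \<beta> \<noteq> 0)
     \<and> q = helix (covec \<alpha> \<beta> v e w) (2 * pi / w))"
proof
  assume "q \<in> cut_locus"
  then obtain \<xi> where \<xi>: "q = helix \<xi> (2 * pi / norm (snd (snd \<xi>)))" "unit_covector \<xi>" "\<not> straight \<xi>"
    unfolding cut_locus_eq by blast
  have "snd (snd \<xi>) \<noteq> 0" using \<xi>(3) by (auto simp: straight_def)
  from covec_exists[OF this] obtain \<alpha> \<beta> v e w where c: "\<xi> = covec \<alpha> \<beta> v e w" "adapted v e w" by blast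
  have w: "norm (snd (snd \<xi>)) = w" using adaptedD(6)[OF c(2)] by (simp add: c covec_def)
  have "q = helix (covec \<alpha> \<beta> v e w) (2 * pi / w)" using \<xi>(1) unfolding w unfolding c(1) .
  moreover have "\<alpha> \<noteq> 0 \<or> \<beta> \<noteq> 0" using \<xi>(3) unfolding c(1) straight_covec[OF c(2)] by blast
  moreover note c(2) \<xi>(2)[unfolded c(1)]
  ultimately show "\<exists>\<alpha> \<beta> v e w. adapted v e w \<and> unit_covector (covec \<alpha> \<beta> v e w) \<and> (\<alpha> \<noteq> 0 \<or> \<beta> \<noteq> 0)
     \<and> q = helix (covec \<alpha> \<beta> v e w) (2 * pi / w)"
    by blast
next
  assume "\<exists>\<alpha> \<beta> v e w. adapted v e w \<and> unit_covector (covec \<alpha> \<beta> v e w) \<and> (\<alpha> \<noteq> 0 \<or> \<beta> \<noteq> 0)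
     \<and> q = helix (covec \<alpha> \<beta> v e w) (2 * pi / w)"
  then obtain \<alpha> \<beta> v e w where c: "adapted v e w" "unit_covector (covec \<alpha> \<beta> v e w)" "\<alpha> \<noteq> 0 \<or> \<beta> \<noteq> 0"
    "q = helix (covec \<alpha> \<beta> v e w) (2 * pi / w)" by blast
  have "norm (snd (snd (covec \<alpha> \<beta> v e w))) = w" using adaptedD(6)[OF c(1)] by (simp add: covec_def)
  then have "q = helix (covec \<alpha> \<beta> v e w) (2 * pi / norm (snd (snd (covec \<alpha> \<beta> v e w))))" using c(4) by simp
  moreover have "\<not> straight (covec \<alpha> \<beta> v e w)" unfolding straight_covec[OF c(1)] using c(3) by blast
  ultimately show "q \<in> cut_locus" unfolding cut_locus_eq using c(2) by blast
qed

text \<open>A circle without drift, starting along X_0: its vertical displacement has norm P^2 / (4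
  pi), which determines the period.\<close>

lemma vertical_in_cut_locus:
  fixes y :: "real ^ 'n::finite"
  assumes y: "y \<noteq> 0"
  shows "(0, 0, y) \<in> cut_locus"
proof -
  define P w where Pw: "P = sqrt (4 * pi * norm y)" "w = 2 * pi / P"
  have P: "P > 0" "P\<^sup>2 = 4 * pi * norm y" "P = 2 * pi / w" using y by (simp_all add: Pw)
  have w: "w > 0" unfolding Pw(2) using P(1) by simp
  have ad: "adapted 0 (sgn y) w" using y w by (simp add: adapted_def norm_sgn)
  have "P / (2 * w) = norm y" using P(1,2) by (simp add: Pw(2) power2_eq_square)
  then have "helix (covec 1 0 0 (sgn y) w) P = (0, 0, y)"
    using helix_covec_period[OF ad P(3), of 1 0] by (simp add: norm_scaleR_sgn)
  moreover have "unit_covector (covec 1 0 0 (sgn y) w)" unfolding unit_covec[OF ad] by simp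
  ultimately show ?thesis
    unfolding cut_locus_covec P(3)[symmetric] using ad
    by (intro exI[of _ 1] exI[of _ 0] exI[of _ "0 :: real ^ 'n"] exI[of _ "sgn y"] exI[of _ w]) (simp add: P(3)[symmetric])
qed

text \<open>Splitting y into its components along and orthogonal to l gives s, c and
  \<open>e\<close>; the equations of \<open>cut_point_covec\<close> are then solved for the
  covector.\<close>

lemma oblique_in_cut_locus:
  fixes l y :: "real ^ 'n::finite"
  assumes wn: "wedge_nonzero l y"
    and cond: "pi * norm y * (cos (angle l y))\<^sup>2 \<le> (norm l)\<^sup>2 * sin (angle l y)"
  shows "(0, l, y) \<in> cut_locus"
proof -
  have l: "l \<noteq> 0" and ys: "y \<notin> span {l}" using wn by (simp_all add: wedge_nonzero_iff)
  define s m where sm: "s = l \<bullet> y / (l \<bullet> l)" "m = y - s *\<^sub>R l"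
  define c e where ce: "c = norm m" "e = sgn m"
  have "m \<noteq> 0" using ys by (auto simp: sm span_singleton)
  then have c: "c > 0" and e: "norm e = 1" by (simp_all add: ce norm_sgn)
  have "l \<bullet> m = 0" using l by (simp add: sm inner_diff_right)
  then have le: "l \<bullet> e = 0" by (simp add: ce sgn_div_norm)
  have y: "y = s *\<^sub>R l + c *\<^sub>R e" by (simp add: ce norm_scaleR_sgn sm)
  have cs: "pi * s\<^sup>2 \<le> c" using angle_condition_decomposition(1)[OF l e le c y] cond by simp
  define P w where Pw: "P = sqrt (4 * pi * c + (norm l)\<^sup>2)" "w = 2 * pi / P"
  have pos: "4 * pi * c + (norm l)\<^sup>2 > 0" using c by (simp add: add_pos_nonneg)
  have P: "P > 0" "P\<^sup>2 = 4 * pi * c + (norm l)\<^sup>2" "P = 2 * pi / w" using pos by (simp_all add: Pw)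
  have w: "w > 0" unfolding Pw(2) using P(1) by simp
  \<comment> \<open>The angle condition is exactly the nonnegativity of the radicand in
    \<alpha>.\<close>
  define v \<beta> \<alpha> where defs: "v = (1 / P) *\<^sub>R l" "\<beta> = - s * w" "\<alpha> = sqrt (c * w\<^sup>2 / pi - \<beta>\<^sup>2)"
  have ad: "adapted v e w" using e le w by (simp add: adapted_def defs)
  have "\<beta>\<^sup>2 \<le> c * w\<^sup>2 / pi"
  proof -
    have "pi * s\<^sup>2 * (w\<^sup>2 / pi) \<le> c * (w\<^sup>2 / pi)" using cs by (intro mult_right_mono) auto
    then show ?thesis by (simp add: defs power_mult_distrib)
  qed
  then have r: "\<alpha>\<^sup>2 + \<beta>\<^sup>2 = c * w\<^sup>2 / pi" by (simp add: defs(3))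
  have u: "unit_covector (covec \<alpha> \<beta> v e w)"
  proof -
    have "c * w\<^sup>2 / pi = 4 * pi * c / P\<^sup>2" by (simp add: Pw(2) power2_eq_square)
    moreover have "norm v = norm l / P" using P(1) by (simp add: defs(1))
    ultimately have "\<alpha>\<^sup>2 + \<beta>\<^sup>2 + (norm v)\<^sup>2 = (4 * pi * c + (norm l)\<^sup>2) / P\<^sup>2"
      by (simp only: r power_divide add_divide_distrib)
    also have "\<dots> = 1" unfolding P(2)[symmetric] using P(1) by simp
    finally show ?thesis unfolding unit_covec[OF ad] .
  qed
  have "\<alpha>\<^sup>2 + \<beta>\<^sup>2 \<noteq> 0" using c w by (simp add: r)
  then have ns: "\<alpha> \<noteq> 0 \<or> \<beta> \<noteq> 0" by auto
  have "- (\<beta> * P / w) *\<^sub>R v = s *\<^sub>R l" using w P(1) by (simp add: defs)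
  moreover have "P * (\<alpha>\<^sup>2 + \<beta>\<^sup>2) / (2 * w) = c" unfolding r using w P(3) by (simp add: power2_eq_square)
  ultimately have "helix (covec \<alpha> \<beta> v e w) P = (0, l, y)"
    using helix_covec_period[OF ad P(3), of \<alpha> \<beta>] P(1) by (simp add: defs y)
  then have "(0, l, y) = helix (covec \<alpha> \<beta> v e w) (2 * pi / w)" unfolding P(3) by (rule sym)
  with ad u ns show ?thesis unfolding cut_locus_covec by blast
qed

lemma restrict_helix_eq:
  assumes "restrict (helix \<xi>) {0..P} = restrict (helix \<zeta>) {0..P}" "0 < P" "\<not> straight \<xi>"
  shows "\<xi> = \<zeta>"
proof -
  have "helix \<xi> t = helix \<zeta> t" if "t \<in> {0..P}" for t using fun_cong[OF assms(1), of t] that by simp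
  then show ?thesis using helix_eq_imp[OF assms(2), of \<xi> \<zeta>] assms(3) by blast
qed

text \<open>The two geodesics to an oblique cut point are exchanged by \<alpha> -> - \<alpha>. In
  the case of equality \<alpha> = 0, so they coincide, and this coincidence is at the same time the
  degeneracy of the exponential map.\<close>

theorem theorem4p3:
  shows "(cut_locus :: 'n::finite pgroup set) =
      {(0, 0, y) | y. y \<noteq> 0} \<union>
      {(0, l, y) | l y. wedge_nonzero l y \<and>
         pi * norm y * (cos (angle l y))\<^sup>2 \<le> (norm l)\<^sup>2 * sin (angle l y)}
    \<and> (\<forall>(\<gamma> :: real \<Rightarrow> 'n pgroup) T l y.
        geodesic \<gamma> \<and> cut_time \<gamma> = ereal T \<and> \<gamma> T = (0, l, y) \<longrightarrow>
        T = (if wedge_nonzero l y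
             then sqrt (4 * pi * norm y * sin (angle l y) + (norm l)\<^sup>2)
             else sqrt (4 * pi * norm y)))
    \<and> (\<forall>y :: real ^ 'n. (0, 0, y) \<in> cut_locus \<longrightarrow>
        infinite (optimal_geodesics (0, 0, y)) \<and>
        (\<forall>T \<gamma>. optimal_geodesic (0, 0, y) T \<gamma> \<longrightarrow> ends_at_first_conjugate_point T \<gamma>))
    \<and> (\<forall>l y :: real ^ 'n. (0, l, y) \<in> cut_locus \<and> wedge_nonzero l y \<longrightarrow>
        (\<exists>\<gamma>\<^sub>1 \<gamma>\<^sub>2. optimal_geodesics (0, l, y) = {\<gamma>\<^sub>1, \<gamma>\<^sub>2} \<and>
           (\<gamma>\<^sub>1 = \<gamma>\<^sub>2 \<longleftrightarrow>
             pi * norm y * (cos (angle l y))\<^sup>2 = (norm l)\<^sup>2 * sin (angle l y))) \<and>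
        (\<forall>T \<gamma>. optimal_geodesic (0, l, y) T \<gamma> \<longrightarrow>
           (ends_at_first_conjugate_point T \<gamma> \<longleftrightarrow>
             pi * norm y * (cos (angle l y))\<^sup>2 = (norm l)\<^sup>2 * sin (angle l y))))"
proof (intro conjI)
  let ?A = "{(0, 0, y) | y :: real ^ 'n. y \<noteq> 0}"
  let ?B = "{(0, l, y) | l y :: real ^ 'n. wedge_nonzero l y \<and>
         pi * norm y * (cos (angle l y))\<^sup>2 \<le> (norm l)\<^sup>2 * sin (angle l y)}"
  show "cut_locus = ?A \<union> ?B"
  proof (intro equalityI subsetI)
    fix q :: "'n pgroup" assume "q \<in> cut_locus"
    then obtain \<alpha> \<beta> v e w where c: "adapted v e w" "unit_covector (covec \<alpha> \<beta> v e w)" "\<alpha> \<noteq> 0 \<or> \<beta> \<noteq> 0"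
      "q = helix (covec \<alpha> \<beta> v e w) (2 * pi / w)" unfolding cut_locus_covec by blast
    obtain l y where q: "q = (0, l, y)" using c(4) helix_covec_period[OF c(1) refl, of \<alpha> \<beta>] by simp
    note cp = cut_point_covec[OF c(1,2,3) refl c(4)[symmetric, unfolded q]]
    show "q \<in> ?A \<union> ?B"
    proof (cases "v = 0")
      case True
      then show ?thesis using cp(1,3) q by simp
    next
      case False
      then show ?thesis using cp(2,4) q by blast
    qed
  next
    fix q :: "'n pgroup" assume "q \<in> ?A \<union> ?B"
    then show "q \<in> cut_locus" using vertical_in_cut_locus oblique_in_cut_locus by blast
  qed
next
  show "\<forall>(\<gamma> :: real \<Rightarrow> 'n pgroup) T l y.
        geodesic \<gamma> \<and> cut_time \<gamma> = ereal T \<and> \<gamma> T = (0, l, y) \<longrightarrow>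
        T = (if wedge_nonzero l y
             then sqrt (4 * pi * norm y * sin (angle l y) + (norm l)\<^sup>2)
             else sqrt (4 * pi * norm y))"
  proof (intro allI impI)
    fix \<gamma> :: "real \<Rightarrow> 'n pgroup" and T l y
    assume g: "geodesic \<gamma> \<and> cut_time \<gamma> = ereal T \<and> \<gamma> T = (0, l, y)"
    then obtain \<xi> where \<xi>: "unit_covector \<xi>" "\<not> straight \<xi>" "T = 2 * pi / norm (snd (snd \<xi>))"
      "\<And>t. t \<ge> 0 \<Longrightarrow> \<gamma> t = helix \<xi> t" using geodesic_cut_time[of \<gamma> T] by blast
    have "snd (snd \<xi>) \<noteq> 0" using \<xi>(2) by (auto simp: straight_def)
    from covec_exists[OF this] obtain \<alpha> \<beta> v e w where c: "\<xi> = covec \<alpha> \<beta> v e w" "adapted v e w" by blast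
    have w: "norm (snd (snd \<xi>)) = w" using adaptedD(6)[OF c(2)] by (simp add: c covec_def)
    have T: "T = 2 * pi / w" using \<xi>(3) w by simp
    have ns: "\<alpha> \<noteq> 0 \<or> \<beta> \<noteq> 0" using \<xi>(2) unfolding c(1) straight_covec[OF c(2)] by blast
    have "helix (covec \<alpha> \<beta> v e w) T = (0, l, y)"
      using g \<xi>(4)[of T] T adaptedD(4)[OF c(2)] by (simp add: c)
    from cut_point_covec(6)[OF c(2) \<xi>(1)[unfolded c(1)] ns T this]
    show "T = (if wedge_nonzero l y then sqrt (4 * pi * norm y * sin (angle l y) + (norm l)\<^sup>2)
             else sqrt (4 * pi * norm y))" .
  qed
next
  show "\<forall>y :: real ^ 'n. (0, 0, y) \<in> cut_locus \<longrightarrow>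
        infinite (optimal_geodesics (0, 0, y)) \<and>
        (\<forall>T \<gamma>. optimal_geodesic (0, 0, y) T \<gamma> \<longrightarrow> ends_at_first_conjugate_point T \<gamma>)"
  proof (rule allI, rule impI)
    fix y :: "real ^ 'n" assume "(0, 0, y) \<in> cut_locus"
    then obtain \<alpha> \<beta> v e w where c: "adapted v e w" "unit_covector (covec \<alpha> \<beta> v e w)" "\<alpha> \<noteq> 0 \<or> \<beta> \<noteq> 0"
      "helix (covec \<alpha> \<beta> v e w) (2 * pi / w) = (0, 0, y)" unfolding cut_locus_covec by metis
    define P where P: "P = 2 * pi / w"
    have P0: "P > 0" using adaptedD(4)[OF c(1)] by (simp add: P)
    have v: "v = 0" using cut_point_covec(1)[OF c(1,2,3) P c(4)[folded P]] P0 by simp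
    have r: "\<alpha>\<^sup>2 + \<beta>\<^sup>2 = 1" using c(2) unfolding unit_covec[OF c(1)] by (simp add: v)
    note opt = optimal_geodesic_covec_iff[OF c(1,2) P, unfolded c(4)[folded P] r]
    \<comment> \<open>As v = 0, every point (\<alpha>, \<beta>) of the unit circle gives an optimal
      geodesic. An arc of that circle is parametrized by \<beta> = s, and distinct s give distinct
      curves because these helices are not straight.\<close>
    define F where "F s = restrict (helix (covec (sqrt (1 - s\<^sup>2)) s v e w)) {0..P}" for s
    have "inj_on F {0<..1}"
    proof (rule inj_onI)
      fix s s' assume s: "s \<in> {0<..1}" "s' \<in> {0<..1}" "F s = F s'"
      have "\<not> straight (covec (sqrt (1 - s\<^sup>2)) s v e w)" unfolding straight_covec[OF c(1)] using s by simp
      from restrict_helix_eq[OF s(3)[unfolded F_def] P0 this]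
      have "s *\<^sub>R e = s' *\<^sub>R e" by (simp add: covec_def)
      then show "s = s'" using adaptedD(5)[OF c(1)] by simp
    qed
    moreover have "infinite {0<..1::real}" by (rule infinite_Ioc) simp
    ultimately have "infinite (F ` {0<..1})" using finite_imageD by blast
    moreover have "F ` {0<..1} \<subseteq> optimal_geodesics (0, 0, y)"
    proof
      fix \<gamma> assume "\<gamma> \<in> F ` {0<..1}"
      then obtain s where s: "0 < s" "s \<le> 1" "\<gamma> = F s" by auto
      have "(sqrt (1 - s\<^sup>2))\<^sup>2 + s\<^sup>2 = 1" using s by (simp add: power_le_one)
      then have "optimal_geodesic (0, 0, y) P \<gamma>" unfolding opt using s(3) v by (auto simp: F_def)
      then show "\<gamma> \<in> optimal_geodesics (0, 0, y)" by (auto simp: optimal_geodesics_def)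
    qed
    ultimately have "infinite (optimal_geodesics (0, 0, y))" using infinite_super by blast
    moreover have "ends_at_first_conjugate_point T \<gamma>" if "optimal_geodesic (0, 0, y) T \<gamma>" for T \<gamma>
    proof -
      obtain \<alpha>' \<beta>' where o: "T = P" "\<alpha>'\<^sup>2 + \<beta>'\<^sup>2 = 1" "\<gamma> = restrict (helix (covec \<alpha>' \<beta>' v e w)) {0..P}"
        using \<open>optimal_geodesic (0, 0, y) T \<gamma>\<close> unfolding opt by blast
      have "\<alpha>' \<noteq> 0 \<or> \<beta>' \<noteq> 0" using o(2) by auto
      moreover have "unit_covector (covec \<alpha>' \<beta>' v e w)" unfolding unit_covec[OF c(1)] using o(2) v by simp
      ultimately show ?thesis
        using ends_at_first_conjugate_point_covec[OF c(1), of \<alpha>' \<beta>' P \<gamma>] P v o by simp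
    qed
    ultimately show "infinite (optimal_geodesics (0, 0, y)) \<and>
        (\<forall>T \<gamma>. optimal_geodesic (0, 0, y) T \<gamma> \<longrightarrow> ends_at_first_conjugate_point T \<gamma>)" by blast
  qed
next
  show "\<forall>l y :: real ^ 'n. (0, l, y) \<in> cut_locus \<and> wedge_nonzero l y \<longrightarrow>
        (\<exists>\<gamma>\<^sub>1 \<gamma>\<^sub>2. optimal_geodesics (0, l, y) = {\<gamma>\<^sub>1, \<gamma>\<^sub>2} \<and>
           (\<gamma>\<^sub>1 = \<gamma>\<^sub>2 \<longleftrightarrow>
             pi * norm y * (cos (angle l y))\<^sup>2 = (norm l)\<^sup>2 * sin (angle l y))) \<and>
        (\<forall>T \<gamma>. optimal_geodesic (0, l, y) T \<gamma> \<longrightarrow>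
           (ends_at_first_conjugate_point T \<gamma> \<longleftrightarrow>
             pi * norm y * (cos (angle l y))\<^sup>2 = (norm l)\<^sup>2 * sin (angle l y)))"
  proof (rule allI, rule allI, rule impI)
    fix l y :: "real ^ 'n" assume cl: "(0, l, y) \<in> cut_locus \<and> wedge_nonzero l y"
    then obtain \<alpha> \<beta> v e w where c: "adapted v e w" "unit_covector (covec \<alpha> \<beta> v e w)" "\<alpha> \<noteq> 0 \<or> \<beta> \<noteq> 0"
      "helix (covec \<alpha> \<beta> v e w) (2 * pi / w) = (0, l, y)" unfolding cut_locus_covec by metis
    define P where P: "P = 2 * pi / w"
    have P0: "P > 0" using adaptedD(4)[OF c(1)] by (simp add: P)
    note cp = cut_point_covec[OF c(1,2,3) P c(4)[folded P]]
    have v: "v \<noteq> 0" using cp(2) cl by simp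
    note opt = optimal_geodesic_covec_iff[OF c(1,2) P, unfolded c(4)[folded P]]
    define G where "G \<alpha> = restrict (helix (covec \<alpha> \<beta> v e w)) {0..P}" for \<alpha>
    \<comment> \<open>Since v \<noteq> 0, the equation for \<beta> v fixes \<beta>, and the
      remaining one leaves only the sign of \<alpha>.\<close>
    have opt': "optimal_geodesic (0, l, y) T \<gamma> \<longleftrightarrow> T = P \<and> (\<gamma> = G \<alpha> \<or> \<gamma> = G (- \<alpha>))" for T \<gamma>
    proof -
      have "\<alpha>'\<^sup>2 + \<beta>'\<^sup>2 = \<alpha>\<^sup>2 + \<beta>\<^sup>2 \<and> \<beta>' *\<^sub>R v = \<beta> *\<^sub>R v \<longleftrightarrow> \<beta>' = \<beta> \<and> (\<alpha>' = \<alpha> \<or> \<alpha>' = - \<alpha>)" for \<alpha>' \<beta>'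
        using v by (auto simp: power2_eq_iff)
      note * = this
      show ?thesis unfolding opt G_def conj_assoc[symmetric] * by blast
    qed
    have "optimal_geodesics (0, l, y) = {G \<alpha>, G (- \<alpha>)}"
      unfolding optimal_geodesics_def opt' by blast
    moreover have "G \<alpha> = G (- \<alpha>) \<longleftrightarrow> \<alpha> = 0"
    proof
      assume "G \<alpha> = G (- \<alpha>)"
      then have "covec \<alpha> \<beta> v e w = covec (- \<alpha>) \<beta> v e w"
        unfolding G_def using P0 straight_covec[OF c(1)] c(3) by (intro restrict_helix_eq) auto
      then show "\<alpha> = 0" by (simp add: covec_def)
    qed simp
    moreover have "ends_at_first_conjugate_point T \<gamma> \<longleftrightarrow> \<alpha> = 0" if "optimal_geodesic (0, l, y) T \<gamma>" for T \<gamma>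
    proof -
      obtain \<alpha>' where o: "T = P" "\<alpha>' = \<alpha> \<or> \<alpha>' = - \<alpha>" "\<gamma> = G \<alpha>'"
        using \<open>optimal_geodesic (0, l, y) T \<gamma>\<close> unfolding opt' by blast
      have "\<alpha>' \<noteq> 0 \<or> \<beta> \<noteq> 0" "unit_covector (covec \<alpha>' \<beta> v e w)"
        using o(2) c(2,3) unfolding unit_covec[OF c(1)] by auto
      then have "ends_at_first_conjugate_point P \<gamma> \<longleftrightarrow> \<alpha>' = 0 \<or> v = 0"
        using P o(3) by (intro ends_at_first_conjugate_point_covec[OF c(1)]) (auto simp: G_def)
      then show ?thesis using o v by auto
    qed
    ultimately show "(\<exists>\<gamma>\<^sub>1 \<gamma>\<^sub>2. optimal_geodesics (0, l, y) = {\<gamma>\<^sub>1, \<gamma>\<^sub>2} \<and>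
           (\<gamma>\<^sub>1 = \<gamma>\<^sub>2 \<longleftrightarrow>
             pi * norm y * (cos (angle l y))\<^sup>2 = (norm l)\<^sup>2 * sin (angle l y))) \<and>
        (\<forall>T \<gamma>. optimal_geodesic (0, l, y) T \<gamma> \<longrightarrow>
           (ends_at_first_conjugate_point T \<gamma> \<longleftrightarrow>
             pi * norm y * (cos (angle l y))\<^sup>2 = (norm l)\<^sup>2 * sin (angle l y)))"
      unfolding cp(5)[OF v] by blast
  qed
qed

end
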